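(* Let $X$ be a complex Banach space, $\{T_h\}\in C_b((0,1],B(X))$, and let $\Omega\subset\mathbb{C}$ be an open set containing $\bigcup_{h\in(0,1]}Sp(T_h)$. Then for every analytic function $f:\Omega\to\mathbb{C}$, $$Sp(\{f(T_h)\})=f(Sp(\{T_h\})),$$ where $f(T_h)$ is defined by the holomorphic functional calculus.
   Context: $B(X)$ is the algebra of bounded linear operators on $X$; $Sp(T)$ is the usual spectrum of $T\in B(X)$, and for $f$ analytic on an open neighbourhood of $Sp(T)$, $f(T)=\frac{1}{2\pi i}\int_\gamma f(\lambda)(\lambda I-T)^{-1}d\lambda$ with $\gamma$ a contour enclosing $Sp(T)$ in the domain of $f$. $C_b((0,1],B(X))$ denotes the set of families $\{T_h\}_{h\in(0,1]}\subset B(X)$ with $\sup_h\|T_h\|<\infty$. For a family $\{S_h\}$ of bounded operators, its resolvent set is $r(\{S_h\})=\{\lambda\in\mathbb{C}:\ \exists\{\mathcal{R}(\lambda,S_h)\}\in C_b((0,1],B(X))$ with $\lim_{h\to0}\|(\lambda I-S_h)\mathcal{R}(\lambda,S_h)-I\|=\lim_{h\to0}\|\mathcal{R}(\lambda,S_h)(\lambda I-S_h)-I\|=0\}$, and its spectrum is $Sp(\{S_h\})=\mathbb{C}\setminus r(\{S_h\})$.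
   Formalization: The formal theorem additionally assumes that Sp({T_h}) is contained in Ω; without this f(Sp({T_h})) is undefined, e.g. X = ℂ, T_h = h, Ω = ℂ∖{0}, f(z) = 1/z, where Sp({T_h}) = {0}. *)

theory Defs
  imports "HOL-Complex_Analysis.Complex_Analysis"
begin

class complex_banach = banach +
  fixes cscale :: "complex \<Rightarrow> 'a \<Rightarrow> 'a"
  assumes cscale_of_real: "cscale (complex_of_real r) x = r *\<^sub>R x"
    and cscale_add_right: "cscale c (x + y) = cscale c x + cscale c y"
    and cscale_add_left: "cscale (a + b) x = cscale a x + cscale b x"
    and cscale_cscale: "cscale a (cscale b x) = cscale (a * b) x"
    and cscale_one: "cscale 1 x = x"
    and norm_cscale: "norm (cscale c x) = cmod c * norm x"

instantiation complex :: complex_banach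
begin
definition cscale_complex :: "complex \<Rightarrow> complex \<Rightarrow> complex" where
  "cscale_complex c x = c * x"
instance
  by standard (auto simp: cscale_complex_def scaleR_conv_of_real algebra_simps norm_mult)
end

definition bop :: "('a::complex_banach \<Rightarrow> 'a) \<Rightarrow> bool" where
  "bop T \<longleftrightarrow> bounded_linear T \<and> (\<forall>c x. T (cscale c x) = cscale c (T x))"

definition is_resolvent :: "complex \<Rightarrow> ('a::complex_banach \<Rightarrow> 'a) \<Rightarrow> ('a \<Rightarrow> 'a) \<Rightarrow> bool" where
  "is_resolvent l T S \<longleftrightarrow> bop S \<and> (\<forall>x. cscale l (S x) - T (S x) = x) \<and> (\<forall>x. S (cscale l x - T x) = x)"

definition sp :: "('a::complex_banach \<Rightarrow> 'a) \<Rightarrow> complex set" where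
  "sp T = {l. \<not> (\<exists>S. is_resolvent l T S)}"

definition resolv :: "complex \<Rightarrow> ('a::complex_banach \<Rightarrow> 'a) \<Rightarrow> ('a \<Rightarrow> 'a)" where
  "resolv l T = (SOME S. is_resolvent l T S)"

definition admissible_cycle :: "complex set \<Rightarrow> complex set \<Rightarrow> (real \<Rightarrow> complex) list \<Rightarrow> bool" where
  "admissible_cycle Om K \<Gamma> \<longleftrightarrow>
     (\<forall>g\<in>set \<Gamma>. valid_path g \<and> pathfinish g = pathstart g \<and> path_image g \<subseteq> Om - K) \<and>
     (\<forall>z\<in>K. (\<Sum>g\<leftarrow>\<Gamma>. winding_number g z) = 1) \<and>
     (\<forall>z. z \<notin> Om \<longrightarrow> (\<Sum>g\<leftarrow>\<Gamma>. winding_number g z) = 0)"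

text \<open>f(T) = 1/(2 pi i) \<integral>_gamma f(l) (l I - T)^{-1} dl, evaluated strongly (pointwise in x),
where gamma is a chosen admissible cycle for Sp(T) in Om.\<close>
definition hfc :: "complex set \<Rightarrow> (complex \<Rightarrow> complex) \<Rightarrow> ('a::complex_banach \<Rightarrow> 'a) \<Rightarrow> ('a \<Rightarrow> 'a)" where
  "hfc Om f T = (let \<Gamma> = (SOME \<Gamma>. admissible_cycle Om (sp T) \<Gamma>) in
     (\<lambda>x. cscale (1 / (2 * of_real pi * \<i>))
        (\<Sum>g\<leftarrow>\<Gamma>. integral {0..1}
            (\<lambda>t. cscale (f (g t) * vector_derivative g (at t within {0..1})) (resolv (g t) T x)))))"

definition bounded_family :: "(real \<Rightarrow> 'a::complex_banach \<Rightarrow> 'a) \<Rightarrow> bool" where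
  "bounded_family R \<longleftrightarrow> (\<forall>h\<in>{0<..1}. bop (R h)) \<and> (\<exists>M. \<forall>h\<in>{0<..1}. onorm (R h) \<le> M)"

definition fam_resolvent_set :: "(real \<Rightarrow> 'a::complex_banach \<Rightarrow> 'a) \<Rightarrow> complex set" where
  "fam_resolvent_set S = {l. \<exists>R. bounded_family R \<and>
      ((\<lambda>h. onorm (\<lambda>x. cscale l (R h x) - S h (R h x) - x)) \<longlongrightarrow> 0) (at_right 0) \<and>
      ((\<lambda>h. onorm (\<lambda>x. R h (cscale l x - S h x) - x)) \<longlongrightarrow> 0) (at_right 0)}"

definition fam_sp :: "(real \<Rightarrow> 'a::complex_banach \<Rightarrow> 'a) \<Rightarrow> complex set" where
  "fam_sp S = - fam_resolvent_set S"

end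

theory Submission
  imports Defs
begin

text \<open>
  A point outside the spectrum of the family is, for all small \<open>h\<close>, outside \<open>sp (T h)\<close> with resolvents bounded
  uniformly in \<open>h\<close>, and by compactness this is locally uniform in the point. Hence the spectrum of the
  family is compact, and one cycle around it in \<open>Om\<close> computes \<open>f(T h)\<close> for all small \<open>h\<close> with uniform bounds.
  The theorem then follows from identities for single operators. If \<open>\<mu>\<close> is not a value of \<open>f\<close> on the
  spectrum of the family, \<open>(1 / (\<mu> - f))(T h)\<close> is a bounded resolvent of \<open>f(T h)\<close>. Conversely,
  \<open>f l - f w = (l - w) k w\<close> gives \<open>f l - f(T h) = (l - T h) k(T h)\<close> with commuting factors, so a
  resolvent of \<open>f(T h)\<close> at \<open>f l\<close> yields one of \<open>T h\<close> at \<open>l\<close>.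

  Vector-valued integrals are reduced to scalar ones by a Hahn--Banach separation argument, and the
  independence of the chosen cycle comes from the homology form of Cauchy's theorem for cycles.
\<close>

section \<open>Separation by bounded functionals\<close>

text \<open>Operators are plain functions satisfying \<open>bop\<close>, so the integral in
  \<open>hfc\<close> is taken pointwise in \<open>x\<close>, and boundedness is carried along as
  inequalities \<open>norm (S x) \<le> C * norm x\<close> with an explicit \<open>C\<close>;
  uniformity in \<open>h\<close> means that \<open>C\<close> is chosen before \<open>h\<close>. Two
  features of \<open>hfc\<close> shape the proof. Its cycle is picked by \<open>SOME\<close>
  separately for each operator, so nothing can be estimated until this cycle is exchanged for a
  known one, and two admissible cycles are merely homologous. Moreover its paths are only valid
  paths, whose derivative may be unbounded, so the uniform norm bounds and the interchange of
  integrals are carried out on cycles of polynomial paths. The spectrum of a family only sees the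
  behaviour as \<open>h\<close> tends to 0. A Neumann argument therefore corrects approximate
  resolvents to exact ones for small \<open>h\<close>. The hypothesis
  \<open>fam_sp T \<subseteq> Om\<close> is what provides a compact set inside \<open>Om\<close> for
  the common cycle to surround.\<close>

definition sublinear :: "('a::real_vector \<Rightarrow> real) \<Rightarrow> bool" where
  "sublinear p \<longleftrightarrow> (\<forall>x y. p (x + y) \<le> p x + p y) \<and> (\<forall>t\<ge>0. \<forall>x. p (t *\<^sub>R x) = t * p x)"

lemma sublinearD:
  assumes "sublinear p"
  shows "p (x + y) \<le> p x + p y" "t \<ge> 0 \<Longrightarrow> p (t *\<^sub>R x) = t * p x" "p 0 = 0" "- p (- x) \<le> p x"
proof -
  show "p (x + y) \<le> p x + p y" for x y using assms by (auto simp: sublinear_def)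
  note add = this
  show "t \<ge> 0 \<Longrightarrow> p (t *\<^sub>R x) = t * p x" for t x using assms by (auto simp: sublinear_def)
  from this[of 0 0] show z: "p 0 = 0" by simp
  show "- p (- x) \<le> p x" using add[of x "- x"] z by simp
qed

text \<open>Tilting \<open>p\<close> in the direction \<open>a\<close>; a minimal sublinear functional is not changed by this,
  which makes it additive.\<close>

lemma sublinear_tilt:
  fixes p :: "'a::real_vector \<Rightarrow> real"
  assumes p: "sublinear p"
  obtains q where "sublinear q" "q \<le> p" "\<And>x t. t \<ge> 0 \<Longrightarrow> q x \<le> p (x + t *\<^sub>R a) - t * p a"
proof -
  define q where "q x = (INF t\<in>{0..}. p (x + t *\<^sub>R a) - t * p a)" for x
  \<comment> \<open>Since \<open>t * p a = p (t *\<^sub>R a)\<close>, subadditivity gives a lower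
    bound independent of \<open>t\<close>, so the infimum defining \<open>q\<close> is
    finite.\<close>
  have low: "- p (- x) \<le> p (x + t *\<^sub>R a) - t * p a" if "t \<ge> 0" for x t
    using sublinearD(1)[OF p, of "x + t *\<^sub>R a" "- x"] sublinearD(2)[OF p that, of a] by simp
  then have bdd: "bdd_below ((\<lambda>t. p (x + t *\<^sub>R a) - t * p a) ` {0..})" for x
    by (intro bdd_belowI2) auto
  have le: "q x \<le> p (x + t *\<^sub>R a) - t * p a" if "t \<ge> 0" for x t
    unfolding q_def by (rule cINF_lower[OF bdd]) (use that in auto)
  have ge: "c \<le> q x" if "\<And>t. t \<ge> 0 \<Longrightarrow> c \<le> p (x + t *\<^sub>R a) - t * p a" for x c
    unfolding q_def by (rule cINF_greatest) (use that in auto)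
  have add: "q (x + y) \<le> q x + q y" for x y
  proof -
    have "q (x + y) - q y \<le> q x"
    proof (rule ge)
      fix t :: real assume t: "t \<ge> 0"
      have "q (x + y) - (p (x + t *\<^sub>R a) - t * p a) \<le> q y"
      proof (rule ge)
        fix s :: real assume s: "s \<ge> 0"
        have "q (x + y) \<le> p ((x + y) + (t + s) *\<^sub>R a) - (t + s) * p a"
          using le s t by (meson add_nonneg_nonneg)
        also have "p ((x + y) + (t + s) *\<^sub>R a) \<le> p (x + t *\<^sub>R a) + p (y + s *\<^sub>R a)"
          using sublinearD(1)[OF p, of "x + t *\<^sub>R a" "y + s *\<^sub>R a"] by (simp add: algebra_simps)
        finally show "q (x + y) - (p (x + t *\<^sub>R a) - t * p a) \<le> p (y + s *\<^sub>R a) - s * p a"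
          by (simp add: algebra_simps)
      qed
      then show "q (x + y) - q y \<le> p (x + t *\<^sub>R a) - t * p a" by simp
    qed
    then show ?thesis by simp
  qed
  have scale_le: "c * q x \<le> q (c *\<^sub>R x)" if c: "c > 0" for c x
  proof (rule ge)
    fix t :: real assume t: "t \<ge> 0"
    have "c * q x \<le> c * (p (x + (t / c) *\<^sub>R a) - (t / c) * p a)"
      using le[of "t / c" x] c t by (intro mult_left_mono) auto
    also have "\<dots> = c * p (x + (t / c) *\<^sub>R a) - t * p a"
      using c by (simp add: field_simps)
    also have "c * p (x + (t / c) *\<^sub>R a) = p (c *\<^sub>R x + t *\<^sub>R a)"
      using sublinearD(2)[OF p, of c "x + (t / c) *\<^sub>R a"] c by (simp add: algebra_simps)
    finally show "c * q x \<le> p (c *\<^sub>R x + t *\<^sub>R a) - t * p a" .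
  qed
  have scale: "q (c *\<^sub>R x) = c * q x" if c: "c > 0" for c x
  proof (rule antisym)
    show "q (c *\<^sub>R x) \<le> c * q x"
      using scale_le[of "1 / c" "c *\<^sub>R x"] c by (simp add: field_simps)
  qed (rule scale_le[OF c])
  have zero: "q 0 = 0"
    using le[of 0 0] ge[of 0 0] low[of _ 0] sublinearD(3)[OF p] by fastforce
  have "sublinear q"
    unfolding sublinear_def
  proof (intro conjI allI impI add)
    fix c :: real and x assume "c \<ge> 0"
    then show "q (c *\<^sub>R x) = c * q x"
      using scale[of c x] zero by (cases "c = 0") auto
  qed
  moreover have "q \<le> p"
    by (rule le_funI) (use le[of 0] in simp)
  ultimately show ?thesis using le that by blast
qed

text \<open>Zorn's lemma for the reversed pointwise order. A nonempty chain is bounded by its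
  pointwise infimum, which is finite because every sublinear \<open>q \<le> p\<close> satisfies
  \<open>- p (- x) \<le> q x\<close>; the empty chain is bounded by \<open>p\<close>.\<close>

lemma sublinear_below_minimal:
  fixes p :: "'a::real_vector \<Rightarrow> real"
  assumes p: "sublinear p"
  obtains u where "sublinear u" "u \<le> p" "\<And>q. sublinear q \<Longrightarrow> q \<le> u \<Longrightarrow> q = u"
proof -
  define A where "A = {q. sublinear q \<and> q \<le> p}"
  let ?P = "\<lambda>a b :: 'a \<Rightarrow> real. b \<le> a"
  have "\<exists>m \<in> A. \<forall>a \<in> A. ?P m a \<longrightarrow> a = m"
  proof (rule predicate_Zorn)
    show "partial_order_on A (relation_of ?P A)"
      by (rule partial_order_on_relation_ofI) auto
  next
    fix C assume C: "C \<in> Chains (relation_of ?P A)"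
    have CA: "sublinear q" "q \<le> p" if "q \<in> C" for q
      using C that by (auto simp: Chains_def relation_of_def A_def)
    have tot: "q \<le> r \<or> r \<le> q" if "q \<in> C" "r \<in> C" for q r
      using C that by (auto simp: Chains_def relation_of_def)
    show "\<exists>u \<in> A. \<forall>a \<in> C. ?P a u"
    proof (cases "C = {}")
      case True
      then show ?thesis using p by (auto simp: A_def)
    next
      case False
      define u where "u x = (INF q\<in>C. q x)" for x
      have bdd: "bdd_below ((\<lambda>q. q x) ` C)" for x
      proof (rule bdd_belowI2)
        fix q assume q: "q \<in> C"
        show "- p (- x) \<le> q x"
          using sublinearD(4)[OF CA(1)[OF q], of x] CA(2)[OF q, THEN le_funD, of "- x"] by linarith
      qed
      have le: "u x \<le> q x" if "q \<in> C" for x q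
        unfolding u_def by (rule cINF_lower[OF bdd that])
      have ge: "c \<le> u x" if "\<And>q. q \<in> C \<Longrightarrow> c \<le> q x" for x c
        unfolding u_def by (rule cINF_greatest[OF False]) (rule that)
      have add: "u (x + y) \<le> u x + u y" for x y
      proof -
        have "u (x + y) - u y \<le> u x"
        proof (rule ge)
          fix q assume q: "q \<in> C"
          have "u (x + y) - q x \<le> u y"
          proof (rule ge)
            fix r assume r: "r \<in> C"
            \<comment> \<open>Subadditivity survives the infimum because \<open>q\<close> and
              \<open>r\<close> are comparable: the smaller of them gives
              \<open>u (x + y) \<le> s x + s y \<le> q x + r y\<close>.\<close>
            obtain s where s: "s \<in> C" "s \<le> q" "s \<le> r" using tot[OF q r] q r by blast
            have "u (x + y) \<le> s x + s y"
              using le[OF s(1), of "x + y"] sublinearD(1)[OF CA(1)[OF s(1)], of x y] by linarith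
            then show "u (x + y) - q x \<le> r y"
              using s(2)[THEN le_funD, of x] s(3)[THEN le_funD, of y] by linarith
          qed
          then show "u (x + y) - u y \<le> q x" by simp
        qed
        then show ?thesis by simp
      qed
      have scale_le: "c * u x \<le> u (c *\<^sub>R x)" if c: "c \<ge> 0" for c x
      proof (rule ge)
        fix q assume q: "q \<in> C"
        show "c * u x \<le> q (c *\<^sub>R x)"
          using sublinearD(2)[OF CA(1)[OF q] c, of x] mult_left_mono[OF le[OF q] c] by simp
      qed
      have scale: "u (c *\<^sub>R x) = c * u x" if c: "c > 0" for c x
        using scale_le[of "1 / c" "c *\<^sub>R x"] scale_le[of c x] c by (simp add: field_simps)
      have zero: "u 0 = 0"
      proof -
        obtain q where q: "q \<in> C" using False by auto
        show ?thesis
          using le[OF q, of 0] ge[of 0 0] sublinearD(3)[OF CA(1)] q by fastforce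
      qed
      have "sublinear u"
        unfolding sublinear_def
      proof (intro conjI allI impI add)
        fix c :: real and x assume "c \<ge> 0"
        then show "u (c *\<^sub>R x) = c * u x"
          using scale[of c x] zero by (cases "c = 0") auto
      qed
      moreover have "u \<le> p"
        using False le CA(2) by (fastforce simp: le_fun_def intro: order_trans)
      ultimately show ?thesis using le by (auto simp: A_def le_fun_def)
    qed
  qed
  then obtain m where m: "m \<in> A" "\<And>a. a \<in> A \<Longrightarrow> a \<le> m \<Longrightarrow> a = m" by blast
  show ?thesis
    by (rule that[of m]) (use m in \<open>auto simp: A_def intro: order_trans\<close>)
qed

lemma linear_below_sublinear:
  fixes p :: "'a::real_vector \<Rightarrow> real"
  assumes p: "sublinear p"
  obtains u where "linear u" "u \<le> p"
proof -
  obtain u where u: "sublinear u" "u \<le> p" and min: "\<And>q. sublinear q \<Longrightarrow> q \<le> u \<Longrightarrow> q = u"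
    using sublinear_below_minimal[OF p] by metis
  have add: "u (x + a) = u x + u a" for x a
  proof -
    obtain q where q: "sublinear q" "q \<le> u" "\<And>x t. t \<ge> 0 \<Longrightarrow> q x \<le> u (x + t *\<^sub>R a) - t * u a"
      using sublinear_tilt[OF u(1), of a] by metis
    then have "u x \<le> u (x + a) - u a" using min[OF q(1,2)] q(3)[of 1 x] by simp
    then show ?thesis using sublinearD(1)[OF u(1), of x a] by linarith
  qed
  have neg: "u (- x) = - u x" for x
    using add[of x "- x"] sublinearD(3)[OF u(1)] by simp
  have "u (c *\<^sub>R x) = c * u x" for c x
  proof (cases "c \<ge> 0")
    case True
    then show ?thesis using sublinearD(2)[OF u(1)] by simp
  next
    case False
    then show ?thesis using sublinearD(2)[OF u(1), of "- c" x] neg[of "c *\<^sub>R x"] by simp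
  qed
  then have "linear u" by (intro linearI) (simp_all add: add)
  then show ?thesis using u(2) that by blast
qed

text \<open>No functional is extended from a subspace. Tilting the norm in the direction
  \<open>y\<close> already forces \<open>q (- y) \<le> - norm y\<close> (take \<open>t = 1\<close>),
  so every linear functional below \<open>q\<close> is at least \<open>norm y\<close> at
  \<open>y\<close>.\<close>

lemma real_functional_separates:
  fixes y :: "'a::real_normed_vector"
  assumes "y \<noteq> 0"
  obtains u :: "'a \<Rightarrow> real" where "linear u" "\<And>x. \<bar>u x\<bar> \<le> norm x" "u y \<noteq> 0"
proof -
  have "sublinear (norm :: 'a \<Rightarrow> real)"
    by (auto simp: sublinear_def norm_triangle_ineq)
  then obtain q where q: "sublinear q" "q \<le> norm"
      "\<And>x t. t \<ge> 0 \<Longrightarrow> q x \<le> norm (x + t *\<^sub>R y) - t * norm y"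
    using sublinear_tilt[of norm y] by metis
  obtain u where u: "linear u" "u \<le> q" using linear_below_sublinear[OF q(1)] by metis
  have le: "u x \<le> norm x" for x using u(2) q(2) by (meson le_funD order_trans)
  have "\<bar>u x\<bar> \<le> norm x" for x
    using le[of x] le[of "- x"] linear_neg[OF u(1), of x] by simp
  moreover have "u (- y) \<le> - norm y"
    using u(2)[THEN le_funD, of "- y"] q(3)[of 1 "- y"] by simp
  then have "u y \<noteq> 0" using assms linear_neg[OF u(1), of y] by auto
  ultimately show ?thesis using u(1) that by blast
qed

section \<open>Complex scalars and complex-linear functionals\<close>

lemma cscale_zero [simp]: "cscale 0 x = 0" "cscale c (0::'a::complex_banach) = 0"
  by (metis cscale_of_real of_real_0 scaleR_zero_left) (metis norm_cscale norm_eq_zero mult_zero_right norm_zero)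

lemma cscale_minus_left: "cscale (- c) x = - cscale c x"
  by (metis ab_group_add_class.ab_left_minus add_eq_0_iff cscale_add_left cscale_zero(1))

lemma cscale_minus_right: "cscale c (- x) = - cscale c x"
  by (metis ab_group_add_class.ab_left_minus add_eq_0_iff cscale_add_right cscale_zero(2))

lemma cscale_diff_right: "cscale c (x - y) = cscale c x - cscale c y"
  using cscale_add_right[of c x "- y"] by (simp add: cscale_minus_right)

lemma cscale_diff_left: "cscale (a - b) x = cscale a x - cscale b x"
  using cscale_add_left[of a "- b" x] by (simp add: cscale_minus_left)

lemma cscale_scaleR: "cscale c (r *\<^sub>R x) = r *\<^sub>R cscale c x"
  by (metis cscale_cscale cscale_of_real mult.commute)

lemma scaleR_cscale: "cscale (r *\<^sub>R c) x = r *\<^sub>R cscale c x"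
  by (metis cscale_cscale cscale_of_real scaleR_conv_of_real)

lemma bounded_linear_cscale_right: "bounded_linear (cscale c)"
  by (rule bounded_linear_intro[where K = "cmod c"])
     (simp_all add: cscale_add_right cscale_scaleR norm_cscale mult.commute)

lemma bounded_bilinear_cscale: "bounded_bilinear cscale"
  by (rule bounded_bilinear.intro)
     (auto simp: cscale_add_right cscale_add_left cscale_scaleR scaleR_cscale norm_cscale intro!: exI[of _ 1])

definition cfunctional :: "('a::complex_banach \<Rightarrow> complex) \<Rightarrow> bool" where
  "cfunctional \<phi> \<longleftrightarrow> bounded_linear \<phi> \<and> (\<forall>c x. \<phi> (cscale c x) = c * \<phi> x)"

text \<open>A real functional \<open>u\<close> is the real part of the complex-linear one
  \<open>u x - \<i> * u (\<i> x)\<close>. The constant 2 in its bound comes from estimating the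
  modulus by the sum of the real and imaginary parts.\<close>

lemma cfunctional_separates:
  fixes y :: "'a::complex_banach"
  assumes "\<And>\<phi>. cfunctional \<phi> \<Longrightarrow> \<phi> y = 0"
  shows "y = 0"
proof (rule ccontr)
  assume "y \<noteq> 0"
  then obtain u :: "'a \<Rightarrow> real" where u: "linear u" "\<And>x. \<bar>u x\<bar> \<le> norm x" "u y \<noteq> 0"
    using real_functional_separates by metis
  define \<phi> where "\<phi> x = Complex (u x) (- u (cscale \<i> x))" for x
  have "bounded_linear \<phi>"
  proof (rule bounded_linear_intro[where K = 2])
    show "\<phi> (x + y) = \<phi> x + \<phi> y" for x y
      by (simp add: \<phi>_def complex_eq_iff cscale_add_right linear_add[OF u(1)])
    show "\<phi> (r *\<^sub>R x) = r *\<^sub>R \<phi> x" for r x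
      by (simp add: \<phi>_def complex_eq_iff cscale_scaleR linear_scale[OF u(1)])
    show "norm (\<phi> x) \<le> norm x * 2" for x
      using cmod_le[of "\<phi> x"] u(2)[of x] u(2)[of "cscale \<i> x"] by (simp add: \<phi>_def norm_cscale)
  qed
  moreover have "\<phi> (cscale c x) = c * \<phi> x" for c x
  proof -
    have c: "cscale c z = Re c *\<^sub>R z + Im c *\<^sub>R cscale \<i> z" for z :: 'a
    proof -
      have "cscale c z = cscale (complex_of_real (Re c) + complex_of_real (Im c) * \<i>) z"
        by (metis complex_eq mult.commute)
      then show ?thesis
        by (metis cscale_add_left cscale_cscale cscale_of_real)
    qed
    have ii: "cscale \<i> (cscale \<i> x) = - x"
      by (simp add: cscale_cscale cscale_minus_left cscale_one)
    have "cscale \<i> (cscale c x) = Re c *\<^sub>R cscale \<i> x - Im c *\<^sub>R x"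
      unfolding c[of x] by (simp add: cscale_add_right cscale_scaleR ii)
    then show ?thesis
      by (simp add: \<phi>_def complex_eq_iff c[of x] linear_add[OF u(1)] linear_diff[OF u(1)] linear_scale[OF u(1)])
  qed
  ultimately have "\<phi> y = 0" using assms by (auto simp: cfunctional_def)
  then show False using u(3) by (simp add: \<phi>_def complex_eq_iff)
qed

section \<open>Cycles around compact sets\<close>

datatype side = South | East | North | West

lemma UNIV_side: "UNIV = {South, East, North, West}"
  using side.exhaust by auto

text \<open>A pair of a cell of the grid \<open>\<int> \<times> \<int>\<close> (named by its lower left corner) and a side of it stands for that
  side with the counterclockwise orientation; \<open>opp\<close> is the same side seen from the neighbouring cell.\<close>

fun edge :: "(int \<times> int) \<times> side \<Rightarrow> (int \<times> int) \<times> (int \<times> int)" where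
  "edge ((i, j), South) = ((i, j), (i + 1, j))"
| "edge ((i, j), East) = ((i + 1, j), (i + 1, j + 1))"
| "edge ((i, j), North) = ((i + 1, j + 1), (i, j + 1))"
| "edge ((i, j), West) = ((i, j + 1), (i, j))"

fun opp :: "(int \<times> int) \<times> side \<Rightarrow> (int \<times> int) \<times> side" where
  "opp ((i, j), South) = ((i, j - 1), North)"
| "opp ((i, j), East) = ((i + 1, j), West)"
| "opp ((i, j), North) = ((i, j + 1), South)"
| "opp ((i, j), West) = ((i - 1, j), East)"

lemma opp_opp [simp]: "opp (opp p) = p"
  by (cases p rule: opp.cases) auto

lemma edge_opp: "edge (opp p) = prod.swap (edge p)"
  by (cases p rule: opp.cases) auto

definition vtx :: "real \<Rightarrow> int \<times> int \<Rightarrow> complex" where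
  "vtx d v = Complex (d * fst v) (d * snd v)"

definition cell :: "real \<Rightarrow> int \<times> int \<Rightarrow> complex set" where
  "cell d q = cbox (vtx d q) (vtx d (fst q + 1, snd q + 1))"

definition seg :: "real \<Rightarrow> (int \<times> int) \<times> side \<Rightarrow> complex set" where
  "seg d p = closed_segment (vtx d (fst (edge p))) (vtx d (snd (edge p)))"

lemma seg_opp: "seg d (opp p) = seg d p"
  by (simp add: seg_def edge_opp closed_segment_commute)

lemma seg_subset_cell:
  assumes "d > 0" shows "seg d p \<subseteq> cell d (fst p)"
proof -
  have "vtx d (fst (edge p)) \<in> cell d (fst p)" "vtx d (snd (edge p)) \<in> cell d (fst p)"
    using assms by (cases p rule: opp.cases; simp add: cell_def vtx_def in_cbox_complex_iff algebra_simps)+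
  then show ?thesis
    unfolding seg_def by (intro closed_segment_subset) (simp_all add: cell_def)
qed

text \<open>Consequently a point with neither coordinate an integer multiple of \<open>d\<close>
  lies on no side at all; such a point is used to compute the index of the grid cycle.\<close>

lemma seg_grid_line:
  assumes "w \<in> seg d p" shows "(\<exists>i::int. Re w = d * i) \<or> (\<exists>j::int. Im w = d * j)"
proof -
  have "Re w \<in> closed_segment (Re (vtx d (fst (edge p)))) (Re (vtx d (snd (edge p))))"
       "Im w \<in> closed_segment (Im (vtx d (fst (edge p)))) (Im (vtx d (snd (edge p))))"
    using assms unfolding seg_def
    by (metis closed_segment_linear_image image_eqI bounded_linear.linear bounded_linear_Re bounded_linear_Im)+
  then show ?thesis
    by (cases p rule: opp.cases; simp add: vtx_def) (metis of_int_1 of_int_add)+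
qed

text \<open>The map \<open>opp\<close> is an involution of the bad sides that reverses orientation,
  so their sum equals its own negative.\<close>

lemma sum_edges_cancel:
  fixes G :: "(int \<times> int) \<times> (int \<times> int) \<Rightarrow> complex"
  assumes fin: "finite S"
    and opp: "\<And>p. p \<in> S \<times> UNIV \<Longrightarrow> bad p \<Longrightarrow> opp p \<in> S \<times> UNIV \<and> bad (opp p)"
    and anti: "\<And>u v. G (v, u) = - G (u, v)"
  shows "(\<Sum>p\<in>{p\<in>S \<times> UNIV. \<not> bad p}. G (edge p)) = (\<Sum>p\<in>S \<times> UNIV. G (edge p))"
proof -
  define B where "B = {p\<in>S \<times> UNIV. bad p}"
  have finU: "finite (S \<times> (UNIV :: side set))" using fin by (simp add: UNIV_side)
  have "(\<Sum>p\<in>B. G (edge p)) = (\<Sum>p\<in>B. G (edge (opp p)))"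
    by (rule sum.reindex_bij_witness[of _ opp opp]) (use opp in \<open>auto simp: B_def\<close>)
  also have "\<dots> = - (\<Sum>p\<in>B. G (edge p))"
    unfolding sum_negf[symmetric] edge_opp
    by (rule sum.cong) (metis anti prod.collapse prod.swap_def)+
  finally have "(\<Sum>p\<in>B. G (edge p)) = 0" by simp
  moreover have "{p\<in>S \<times> UNIV. \<not> bad p} = S \<times> UNIV - B" "B \<subseteq> S \<times> UNIV" by (auto simp: B_def)
  ultimately show ?thesis
    using sum.subset_diff[of B "S \<times> UNIV" "\<lambda>p. G (edge p)"] finU by simp
qed

lemma contour_integral_cell:
  assumes "d > 0" "\<And>s. continuous_on (seg d (q, s)) F"
  shows "contour_integral (rectpath (vtx d q) (vtx d (fst q + 1, snd q + 1))) F =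
    (\<Sum>s\<in>UNIV. contour_integral (linepath (vtx d (fst (edge (q, s)))) (vtx d (snd (edge (q, s))))) F)"
proof -
  obtain i j where q: "q = (i, j)" by (cases q)
  have int: "F contour_integrable_on (linepath (vtx d (fst (edge (q, s)))) (vtx d (snd (edge (q, s)))))" for s
    using assms(2)[of s] unfolding seg_def by (rule contour_integrable_continuous_linepath)
  have "rectpath (vtx d q) (vtx d (fst q + 1, snd q + 1)) =
      linepath (vtx d (i, j)) (vtx d (i + 1, j)) +++ linepath (vtx d (i + 1, j)) (vtx d (i + 1, j + 1)) +++
      linepath (vtx d (i + 1, j + 1)) (vtx d (i, j + 1)) +++ linepath (vtx d (i, j + 1)) (vtx d (i, j))"
    by (simp add: rectpath_def q vtx_def Let_def)
  then show ?thesis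
    using int[of South] int[of East] int[of North] int[of West]
    by (simp add: UNIV_side q add.assoc contour_integrable_joinI valid_path_join)
qed

lemma valid_path_in_open_connected:
  fixes S :: "complex set"
  assumes "open S" "x \<in> S" "y \<in> S" "connected S"
  obtains g where "valid_path g" "path_image g \<subseteq> S" "pathstart g = x" "pathfinish g = y"
  using connected_open_polynomial_connected[OF assms(1,4,2,3)] valid_path_polynomial_function by metis

text \<open>Each side that avoids \<open>K\<close> is closed up to a loop by paths from a base point of its component of
  \<open>W - K\<close>; these paths contribute a coboundary, which cancels together with the sides meeting \<open>K\<close>.\<close>

lemma grid_cycle:
  assumes K: "compact K" and W: "open W" and KW: "K \<subseteq> W"
  obtains \<Gamma> where
    "\<And>g. g \<in> set \<Gamma> \<Longrightarrow> valid_path g \<and> pathfinish g = pathstart g \<and> path_image g \<subseteq> W - K"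
    "\<And>F. F holomorphic_on W \<Longrightarrow> (\<Sum>g\<leftarrow>\<Gamma>. contour_integral g F) = 0"
    "\<And>z. z \<in> K \<Longrightarrow> (\<Sum>g\<leftarrow>\<Gamma>. winding_number g z) = 1"
proof -
  obtain e where e: "e > 0" "(\<Union>x\<in>K. ball x e) \<subseteq> W"
    using compact_subset_open_imp_ball_epsilon_subset[OF K W KW] by metis
  \<comment> \<open>Points of one cell differ by at most \<open>d\<close> in each coordinate, hence
    by at most \<open>2 * d < e\<close> in modulus; so a cell that meets \<open>K\<close> lies in
    \<open>W\<close>.\<close>
  define d where "d = e / 3"
  have d: "d > 0" using e by (simp add: d_def)
  define S where "S = {q. cell d q \<inter> K \<noteq> {}}"
  have cellW: "cell d q \<subseteq> W" if q: "q \<in> S" for q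
  proof
    fix w assume w: "w \<in> cell d q"
    obtain x where x: "x \<in> cell d q" "x \<in> K" using q by (auto simp: S_def)
    have "\<bar>Re (x - w)\<bar> \<le> d" "\<bar>Im (x - w)\<bar> \<le> d"
      using w x(1) by (auto simp: cell_def vtx_def in_cbox_complex_iff algebra_simps)
    then have "dist x w \<le> 2 * d" using cmod_le[of "x - w"] by (simp add: dist_norm)
    then have "w \<in> ball x e" using e(1) by (simp add: d_def)
    then show "w \<in> W" using e(2) x(2) by blast
  qed
  have finS: "finite S"
  proof -
    obtain B where B: "\<And>x. x \<in> K \<Longrightarrow> norm x \<le> B"
      using compact_imp_bounded[OF K] by (auto simp: bounded_iff)
    define N where "N = \<lceil>B / d\<rceil> + 1"
    have "S \<subseteq> {- N..N} \<times> {- N..N}"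
    proof
      fix q assume "q \<in> S"
      then obtain x where x: "x \<in> cell d q" "x \<in> K" by (auto simp: S_def)
      have "\<bar>Re x\<bar> \<le> B" "\<bar>Im x\<bar> \<le> B"
        using B[OF x(2)] abs_Re_le_cmod[of x] abs_Im_le_cmod[of x] by auto
      then have "\<bar>Re x / d\<bar> \<le> B / d" "\<bar>Im x / d\<bar> \<le> B / d"
        using d by (auto simp: divide_right_mono)
      moreover have "B / d \<le> N - 1" by (simp add: N_def)
      moreover have "fst q \<le> Re x / d" "Re x / d \<le> fst q + 1" "snd q \<le> Im x / d" "Im x / d \<le> snd q + 1"
        using x(1) d by (auto simp: cell_def vtx_def in_cbox_complex_iff field_simps)
      ultimately have "\<bar>fst q\<bar> \<le> N" "\<bar>snd q\<bar> \<le> N" by linarith+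
      then show "q \<in> {- N..N} \<times> {- N..N}" by (cases q) auto
    qed
    then show ?thesis by (rule finite_subset) simp
  qed
  define V where "V = W - K"
  have V: "open V" unfolding V_def using W compact_imp_closed[OF K] by (rule open_Diff)
  define C where "C u = connected_component_set V u" for u
  \<comment> \<open>The root is chosen as a function of the set \<open>C u\<close> rather than of
    \<open>u\<close>. The two ends of a side inside \<open>V\<close> have equal component sets,
    hence the same root, and the loop closes.\<close>
  have C_path: "\<exists>g. valid_path g \<and> path_image g \<subseteq> V \<and> pathstart g = (SOME x. x \<in> C u) \<and> pathfinish g = u"
    if "u \<in> V" for u
  proof -
    have u: "u \<in> C u" using that by (simp add: C_def)
    then have "(SOME x. x \<in> C u) \<in> C u" by (rule someI)
    moreover have "open (C u)" "connected (C u)" "C u \<subseteq> V"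
      by (simp_all add: C_def open_connected_component[OF V] connected_component_subset)
    ultimately show ?thesis
      using valid_path_in_open_connected[of "C u" "SOME x. x \<in> C u" u] u by (metis order_trans)
  qed
  define c where "c u = (SOME g. valid_path g \<and> path_image g \<subseteq> V \<and> pathstart g = (SOME x. x \<in> C u) \<and> pathfinish g = u)" for u
  have c: "valid_path (c u)" "path_image (c u) \<subseteq> V" "pathstart (c u) = (SOME x. x \<in> C u)" "pathfinish (c u) = u"
    if "u \<in> V" for u
    using someI_ex[OF C_path[OF that]] by (simp_all add: c_def)
  define bad where "bad p \<longleftrightarrow> seg d p \<inter> K \<noteq> {}" for p
  define good where "good = {p \<in> S \<times> UNIV. \<not> bad p}"
  have fin_good: "finite good" using finS by (simp add: good_def UNIV_side)
  define loop where "loop p = (let u = vtx d (fst (edge p)); v = vtx d (snd (edge p)) in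
      c u +++ linepath u v +++ reversepath (c v))" for p
  have segW: "seg d p \<subseteq> W" if "p \<in> S \<times> UNIV" for p
    using that seg_subset_cell[OF d, of p] cellW[of "fst p"] by (metis mem_Times_iff order_trans)
  have goodV: "seg d p \<subseteq> V" if "p \<in> good" for p
    using that segW[of p] by (auto simp: good_def bad_def V_def)
  have same_root: "C (vtx d (fst (edge p))) = C (vtx d (snd (edge p)))" if "p \<in> good" for p
    unfolding C_def
    by (rule connected_component_eq, simp, rule connected_componentI[of "seg d p"])
       (use goodV[OF that] in \<open>auto simp: seg_def\<close>)
  have endsV: "vtx d (fst (edge p)) \<in> V" "vtx d (snd (edge p)) \<in> V" if "p \<in> good" for p
    using goodV[OF that] by (auto simp: seg_def)
  have loop: "valid_path (loop p)" "pathfinish (loop p) = pathstart (loop p)"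
      "path_image (loop p) = path_image (c (vtx d (fst (edge p)))) \<union> seg d p \<union> path_image (c (vtx d (snd (edge p))))"
    if "p \<in> good" for p
    using c[OF endsV(1)[OF that]] c[OF endsV(2)[OF that]] same_root[OF that]
    by (auto simp: loop_def Let_def seg_def path_image_join valid_path_join)
  have loopV: "path_image (loop p) \<subseteq> V" if "p \<in> good" for p
    using loop(3)[OF that] c(2)[OF endsV(1)[OF that]] c(2)[OF endsV(2)[OF that]] goodV[OF that] by auto
  \<comment> \<open>The neighbouring cell contains the same side, so it meets \<open>K\<close> as
    well and belongs to \<open>S\<close>. Bad sides therefore never lie on the outer boundary of the
    union of cells.\<close>
  have opp_bad: "opp p \<in> S \<times> UNIV \<and> bad (opp p)" if "p \<in> S \<times> UNIV" "bad p" for p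
  proof -
    have "bad (opp p)" using that(2) by (simp add: bad_def seg_opp)
    moreover from this have "fst (opp p) \<in> S"
      using seg_subset_cell[OF d, of "opp p"] by (auto simp: bad_def S_def)
    ultimately show ?thesis by (auto simp: mem_Times_iff)
  qed
  \<comment> \<open>The domain \<open>A\<close> is left open because the identity is needed twice:
    with \<open>W\<close>, for integrals that vanish, and with the complement of one point, for the
    Cauchy kernel.\<close>
  have key: "(\<Sum>p\<in>good. contour_integral (loop p) F) =
      (\<Sum>q\<in>S. contour_integral (rectpath (vtx d q) (vtx d (fst q + 1, snd q + 1))) F)"
    if F: "F holomorphic_on A" "open A" and segA: "\<And>p. p \<in> S \<times> UNIV \<Longrightarrow> seg d p \<subseteq> A"
      and loopA: "\<And>p. p \<in> good \<Longrightarrow> path_image (loop p) \<subseteq> A" for A F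
  proof -
    define J where "J u v = contour_integral (linepath (vtx d u) (vtx d v)) F" for u v
    \<comment> \<open>For a vertex outside \<open>V\<close> the path \<open>c\<close> is unspecified
      and its integral an arbitrary number. This is harmless: such terms enter only through the
      antisymmetry of \<open>G\<close> and through telescoping around a cell.\<close>
    define G where "G = (\<lambda>(u, v). contour_integral (c (vtx d u)) F + J u v - contour_integral (c (vtx d v)) F)"
    have "G (v, u) = - G (u, v)" for u v
      using contour_integral_reversepath[of "linepath (vtx d u) (vtx d v)" F]
      by (simp add: G_def J_def reversepath_linepath)
    then have "(\<Sum>p\<in>good. G (edge p)) = (\<Sum>p\<in>S \<times> UNIV. G (edge p))"
      unfolding good_def using finS opp_bad by (intro sum_edges_cancel) blast+
    also have "\<dots> = (\<Sum>q\<in>S. \<Sum>s\<in>UNIV. G (edge (q, s)))"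
      by (simp add: sum.cartesian_product case_prod_unfold)
    also have "\<dots> = (\<Sum>q\<in>S. contour_integral (rectpath (vtx d q) (vtx d (fst q + 1, snd q + 1))) F)"
    proof (rule sum.cong)
      fix q assume q: "q \<in> S"
      have "continuous_on (seg d (q, s)) F" for s
        using holomorphic_on_imp_continuous_on[OF F(1)] segA[of "(q, s)"] q continuous_on_subset by blast
      then have "contour_integral (rectpath (vtx d q) (vtx d (fst q + 1, snd q + 1))) F =
          (\<Sum>s\<in>UNIV. J (fst (edge (q, s))) (snd (edge (q, s))))"
        using contour_integral_cell[OF d, of q F] by (simp add: J_def)
      also have "\<dots> = (\<Sum>s\<in>UNIV. G (edge (q, s)))"
        by (cases q) (simp add: G_def UNIV_side)
      finally show "(\<Sum>s\<in>UNIV. G (edge (q, s))) =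
          contour_integral (rectpath (vtx d q) (vtx d (fst q + 1, snd q + 1))) F" ..
    qed simp
    also have "(\<Sum>p\<in>good. G (edge p)) = (\<Sum>p\<in>good. contour_integral (loop p) F)"
    proof (rule sum.cong)
      fix p assume p: "p \<in> good"
      define u v where uv: "u = vtx d (fst (edge p))" "v = vtx d (snd (edge p))"
      note cu = c[OF endsV(1)[OF p], folded uv] and cv = c[OF endsV(2)[OF p], folded uv]
      have im: "path_image (c u) \<subseteq> A" "path_image (c v) \<subseteq> A" "closed_segment u v \<subseteq> A"
        using loopA[OF p] loop(3)[OF p] by (auto simp: uv seg_def)
      have int: "F contour_integrable_on c u" "F contour_integrable_on c v" "F contour_integrable_on linepath u v"
        using contour_integrable_holomorphic_simple[OF F] im cu(1) cv(1) by auto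
      have "loop p = c u +++ linepath u v +++ reversepath (c v)" by (simp add: loop_def uv Let_def)
      then have "contour_integral (loop p) F =
          contour_integral (c u) F + (contour_integral (linepath u v) F - contour_integral (c v) F)"
        using int cu cv
        by (simp add: contour_integrable_joinI contour_integrable_reversepath_eq valid_path_join contour_integral_reversepath)
      then show "G (edge p) = contour_integral (loop p) F"
        by (simp add: G_def J_def uv case_prod_unfold)
    qed simp
    finally show ?thesis .
  qed
  obtain ps where ps: "set ps = good" "distinct ps" using finite_distinct_list[OF fin_good] by metis
  have sum_ps: "(\<Sum>g\<leftarrow>map loop ps. H g) = (\<Sum>p\<in>good. H (loop p))" for H :: "_ \<Rightarrow> complex"
    using ps by (simp add: sum_list_distinct_conv_sum_set comp_def)
  show ?thesis
  proof (rule that[of "map loop ps"])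
    fix g assume "g \<in> set (map loop ps)"
    then obtain p where "p \<in> good" "g = loop p" using ps(1) by auto
    then show "valid_path g \<and> pathfinish g = pathstart g \<and> path_image g \<subseteq> W - K"
      using loop(1,2)[of p] loopV[of p] unfolding V_def by simp
  next
    fix F assume F: "F holomorphic_on W"
    have "(\<Sum>p\<in>good. contour_integral (loop p) F) =
      (\<Sum>q\<in>S. contour_integral (rectpath (vtx d q) (vtx d (fst q + 1, snd q + 1))) F)"
      by (rule key[OF F W segW]) (use loopV in \<open>unfold V_def, blast+\<close>)
    also have "\<dots> = 0"
    proof (rule sum.neutral, rule ballI)
      fix q assume q: "q \<in> S"
      have "(F has_contour_integral 0) (rectpath (vtx d q) (vtx d (fst q + 1, snd q + 1)))"
      proof (rule Cauchy_theorem_convex_simple)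
        show "F holomorphic_on cell d q" using F cellW[OF q] by (rule holomorphic_on_subset)
        show "path_image (rectpath (vtx d q) (vtx d (fst q + 1, snd q + 1))) \<subseteq> cell d q"
          unfolding cell_def by (rule path_image_rectpath_subset_cbox) (use d in \<open>auto simp: vtx_def\<close>)
      qed (auto simp: cell_def)
      then show "contour_integral (rectpath (vtx d q) (vtx d (fst q + 1, snd q + 1))) F = 0"
        by (rule contour_integral_unique)
    qed
    finally show "(\<Sum>g\<leftarrow>map loop ps. contour_integral g F) = 0" by (simp only: sum_ps)
  next
    fix z assume z: "z \<in> K"
    define i j where ij: "i = \<lfloor>Re z / d\<rfloor>" "j = \<lfloor>Im z / d\<rfloor>"
    have fl: "d * i \<le> Re z" "Re z < d * (i + 1)" "d * j \<le> Im z" "Im z < d * (j + 1)"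
    proof -
      have "i \<le> Re z / d" "Re z / d < i + 1" "j \<le> Im z / d" "Im z / d < j + 1"
        unfolding ij by linarith+
      then show "d * i \<le> Re z" "Re z < d * (i + 1)" "d * j \<le> Im z" "Im z < d * (j + 1)"
        using d by (simp_all add: field_simps)
    qed
    have "z \<in> cell d (i, j)" using fl by (auto simp: cell_def vtx_def in_cbox_complex_iff)
    then have ijS: "(i, j) \<in> S" using z by (auto simp: S_def)
    define U where "U = - (\<Union>p\<in>good. path_image (loop p))"
    have "closed (\<Union>p\<in>good. path_image (loop p))"
      using fin_good loop(1) by (intro closed_UN ballI closed_path_image valid_path_imp_path) blast+
    moreover have "z \<in> U" using z loopV by (auto simp: U_def V_def)
    ultimately obtain r where r: "r > 0" "ball z r \<subseteq> U"
      unfolding U_def by (meson open_Compl openE)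
    \<comment> \<open>The point \<open>z\<close> may lie on a grid line, so it is moved diagonally
      into the interior of the cell \<open>(i, j)\<close>: half the remaining room keeps it inside
      that cell, and \<open>r / 3\<close> keeps it in \<open>ball z r\<close>, where all indices are
      constant.\<close>
    define t where "t = min (r / 3) (min (d * (i + 1) - Re z) (d * (j + 1) - Im z) / 2)"
    have t: "t > 0" "t \<le> r / 3" "t < d * (i + 1) - Re z" "t < d * (j + 1) - Im z"
      using fl r(1) by (auto simp: t_def min_def field_simps)
    define z' where "z' = Complex (Re z + t) (Im z + t)"
    have zz: "dist z z' \<le> 2 * t"
      using cmod_le[of "z - z'"] t(1) by (simp add: dist_norm z'_def)
    then have z'r: "z' \<in> ball z r" using t r(1) by simp
    have box: "d * i < Re z'" "Re z' < d * (i + 1)" "d * j < Im z'" "Im z' < d * (j + 1)"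
      using fl t by (auto simp: z'_def)
    have between: "k = m" if "d * k \<le> x" "x \<le> d * (k + 1)" "d * m < x" "x < d * (m + 1)" for k m :: int and x
    proof -
      have "d * k < d * (m + 1)" "d * m < d * (k + 1)" using that by linarith+
      then have "real_of_int k < m + 1" "real_of_int m < k + 1" using d by simp_all
      then show ?thesis by linarith
    qed
    have off: "z' \<notin> seg d p" for p
    proof
      assume "z' \<in> seg d p"
      then consider k :: int where "Re z' = d * k" | k :: int where "Im z' = d * k"
        using seg_grid_line by blast
      then show False
        using box between[of _ "Re z'" i] between[of _ "Im z'" j] d by cases (force simp: algebra_simps)+
    qed
    have "winding_number (loop p) z = winding_number (loop p) z'" if "p \<in> good" for p
    proof -
      have "winding_number (loop p) constant_on ball z r"
        by (rule winding_number_constant)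
           (use that loop(1,2)[of p] r(2) in \<open>auto simp: U_def simp del: split_paired_All intro: valid_path_imp_path\<close>)
      then show ?thesis using z'r r(1) unfolding constant_on_def by (metis centre_in_ball)
    qed
    then have "(\<Sum>p\<in>good. winding_number (loop p) z) = (\<Sum>p\<in>good. winding_number (loop p) z')"
      by simp
    also have "\<dots> = (\<Sum>p\<in>good. 1 / (2 * pi * \<i>) * contour_integral (loop p) (\<lambda>w. 1 / (w - z')))"
      by (intro sum.cong refl winding_number_valid_path loop(1)) (use z'r r(2) in \<open>unfold U_def, blast+\<close>)
    also have "\<dots> = (\<Sum>q\<in>S. 1 / (2 * pi * \<i>) * contour_integral (rectpath (vtx d q) (vtx d (fst q + 1, snd q + 1))) (\<lambda>w. 1 / (w - z')))"
      unfolding sum_distrib_left[symmetric]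
      by (subst key[where A = "- {z'}"]) (use off z'r r(2) in \<open>unfold U_def, auto intro!: holomorphic_intros\<close>)
    also have "\<dots> = (\<Sum>q\<in>S. winding_number (rectpath (vtx d q) (vtx d (fst q + 1, snd q + 1))) z')"
    proof (rule sum.cong)
      fix q assume "q \<in> S"
      have "z' \<notin> path_image (rectpath (vtx d q) (vtx d (fst q + 1, snd q + 1)))"
      proof -
        obtain k l where q: "q = (k, l)" by (cases q)
        have "rectpath (vtx d q) (vtx d (fst q + 1, snd q + 1)) =
            linepath (vtx d (k, l)) (vtx d (k + 1, l)) +++ linepath (vtx d (k + 1, l)) (vtx d (k + 1, l + 1)) +++
            linepath (vtx d (k + 1, l + 1)) (vtx d (k, l + 1)) +++ linepath (vtx d (k, l + 1)) (vtx d (k, l))"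
          by (simp add: rectpath_def q vtx_def Let_def)
        then show ?thesis
          using off[of "(q, South)"] off[of "(q, East)"] off[of "(q, North)"] off[of "(q, West)"]
          by (simp add: path_image_join seg_def q)
      qed
      then show "1 / (2 * pi * \<i>) * contour_integral (rectpath (vtx d q) (vtx d (fst q + 1, snd q + 1))) (\<lambda>w. 1 / (w - z')) =
          winding_number (rectpath (vtx d q) (vtx d (fst q + 1, snd q + 1))) z'"
        by (simp add: winding_number_valid_path)
    qed simp
    also have "\<dots> = (\<Sum>q\<in>S. if q = (i, j) then 1 else 0)"
    proof (rule sum.cong)
      fix q assume "q \<in> S"
      show "winding_number (rectpath (vtx d q) (vtx d (fst q + 1, snd q + 1))) z' = (if q = (i, j) then 1 else 0)"
      proof (cases "q = (i, j)")
        case True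
        then show ?thesis
          using box by (auto intro!: winding_number_rectpath simp: in_box_complex_iff vtx_def)
      next
        case False
        have "z' \<notin> cbox (vtx d q) (vtx d (fst q + 1, snd q + 1))"
        proof
          assume "z' \<in> cbox (vtx d q) (vtx d (fst q + 1, snd q + 1))"
          then have "fst q = i" "snd q = j"
            using box between[of "fst q" "Re z'" i] between[of "snd q" "Im z'" j]
            by (auto simp: in_cbox_complex_iff vtx_def)
          then show False using False by (cases q) auto
        qed
        then show ?thesis
          using False d by (auto intro!: winding_number_rectpath_outside simp: vtx_def)
      qed
    qed simp
    also have "\<dots> = 1" using ijS finS by simp
    finally show "(\<Sum>g\<leftarrow>map loop ps. winding_number g z) = 1" by (simp only: sum_ps)
  qed
qed

section \<open>Cauchy's theorem for cycles\<close>

text \<open>A list of loops is read as a formal sum: integral and index are sums over the list,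
  \<open>@\<close> adds two cycles and \<open>map reversepath\<close> negates one.\<close>

definition is_cycle :: "complex set \<Rightarrow> (real \<Rightarrow> complex) list \<Rightarrow> bool" where
  "is_cycle V \<Gamma> \<longleftrightarrow> (\<forall>g\<in>set \<Gamma>. valid_path g \<and> pathfinish g = pathstart g \<and> path_image g \<subseteq> V)"

text \<open>Polynomial paths have a continuous derivative on the whole parameter interval, so a
  continuous integrand is integrable, Fubini's theorem applies and integrals are bounded by
  suprema.\<close>

definition polynomial_paths :: "(real \<Rightarrow> complex) list \<Rightarrow> bool" where
  "polynomial_paths \<Gamma> \<longleftrightarrow> (\<forall>g\<in>set \<Gamma>. polynomial_function g)"

definition cycle_image :: "(real \<Rightarrow> complex) list \<Rightarrow> complex set" where
  "cycle_image \<Gamma> = (\<Union>g\<in>set \<Gamma>. path_image g)"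

definition cycle_integral :: "(real \<Rightarrow> complex) list \<Rightarrow> (complex \<Rightarrow> complex) \<Rightarrow> complex" where
  "cycle_integral \<Gamma> F = (\<Sum>g\<leftarrow>\<Gamma>. contour_integral g F)"

definition cycle_index :: "(real \<Rightarrow> complex) list \<Rightarrow> complex \<Rightarrow> complex" where
  "cycle_index \<Gamma> z = (\<Sum>g\<leftarrow>\<Gamma>. winding_number g z)"

lemma admissible_cycle_iff:
  "admissible_cycle Om K \<Gamma> \<longleftrightarrow>
    is_cycle (Om - K) \<Gamma> \<and> (\<forall>z\<in>K. cycle_index \<Gamma> z = 1) \<and> (\<forall>z. z \<notin> Om \<longrightarrow> cycle_index \<Gamma> z = 0)"
  by (simp add: admissible_cycle_def is_cycle_def cycle_index_def)

lemma null_cycle_around_compact: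
  assumes "compact K" "open W" "K \<subseteq> W"
  obtains \<Gamma> where "is_cycle (W - K) \<Gamma>" "\<And>F. F holomorphic_on W \<Longrightarrow> cycle_integral \<Gamma> F = 0"
    "\<And>z. z \<in> K \<Longrightarrow> cycle_index \<Gamma> z = 1"
proof (rule grid_cycle[OF assms])
  fix \<Gamma>
  assume "\<And>g. g \<in> set \<Gamma> \<Longrightarrow> valid_path g \<and> pathfinish g = pathstart g \<and> path_image g \<subseteq> W - K"
    "\<And>F. F holomorphic_on W \<Longrightarrow> (\<Sum>g\<leftarrow>\<Gamma>. contour_integral g F) = 0"
    "\<And>z. z \<in> K \<Longrightarrow> (\<Sum>g\<leftarrow>\<Gamma>. winding_number g z) = 1"
  then show thesis
    by (intro that[of \<Gamma>]) (simp_all add: is_cycle_def cycle_integral_def cycle_index_def)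
qed

lemma is_cycleD:
  assumes "is_cycle V \<Gamma>" "g \<in> set \<Gamma>"
  shows "valid_path g" "pathfinish g = pathstart g" "path_image g \<subseteq> V" "path g"
  using assms by (auto simp: is_cycle_def intro: valid_path_imp_path)

lemma is_cycle_mono: "is_cycle V \<Gamma> \<Longrightarrow> V \<subseteq> V' \<Longrightarrow> is_cycle V' \<Gamma>"
  by (auto simp: is_cycle_def)

lemma is_cycle_cycle_image: "is_cycle V \<Gamma> \<Longrightarrow> cycle_image \<Gamma> \<subseteq> V' \<Longrightarrow> is_cycle V' \<Gamma>"
  by (auto simp: is_cycle_def cycle_image_def)

lemma cycle_image_subset: "is_cycle V \<Gamma> \<Longrightarrow> cycle_image \<Gamma> \<subseteq> V"
  by (auto simp: is_cycle_def cycle_image_def)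

lemma compact_cycle_image: "is_cycle V \<Gamma> \<Longrightarrow> compact (cycle_image \<Gamma>)"
  unfolding cycle_image_def by (intro compact_UN) (auto dest: is_cycleD(4) intro: compact_path_image)

lemma cycle_index_eq_integral:
  assumes "is_cycle V \<Gamma>" "z \<notin> cycle_image \<Gamma>"
  shows "cycle_integral \<Gamma> (\<lambda>w. 1 / (w - z)) = 2 * pi * \<i> * cycle_index \<Gamma> z"
proof -
  have "contour_integral g (\<lambda>w. 1 / (w - z)) = 2 * pi * \<i> * winding_number g z" if "g \<in> set \<Gamma>" for g
    using winding_number_valid_path[of g z] is_cycleD(1)[OF assms(1) that] assms(2) that
    by (auto simp: cycle_image_def)
  then have "cycle_integral \<Gamma> (\<lambda>w. 1 / (w - z)) = (\<Sum>g\<leftarrow>\<Gamma>. 2 * pi * \<i> * winding_number g z)"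
    unfolding cycle_integral_def by (intro arg_cong[of _ _ sum_list] map_cong) auto
  then show ?thesis by (simp add: cycle_index_def sum_list_const_mult)
qed

lemma cycle_integral_cong:
  assumes "\<And>w. w \<in> cycle_image \<Gamma> \<Longrightarrow> F w = G w"
  shows "cycle_integral \<Gamma> F = cycle_integral \<Gamma> G"
  unfolding cycle_integral_def
  by (intro arg_cong[of _ _ sum_list] map_cong refl contour_integral_eq) (use assms in \<open>auto simp: cycle_image_def\<close>)

definition cycle_integrable :: "(real \<Rightarrow> complex) list \<Rightarrow> (complex \<Rightarrow> complex) \<Rightarrow> bool" where
  "cycle_integrable \<Gamma> F \<longleftrightarrow> (\<forall>g\<in>set \<Gamma>. F contour_integrable_on g)"

lemma cycle_integrable_holomorphic:
  "is_cycle V \<Gamma> \<Longrightarrow> open V \<Longrightarrow> F holomorphic_on V \<Longrightarrow> cycle_integrable \<Gamma> F"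
  unfolding cycle_integrable_def by (meson contour_integrable_holomorphic_simple is_cycleD)

lemma cycle_integral_add:
  assumes "cycle_integrable \<Gamma> F" "cycle_integrable \<Gamma> G"
  shows "cycle_integral \<Gamma> (\<lambda>w. F w + G w) = cycle_integral \<Gamma> F + cycle_integral \<Gamma> G"
  using assms unfolding cycle_integral_def cycle_integrable_def sum_list_addf[symmetric]
  by (intro arg_cong[of _ _ sum_list] map_cong) (auto simp: contour_integral_add)

lemma cycle_integral_diff:
  assumes "cycle_integrable \<Gamma> F" "cycle_integrable \<Gamma> G"
  shows "cycle_integral \<Gamma> (\<lambda>w. F w - G w) = cycle_integral \<Gamma> F - cycle_integral \<Gamma> G"
  using assms unfolding cycle_integral_def cycle_integrable_def sum_list_subtractf[symmetric]
  by (intro arg_cong[of _ _ sum_list] map_cong) (auto simp: contour_integral_diff)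

lemma cycle_integral_lmul:
  assumes "cycle_integrable \<Gamma> F"
  shows "cycle_integral \<Gamma> (\<lambda>w. c * F w) = c * cycle_integral \<Gamma> F"
  using assms unfolding cycle_integral_def cycle_integrable_def sum_list_const_mult[symmetric]
  by (intro arg_cong[of _ _ sum_list] map_cong) (auto simp: contour_integral_lmul)

lemma cycle_integral_zero: "cycle_integral \<Gamma> (\<lambda>w. 0) = 0"
  by (simp add: cycle_integral_def)

lemma cycle_integral_append: "cycle_integral (\<Gamma> @ \<Delta>) F = cycle_integral \<Gamma> F + cycle_integral \<Delta> F"
  by (simp add: cycle_integral_def)

lemma cycle_index_append: "cycle_index (\<Gamma> @ \<Delta>) F = cycle_index \<Gamma> F + cycle_index \<Delta> F"
  by (simp add: cycle_index_def)

lemma cycle_index_reverse: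
  assumes "is_cycle V \<Gamma>" "z \<notin> cycle_image \<Gamma>"
  shows "cycle_index (map reversepath \<Gamma>) z = - cycle_index \<Gamma> z"
  using assms unfolding cycle_index_def is_cycle_def cycle_image_def
  by (induction \<Gamma>) (auto simp: winding_number_reversepath valid_path_imp_path)

lemma cycle_integral_reverse:
  assumes "is_cycle V \<Gamma>"
  shows "cycle_integral (map reversepath \<Gamma>) F = - cycle_integral \<Gamma> F"
  using assms unfolding cycle_integral_def is_cycle_def
  by (induction \<Gamma>) (auto simp: contour_integral_reversepath)

lemma is_cycle_reverse: "is_cycle V \<Gamma> \<Longrightarrow> is_cycle V (map reversepath \<Gamma>)"
  by (auto simp: is_cycle_def)

lemma is_cycle_append: "is_cycle V (\<Gamma> @ \<Delta>) \<longleftrightarrow> is_cycle V \<Gamma> \<and> is_cycle V \<Delta>"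
  by (auto simp: is_cycle_def)

lemma cycle_index_locally_constant:
  assumes "is_cycle V \<Gamma>" "z \<notin> cycle_image \<Gamma>"
  obtains r where "r > 0" "ball z r \<inter> cycle_image \<Gamma> = {}" "\<And>w. w \<in> ball z r \<Longrightarrow> cycle_index \<Gamma> w = cycle_index \<Gamma> z"
proof -
  have "open (- cycle_image \<Gamma>)"
    using compact_cycle_image[OF assms(1)] compact_imp_closed by blast
  then obtain r where r: "r > 0" "ball z r \<subseteq> - cycle_image \<Gamma>" using assms(2) by (meson ComplI openE)
  have "cycle_index \<Gamma> w = cycle_index \<Gamma> z" if w: "w \<in> ball z r" for w
    unfolding cycle_index_def
  proof (intro arg_cong[of _ _ sum_list] map_cong refl)
    fix g assume g: "g \<in> set \<Gamma>"
    have "winding_number g constant_on ball z r"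
      by (rule winding_number_constant)
         (use is_cycleD[OF assms(1) g] r(2) g in \<open>auto simp: cycle_image_def\<close>)
    then show "winding_number g w = winding_number g z"
      using w r(1) unfolding constant_on_def by (metis centre_in_ball)
  qed
  then show ?thesis using r that by blast
qed

lemma open_cycle_index_eq:
  assumes "is_cycle V \<Gamma>"
  shows "open {z. z \<notin> cycle_image \<Gamma> \<and> cycle_index \<Gamma> z = n}"
  unfolding open_contains_ball
proof
  fix z assume "z \<in> {z. z \<notin> cycle_image \<Gamma> \<and> cycle_index \<Gamma> z = n}"
  then have z: "z \<notin> cycle_image \<Gamma>" "cycle_index \<Gamma> z = n" by auto
  obtain r where "r > 0" "ball z r \<inter> cycle_image \<Gamma> = {}" "\<And>w. w \<in> ball z r \<Longrightarrow> cycle_index \<Gamma> w = cycle_index \<Gamma> z"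
    using cycle_index_locally_constant[OF assms z(1)] by metis
  then show "\<exists>e>0. ball z e \<subseteq> {z. z \<notin> cycle_image \<Gamma> \<and> cycle_index \<Gamma> z = n}"
    using z(2) by (intro exI[of _ r]) auto
qed

text \<open>Paths uniformly close enough to \<open>g\<close> and with the same end points give the
  same integral for every function holomorphic on \<open>V\<close>. The required closeness depends
  on \<open>g\<close> and \<open>V\<close> only, so one polynomial path serves all
  \<open>F\<close>.\<close>

lemma polynomial_loop_approx:
  assumes V: "open V" and g: "valid_path g" "path_image g \<subseteq> V"
  obtains p where "polynomial_function p" "pathstart p = pathstart g" "pathfinish p = pathfinish g" "path_image p \<subseteq> V"
    "\<And>F. F holomorphic_on V \<Longrightarrow> contour_integral p F = contour_integral g F"
proof -
  obtain d where d: "d > 0" "\<forall>g' h. valid_path g' \<and> valid_path h \<and>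
                  (\<forall>t \<in> {0..1}. norm(g' t - g t) < d \<and> norm(h t - g t) < d) \<and> linked_paths True g' h
                  \<longrightarrow> path_image g' \<subseteq> V \<and> path_image h \<subseteq> V \<and>
                      (\<forall>f. f holomorphic_on V \<longrightarrow> contour_integral h f = contour_integral g' f)"
    using contour_integral_nearby[where atends = True, OF V valid_path_imp_path[OF g(1)] g(2)] by metis
  obtain p where p: "polynomial_function p" "pathstart p = pathstart g" "pathfinish p = pathfinish g"
                    "\<And>t. t \<in> {0..1} \<Longrightarrow> norm(p t - g t) < d"
    using path_approx_polynomial_function[OF valid_path_imp_path[OF g(1)] d(1)] by metis
  have "path_image p \<subseteq> V \<and> (\<forall>f. f holomorphic_on V \<longrightarrow> contour_integral p f = contour_integral g f)"
    using d(2)[rule_format, of g p] g p d(1) by (auto simp: valid_path_polynomial_function linked_paths_def)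
  then show ?thesis using p that by blast
qed

text \<open>For \<open>z \<notin> V\<close> the kernel \<open>1 / (w - z)\<close> is itself
  holomorphic on \<open>V\<close>, so equality of the indices is an instance of equality of the
  integrals.\<close>

lemma polynomial_cycle_approx:
  assumes V: "open V" and "is_cycle V \<Gamma>"
  obtains \<Gamma>' where "polynomial_paths \<Gamma>'" "is_cycle V \<Gamma>'"
    "\<And>F. F holomorphic_on V \<Longrightarrow> cycle_integral \<Gamma>' F = cycle_integral \<Gamma> F"
    "\<And>z. z \<notin> V \<Longrightarrow> cycle_index \<Gamma>' z = cycle_index \<Gamma> z"
proof -
  have "\<exists>p. g \<in> set \<Gamma> \<longrightarrow> polynomial_function p \<and> pathfinish p = pathstart p \<and> path_image p \<subseteq> V \<and>
      (\<forall>F. F holomorphic_on V \<longrightarrow> contour_integral p F = contour_integral g F)" for g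
    using polynomial_loop_approx[OF V, of g] is_cycleD[OF assms(2), of g] by metis
  then obtain P where P: "\<And>g. g \<in> set \<Gamma> \<Longrightarrow> polynomial_function (P g) \<and> pathfinish (P g) = pathstart (P g) \<and>
      path_image (P g) \<subseteq> V \<and> (\<forall>F. F holomorphic_on V \<longrightarrow> contour_integral (P g) F = contour_integral g F)"
    by metis
  have cyc: "is_cycle V (map P \<Gamma>)" using P by (auto simp: is_cycle_def valid_path_polynomial_function)
  have int: "cycle_integral (map P \<Gamma>) F = cycle_integral \<Gamma> F" if "F holomorphic_on V" for F
    unfolding cycle_integral_def map_map
    by (intro arg_cong[of _ _ sum_list] map_cong) (use P that in auto)
  have "cycle_index (map P \<Gamma>) z = cycle_index \<Gamma> z" if z: "z \<notin> V" for z
  proof -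
    have "z \<notin> cycle_image \<Gamma>" "z \<notin> cycle_image (map P \<Gamma>)"
      using cycle_image_subset[OF cyc] cycle_image_subset[OF assms(2)] z by auto
    moreover have "(\<lambda>w. 1 / (w - z)) holomorphic_on V" using z by (auto intro!: holomorphic_intros)
    ultimately show ?thesis
      using int cycle_index_eq_integral[OF cyc, of z] cycle_index_eq_integral[OF assms(2), of z] by simp
  qed
  moreover have "polynomial_paths (map P \<Gamma>)" using P by (auto simp: polynomial_paths_def)
  ultimately show ?thesis using cyc int that by blast
qed

section \<open>Parameter integrals and Fubini's theorem for polynomial cycles\<close>

lemma continuous_vector_derivative_polynomial:
  fixes g :: "real \<Rightarrow> complex"
  assumes "polynomial_function g"
  shows "continuous_on A (\<lambda>t. vector_derivative g (at t))"
proof -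
  obtain g' where g': "polynomial_function g'" "\<And>x. (g has_vector_derivative g' x) (at x)"
    using has_vector_derivative_polynomial_function[OF assms] by metis
  then have "(\<lambda>t. vector_derivative g (at t)) = g'" by (auto simp: vector_derivative_at)
  then show ?thesis using g'(1) continuous_on_polymonial_function by auto
qed

lemma contour_integrable_polynomial:
  assumes g: "polynomial_function g" and f: "continuous_on (path_image g) f"
  shows "f contour_integrable_on g"
proof -
  have "continuous_on {0..1} (\<lambda>t. f (g t))"
    by (rule continuous_on_compose2[OF f]) (use g in \<open>auto simp: path_image_def continuous_on_polymonial_function\<close>)
  then have "continuous_on {0..1} (\<lambda>t. f (g t) * vector_derivative g (at t))"
    by (intro continuous_on_mult continuous_vector_derivative_polynomial g)
  then show ?thesis
    unfolding contour_integrable_on by (rule integrable_continuous_real)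
qed

lemma continuous_on_contour_integral_param:
  assumes g: "polynomial_function g" and h: "continuous_on (S \<times> path_image g) (\<lambda>(z, w). h z w)"
  shows "continuous_on S (\<lambda>z. contour_integral g (h z))"
proof -
  have "continuous_on (S \<times> {0..1}) (\<lambda>x. (\<lambda>(z, w). h z w) (fst x, g (snd x)))"
    by (rule continuous_on_compose2[OF h])
       (use g in \<open>auto simp: path_image_def intro!: continuous_intros continuous_on_compose2[OF continuous_on_polymonial_function[OF g, of UNIV]]\<close>)
  then have "continuous_on (S \<times> {0..1}) (\<lambda>x. h (fst x) (g (snd x)) * vector_derivative g (at (snd x)))"
    by (intro continuous_on_mult continuous_on_compose2[OF continuous_vector_derivative_polynomial[OF g, of UNIV]])
       (auto intro!: continuous_intros)
  then have "continuous_on S (\<lambda>z. integral (cbox 0 1) (\<lambda>t. h z (g t) * vector_derivative g (at t)))"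
    by (intro integral_continuous_on_param) (simp add: case_prod_unfold)
  then show ?thesis by (simp add: contour_integral_integral)
qed

lemma continuous_on_cycle_integral_param:
  assumes "polynomial_paths \<Gamma>" "continuous_on (S \<times> cycle_image \<Gamma>) (\<lambda>(z, w). h z w)"
  shows "continuous_on S (\<lambda>z. cycle_integral \<Gamma> (h z))"
proof -
  have "continuous_on S (\<lambda>z. \<Sum>g\<leftarrow>\<Delta>. contour_integral g (h z))" if "set \<Delta> \<subseteq> set \<Gamma>" for \<Delta>
    using that
  proof (induction \<Delta>)
    case (Cons g \<Delta>)
    have "continuous_on S (\<lambda>z. contour_integral g (h z))"
      by (rule continuous_on_contour_integral_param)
         (use assms Cons.prems in \<open>auto simp: polynomial_paths_def cycle_image_def intro: continuous_on_subset\<close>)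
    then show ?case using Cons by (auto intro!: continuous_intros)
  qed auto
  then show ?thesis by (auto simp: cycle_integral_def)
qed

lemma cycle_integrable_polynomial:
  "polynomial_paths \<Gamma> \<Longrightarrow> continuous_on (cycle_image \<Gamma>) f \<Longrightarrow> cycle_integrable \<Gamma> f"
  unfolding cycle_integrable_def polynomial_paths_def cycle_image_def
  by (meson UN_upper contour_integrable_polynomial continuous_on_subset)

text \<open>The interchange for two single paths is extended additively, by induction over the list
  of inner paths and then over the list of outer ones. The restriction to sublists of
  \<open>\<Gamma>\<close> and \<open>\<Delta>\<close> keeps the continuity of \<open>h\<close>
  available in both inductions.\<close>

lemma cycle_integral_swap:
  assumes \<Gamma>: "polynomial_paths \<Gamma>" and \<Delta>: "polynomial_paths \<Delta>"
    and h: "continuous_on (cycle_image \<Gamma> \<times> cycle_image \<Delta>) (\<lambda>(w, z). h w z)"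
  shows "cycle_integral \<Gamma> (\<lambda>w. cycle_integral \<Delta> (h w)) = cycle_integral \<Delta> (\<lambda>z. cycle_integral \<Gamma> (\<lambda>w. h w z))"
proof -
  have sw: "continuous_on (cycle_image \<Delta> \<times> cycle_image \<Gamma>) (\<lambda>(z, w). h w z)"
    using continuous_on_swap_args[OF h] by simp
  have single: "contour_integral g (\<lambda>w. \<Sum>\<delta>\<leftarrow>D. contour_integral \<delta> (h w)) =
      (\<Sum>\<delta>\<leftarrow>D. contour_integral \<delta> (\<lambda>z. contour_integral g (\<lambda>w. h w z)))"
    if g: "g \<in> set \<Gamma>" and D: "set D \<subseteq> set \<Delta>" for g D
    using D
  proof (induction D)
    case (Cons \<delta> D)
    have \<delta>: "\<delta> \<in> set \<Delta>" using Cons.prems by auto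
    have sub: "path_image g \<subseteq> cycle_image \<Gamma>" "path_image \<delta> \<subseteq> cycle_image \<Delta>" "cycle_image D \<subseteq> cycle_image \<Delta>"
      using g Cons.prems by (auto simp: cycle_image_def)
    have poly: "polynomial_function g" "polynomial_function \<delta>" "polynomial_paths D"
      using g \<delta> \<Gamma> \<Delta> Cons.prems by (auto simp: polynomial_paths_def)
    have c1: "continuous_on (path_image g) (\<lambda>w. contour_integral \<delta> (h w))"
      by (rule continuous_on_contour_integral_param[OF poly(2)], rule continuous_on_subset[OF h]) (use sub in auto)
    have c2: "continuous_on (path_image g) (\<lambda>w. \<Sum>\<delta>\<leftarrow>D. contour_integral \<delta> (h w))"
      unfolding cycle_integral_def[symmetric]
      by (rule continuous_on_cycle_integral_param[OF poly(3)], rule continuous_on_subset[OF h]) (use sub in auto)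
    have "contour_integral g (\<lambda>w. contour_integral \<delta> (h w)) = contour_integral \<delta> (\<lambda>z. contour_integral g (\<lambda>w. h w z))"
      by (rule contour_integral_swap)
         (use sub poly in \<open>auto intro: continuous_on_subset[OF h] valid_path_polynomial_function continuous_vector_derivative_polynomial\<close>)
    then show ?case
      using Cons contour_integral_add[OF contour_integrable_polynomial[OF poly(1) c1] contour_integrable_polynomial[OF poly(1) c2]]
      by simp
  qed simp
  have "(\<Sum>g\<leftarrow>G. contour_integral g (\<lambda>w. cycle_integral \<Delta> (h w))) = cycle_integral \<Delta> (\<lambda>z. \<Sum>g\<leftarrow>G. contour_integral g (\<lambda>w. h w z))"
    if "set G \<subseteq> set \<Gamma>" for G
    using that
  proof (induction G)
    case (Cons g G)
    have g: "g \<in> set \<Gamma>" using Cons.prems by auto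
    have sub: "path_image g \<subseteq> cycle_image \<Gamma>" "cycle_image G \<subseteq> cycle_image \<Gamma>"
      using Cons.prems by (auto simp: cycle_image_def)
    have poly: "polynomial_function g" "polynomial_paths G"
      using g \<Gamma> Cons.prems by (auto simp: polynomial_paths_def)
    have "cycle_integrable \<Delta> (\<lambda>z. contour_integral g (\<lambda>w. h w z))"
      by (rule cycle_integrable_polynomial[OF \<Delta>], rule continuous_on_contour_integral_param[OF poly(1)],
          rule continuous_on_subset[OF sw]) (use sub in auto)
    moreover have "cycle_integrable \<Delta> (\<lambda>z. \<Sum>g\<leftarrow>G. contour_integral g (\<lambda>w. h w z))"
      unfolding cycle_integral_def[symmetric]
      by (rule cycle_integrable_polynomial[OF \<Delta>], rule continuous_on_cycle_integral_param[OF poly(2)],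
          rule continuous_on_subset[OF sw]) (use sub in auto)
    ultimately have "cycle_integral \<Delta> (\<lambda>z. contour_integral g (\<lambda>w. h w z) + (\<Sum>g\<leftarrow>G. contour_integral g (\<lambda>w. h w z))) =
        cycle_integral \<Delta> (\<lambda>z. contour_integral g (\<lambda>w. h w z)) + cycle_integral \<Delta> (\<lambda>z. \<Sum>g\<leftarrow>G. contour_integral g (\<lambda>w. h w z))"
      by (rule cycle_integral_add)
    then show ?case
      using Cons single[OF g, of \<Delta>] by (simp add: cycle_integral_def)
  qed (simp add: cycle_integral_zero)
  from this[of \<Gamma>] show ?thesis by (simp add: cycle_integral_def)
qed

text \<open>The difference quotient of \<open>F\<close> at \<open>z\<close>, completed by the
  derivative, is holomorphic on \<open>W\<close>, so its integral vanishes; splitting it gives the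
  formula. Vanishing integrals are assumed, not vanishing indices, so that the lemma can be applied
  to the grid cycle inside the proof of Cauchy's theorem.\<close>

lemma cycle_integral_formula_aux:
  assumes W: "open W" and cyc: "is_cycle W \<Gamma>" and F: "F holomorphic_on W"
    and null: "\<And>G. G holomorphic_on W \<Longrightarrow> cycle_integral \<Gamma> G = 0"
    and z: "z \<in> W" "z \<notin> cycle_image \<Gamma>"
  shows "cycle_integral \<Gamma> (\<lambda>w. F w / (w - z)) = 2 * pi * \<i> * cycle_index \<Gamma> z * F z"
proof -
  define G where "G w = (if w = z then deriv F z else (F w - F z) / (w - z))" for w
  have "G holomorphic_on W"
    unfolding G_def by (rule pole_lemma[OF F]) (use z W in \<open>simp add: interior_open\<close>)
  then have "0 = cycle_integral \<Gamma> G" using null by simp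
  also have "\<dots> = cycle_integral \<Gamma> (\<lambda>w. F w / (w - z) - F z * (1 / (w - z)))"
    by (rule cycle_integral_cong) (use z in \<open>auto simp: G_def diff_divide_distrib\<close>)
  also have "\<dots> = cycle_integral \<Gamma> (\<lambda>w. F w / (w - z)) - F z * cycle_integral \<Gamma> (\<lambda>w. 1 / (w - z))"
  proof -
    have cyc': "is_cycle (W - {z}) \<Gamma>"
      using is_cycle_cycle_image[OF cyc, of "W - {z}"] cycle_image_subset[OF cyc] z by blast
    have "cycle_integrable \<Gamma> (\<lambda>w. F w / (w - z))" "cycle_integrable \<Gamma> (\<lambda>w. F z * (1 / (w - z)))"
         "cycle_integrable \<Gamma> (\<lambda>w. 1 / (w - z))"
      using W by (auto intro!: cycle_integrable_holomorphic[OF cyc'] holomorphic_intros holomorphic_on_subset[OF F])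
    then show ?thesis by (simp add: cycle_integral_diff cycle_integral_lmul del: times_divide_eq_right)
  qed
  finally show ?thesis using cycle_index_eq_integral[OF cyc z(2)] by simp
qed

text \<open>The points that are on the cycle or have nonzero index form a compact subset of \<open>W\<close>. Surround this
  set by a grid cycle, insert the integral formula over the grid cycle, and swap.\<close>

theorem Cauchy_theorem_cycle:
  assumes W: "open W" and cyc: "is_cycle W \<Gamma>" and null: "\<And>z. z \<notin> W \<Longrightarrow> cycle_index \<Gamma> z = 0"
    and F: "F holomorphic_on W"
  shows "cycle_integral \<Gamma> F = 0"
proof -
  obtain \<Gamma>' where \<Gamma>': "polynomial_paths \<Gamma>'" "is_cycle W \<Gamma>'"
      "\<And>F. F holomorphic_on W \<Longrightarrow> cycle_integral \<Gamma>' F = cycle_integral \<Gamma> F"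
      "\<And>z. z \<notin> W \<Longrightarrow> cycle_index \<Gamma>' z = cycle_index \<Gamma> z"
    using polynomial_cycle_approx[OF W cyc] by metis
  define V where "V = {z. z \<notin> cycle_image \<Gamma>' \<and> cycle_index \<Gamma>' z = 0}"
  define K where "K = - V"
  have "open V" unfolding V_def by (rule open_cycle_index_eq[OF \<Gamma>'(2)])
  then have "closed K" by (simp add: K_def closed_Compl)
  moreover have "bounded K"
  proof -
    obtain B where B: "B > 0" "cycle_image \<Gamma>' \<subseteq> ball 0 B"
      using compact_imp_bounded[OF compact_cycle_image[OF \<Gamma>'(2)]] by (metis bounded_subset_ballD)
    have "K \<subseteq> ball 0 B"
    proof
      fix z assume z: "z \<in> K"
      show "z \<in> ball 0 B"
      proof (rule ccontr)
        assume nz: "z \<notin> ball 0 B"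
        have "winding_number g z = 0" if "g \<in> set \<Gamma>'" for g
          by (rule winding_number_zero_outside[of g "ball 0 B"])
             (use is_cycleD[OF \<Gamma>'(2) that] B that nz in \<open>auto simp: cycle_image_def\<close>)
        then have "cycle_index \<Gamma>' z = 0" unfolding cycle_index_def
          by (simp cong: map_cong)
        then show False using z nz B(2) by (auto simp: K_def V_def)
      qed
    qed
    then show ?thesis by (rule bounded_subset[OF bounded_ball])
  qed
  ultimately have K: "compact K" by (simp add: compact_eq_bounded_closed)
  have KW: "K \<subseteq> W"
    using cycle_image_subset[OF \<Gamma>'(2)] \<Gamma>'(4) null by (auto simp: K_def V_def)
  obtain \<Delta>0 where \<Delta>0: "is_cycle (W - K) \<Delta>0" "\<And>F. F holomorphic_on W \<Longrightarrow> cycle_integral \<Delta>0 F = 0"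
      "\<And>z. z \<in> K \<Longrightarrow> cycle_index \<Delta>0 z = 1"
    using null_cycle_around_compact[OF K W KW] by metis
  have oWK: "open (W - K)" using W \<open>closed K\<close> by blast
  obtain \<Delta> where \<Delta>: "polynomial_paths \<Delta>" "is_cycle (W - K) \<Delta>"
      "\<And>F. F holomorphic_on (W - K) \<Longrightarrow> cycle_integral \<Delta> F = cycle_integral \<Delta>0 F"
      "\<And>z. z \<notin> W - K \<Longrightarrow> cycle_index \<Delta> z = cycle_index \<Delta>0 z"
    using polynomial_cycle_approx[OF oWK \<Delta>0(1)] by metis
  have \<Delta>_null: "cycle_integral \<Delta> G = 0" if "G holomorphic_on W" for G
    using \<Delta>(3)[of G] \<Delta>0(2)[OF that] holomorphic_on_subset[OF that, of "W - K"] by auto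
  have \<Delta>W: "is_cycle W \<Delta>" using \<Delta>(2) by (rule is_cycle_mono) auto
  have im\<Gamma>: "cycle_image \<Gamma>' \<subseteq> K" by (auto simp: K_def V_def)
  have im\<Delta>: "cycle_image \<Delta> \<subseteq> W - K" by (rule cycle_image_subset[OF \<Delta>(2)])
  have formula: "cycle_integral \<Delta> (\<lambda>w. F w / (w - z)) = 2 * pi * \<i> * F z" if "z \<in> cycle_image \<Gamma>'" for z
  proof -
    have "z \<in> K" "z \<in> W" "z \<notin> cycle_image \<Delta>" using that im\<Gamma> im\<Delta> KW by auto
    then show ?thesis
      using cycle_integral_formula_aux[OF W \<Delta>W F \<Delta>_null, of z] \<Delta>(4)[of z] \<Delta>0(3)[of z] by simp
  qed
  have cont: "continuous_on (cycle_image \<Gamma>' \<times> cycle_image \<Delta>) (\<lambda>(z, w). F w / (w - z))"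
  proof -
    have "continuous_on (cycle_image \<Delta>) F"
      using holomorphic_on_imp_continuous_on[OF F] im\<Delta> continuous_on_subset by blast
    then have "continuous_on (cycle_image \<Gamma>' \<times> cycle_image \<Delta>) (\<lambda>x. F (snd x))"
      by (rule continuous_on_compose2[of _ F _ snd]) (auto intro: continuous_on_snd continuous_on_id)
    then show ?thesis
      unfolding case_prod_unfold using im\<Gamma> im\<Delta> by (intro continuous_intros) auto
  qed
  have "2 * pi * \<i> * cycle_integral \<Gamma>' F = cycle_integral \<Gamma>' (\<lambda>z. 2 * pi * \<i> * F z)"
    by (rule cycle_integral_lmul[symmetric], rule cycle_integrable_holomorphic[OF \<Gamma>'(2) W F])
  also have "\<dots> = cycle_integral \<Gamma>' (\<lambda>z. cycle_integral \<Delta> (\<lambda>w. F w / (w - z)))"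
    by (rule cycle_integral_cong) (simp add: formula)
  also have "\<dots> = cycle_integral \<Delta> (\<lambda>w. cycle_integral \<Gamma>' (\<lambda>z. F w / (w - z)))"
    by (rule cycle_integral_swap[OF \<Gamma>'(1) \<Delta>(1) cont])
  \<comment> \<open>For fixed \<open>w\<close> outside \<open>K\<close> the inner integral is
    \<open>- F w\<close> times the integral of the Cauchy kernel, and the index of
    \<open>\<Gamma>'\<close> around \<open>w\<close> is zero by the definition of
    \<open>K\<close>.\<close>
  also have "\<dots> = cycle_integral \<Delta> (\<lambda>w. 0)"
  proof (rule cycle_integral_cong)
    fix w assume "w \<in> cycle_image \<Delta>"
    then have w: "w \<notin> K" using im\<Delta> by auto
    then have w0: "w \<notin> cycle_image \<Gamma>'" "cycle_index \<Gamma>' w = 0" by (auto simp: K_def V_def)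
    have "is_cycle (- {w}) \<Gamma>'" by (rule is_cycle_cycle_image[OF \<Gamma>'(2)]) (use w0(1) in auto)
    then have int: "cycle_integrable \<Gamma>' (\<lambda>z. 1 / (z - w))"
      by (rule cycle_integrable_holomorphic) (auto intro!: holomorphic_intros)
    have "cycle_integral \<Gamma>' (\<lambda>z. F w / (w - z)) = cycle_integral \<Gamma>' (\<lambda>z. - F w * (1 / (z - w)))"
      by (rule cycle_integral_cong) (metis minus_diff_eq minus_divide_divide mult.right_neutral times_divide_eq_right)
    also have "\<dots> = - F w * cycle_integral \<Gamma>' (\<lambda>z. 1 / (z - w))"
      by (rule cycle_integral_lmul[OF int])
    also have "\<dots> = 0" using cycle_index_eq_integral[OF \<Gamma>'(2) w0(1)] w0(2) by simp
    finally show "cycle_integral \<Gamma>' (\<lambda>z. F w / (w - z)) = 0" .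
  qed
  finally show ?thesis using \<Gamma>'(3)[OF F] by (simp add: cycle_integral_zero)
qed

text \<open>This makes the choice of a cycle in \<open>hfc\<close> meaningful. The index is zero
  outside \<open>W\<close> because the grid cycle annihilates all functions holomorphic on
  \<open>W\<close>, among them the Cauchy kernel with its pole outside \<open>W\<close>.\<close>

lemma polynomial_admissible_cycle:
  assumes K: "compact K" and W: "open W" and KW: "K \<subseteq> W"
  obtains \<Gamma> where "polynomial_paths \<Gamma>" "admissible_cycle W K \<Gamma>"
proof -
  obtain \<Delta> where \<Delta>: "is_cycle (W - K) \<Delta>" "\<And>F. F holomorphic_on W \<Longrightarrow> cycle_integral \<Delta> F = 0"
      "\<And>z. z \<in> K \<Longrightarrow> cycle_index \<Delta> z = 1"
    using null_cycle_around_compact[OF K W KW] by metis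
  have oWK: "open (W - K)" using W compact_imp_closed[OF K] by blast
  obtain \<Gamma> where \<Gamma>: "polynomial_paths \<Gamma>" "is_cycle (W - K) \<Gamma>"
      "\<And>z. z \<notin> W - K \<Longrightarrow> cycle_index \<Gamma> z = cycle_index \<Delta> z"
    using polynomial_cycle_approx[OF oWK \<Delta>(1)] by metis
  have "cycle_index \<Delta> z = 0" if "z \<notin> W" for z
  proof -
    have "(\<lambda>w. 1 / (w - z)) holomorphic_on W" using that by (auto intro!: holomorphic_intros)
    moreover have "z \<notin> cycle_image \<Delta>" using that cycle_image_subset[OF \<Delta>(1)] by auto
    ultimately show ?thesis using \<Delta>(2) cycle_index_eq_integral[OF \<Delta>(1)] by fastforce
  qed
  then have "admissible_cycle W K \<Gamma>"
    using \<Gamma> \<Delta>(3) by (auto simp: admissible_cycle_iff)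
  then show ?thesis using \<Gamma>(1) that by blast
qed

lemma cycle_integral_formula:
  assumes W: "open W" and cyc: "is_cycle W \<Gamma>" and null: "\<And>z. z \<notin> W \<Longrightarrow> cycle_index \<Gamma> z = 0"
    and F: "F holomorphic_on W" and z: "z \<in> W" "z \<notin> cycle_image \<Gamma>"
  shows "cycle_integral \<Gamma> (\<lambda>w. F w / (w - z)) = 2 * pi * \<i> * cycle_index \<Gamma> z * F z"
  by (rule cycle_integral_formula_aux[OF W cyc F Cauchy_theorem_cycle[OF W cyc null] z])

section \<open>Resolvents\<close>

lemma bopD:
  assumes "bop T"
  shows "bounded_linear T" "T (cscale c x) = cscale c (T x)" "T (x + y) = T x + T y" "T (x - y) = T x - T y" "T 0 = 0"
proof -
  show bl: "bounded_linear T" and "T (cscale c x) = cscale c (T x)" using assms by (auto simp: bop_def)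
  interpret bounded_linear T by (rule bl)
  show "T (x + y) = T x + T y" "T (x - y) = T x - T y" "T 0 = 0" by (rule add, rule diff, rule zero)
qed

lemma bopI:
  assumes "\<And>x y. T (x + y) = T x + T y" "\<And>c x. T (cscale c x) = cscale c (T x)" "\<And>x. norm (T x) \<le> C * norm x"
  shows "bop T"
proof -
  have "T (r *\<^sub>R x) = r *\<^sub>R T x" for r x
    using assms(2)[of "of_real r" x] by (simp add: cscale_of_real)
  then show ?thesis
    unfolding bop_def using assms by (auto intro!: bounded_linear_intro[where K = C] simp: mult.commute)
qed

lemma bop_bound:
  assumes "bop T" obtains C where "C \<ge> 0" "\<And>x. norm (T x) \<le> C * norm x"
  using bounded_linear.nonneg_bounded[OF bopD(1)[OF assms]] by (metis mult.commute)

lemma bop_compose: "bop S \<Longrightarrow> bop T \<Longrightarrow> bop (\<lambda>x. S (T x))"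
  unfolding bop_def by (auto intro: bounded_linear_compose)

lemma bop_diff: "bop S \<Longrightarrow> bop T \<Longrightarrow> bop (\<lambda>x. S x - T x)"
  unfolding bop_def by (auto simp: cscale_diff_right intro: bounded_linear_sub)

lemma bop_cscale: "bop (cscale c)"
  unfolding bop_def using bounded_linear_cscale_right by (auto simp: cscale_cscale mult.commute)

lemma bop_id: "bop (\<lambda>x. x)"
  by (auto simp: bop_def bounded_linear_ident)

lemma bop_shift: "bop T \<Longrightarrow> bop (\<lambda>x. cscale l x - T x)"
  by (intro bop_diff bop_cscale)

text \<open>Banach's fixed point theorem takes the place of the Neumann series: \<open>B y\<close>
  is the fixed point of the contraction taking \<open>x\<close> to \<open>y + A x\<close>.
  Uniqueness of fixed points makes \<open>B\<close> linear, and the bound follows from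
  \<open>norm (B x) \<le> norm x + q * norm (B x)\<close>.\<close>

lemma inverse_id_minus_contraction:
  fixes A :: "'a::complex_banach \<Rightarrow> 'a"
  assumes A: "bop A" and q: "0 \<le> q" "q < 1" and bound: "\<And>x. norm (A x) \<le> q * norm x"
  obtains B where "bop B" "\<And>x. B x - A (B x) = x" "\<And>x. norm (B x) \<le> 1 / (1 - q) * norm x"
proof -
  have ex: "\<exists>!x. y + A x = x" for y
    by (rule banach_fix_type[OF q]) (simp add: dist_norm bound flip: bopD(4)[OF A])
  define B where "B y = (THE x. y + A x = x)" for y
  have B: "y + A (B y) = B y" for y
    unfolding B_def by (rule theI'[OF ex])
  have uniq: "B y = x" if "y + A x = x" for x y
    using ex[of y] B[of y] that by blast
  have norm_B: "norm (B x) \<le> 1 / (1 - q) * norm x" for x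
  proof -
    have "norm (B x) \<le> norm x + q * norm (B x)"
      using norm_triangle_ineq[of x "A (B x)"] bound[of "B x"] B[of x] by simp
    then show ?thesis using q by (simp add: field_simps)
  qed
  have "bop B"
  proof (rule bopI[OF _ _ norm_B])
    show "B (x + y) = B x + B y" for x y
    proof (rule uniq)
      have "(x + y) + A (B x + B y) = (x + A (B x)) + (y + A (B y))" by (simp add: bopD(3)[OF A])
      then show "(x + y) + A (B x + B y) = B x + B y" by (simp add: B)
    qed
    show "B (cscale c x) = cscale c (B x)" for c x
      by (rule uniq) (simp add: bopD(2)[OF A] B flip: cscale_add_right)
  qed
  moreover have "B x - A (B x) = x" for x using B[of x] by (metis add_diff_cancel_right')
  ultimately show ?thesis using that norm_B by blast
qed

text \<open>The operator \<open>A R\<close> is within \<open>q\<close> of the identity, so it has a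
  right inverse \<open>B\<close>, and \<open>R B\<close> is an exact right inverse of
  \<open>A\<close>. The map \<open>L\<close> serves only to show that \<open>A\<close> is injective,
  which makes this right inverse two-sided.\<close>

lemma inverse_of_approximate_inverse:
  fixes A :: "'a::complex_banach \<Rightarrow> 'a"
  assumes A: "bop A" and R: "bop R" and q: "0 \<le> q" "q < 1" and C: "C \<ge> 0"
    and left: "\<And>x. norm (L (A x) - x) \<le> q * norm x" and L0: "L 0 = 0"
    and right: "\<And>x. norm (A (R x) - x) \<le> q * norm x"
    and norm_R: "\<And>x. norm (R x) \<le> C * norm x"
  obtains S where "bop S" "\<And>x. A (S x) = x" "\<And>x. S (A x) = x" "\<And>x. norm (S x) \<le> C / (1 - q) * norm x"
proof -
  have "bop (\<lambda>x. x - A (R x))" by (intro bop_diff bop_id bop_compose[OF A R])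
  moreover have "norm (x - A (R x)) \<le> q * norm x" for x
    using right[of x] by (simp add: norm_minus_commute)
  ultimately obtain B where B: "bop B" "\<And>x. B x - (B x - A (R (B x))) = x" "\<And>x. norm (B x) \<le> 1 / (1 - q) * norm x"
    by (rule inverse_id_minus_contraction[OF _ q]) blast
  have ARB: "A (R (B x)) = x" for x using B(2)[of x] by simp
  have inj: "x = 0" if "A x = 0" for x
  proof -
    have "norm x \<le> q * norm x" using left[of x] that L0 by simp
    then have "(1 - q) * norm x \<le> 0" by (simp add: algebra_simps)
    then show ?thesis using q by (simp add: mult_le_0_iff)
  qed
  show ?thesis
  proof (rule that[of "\<lambda>x. R (B x)"])
    show "bop (\<lambda>x. R (B x))" by (rule bop_compose[OF R B(1)])
    show "A (R (B x)) = x" for x by (rule ARB)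
    show "R (B (A x)) = x" for x
      using inj[of "R (B (A x)) - x"] ARB[of "A x"] by (simp add: bopD(4)[OF A])
    show "norm (R (B x)) \<le> C / (1 - q) * norm x" for x
      using order_trans[OF norm_R mult_left_mono[OF B(3) C], of x] by (simp add: mult.assoc)
  qed
qed

text \<open>The source of all resolvents below: from \<open>1 / l\<close> far from the origin, from
  the resolvent at a nearby point, and from the approximate resolvents of a family.\<close>

lemma resolvent_of_approximate_inverse:
  fixes T :: "'a::complex_banach \<Rightarrow> 'a"
  assumes "bop T" "bop R" "0 \<le> q" "q < 1" "C \<ge> 0"
    and "\<And>x. norm (R (cscale l x - T x) - x) \<le> q * norm x"
    and "\<And>x. norm (cscale l (R x) - T (R x) - x) \<le> q * norm x"
    and "\<And>x. norm (R x) \<le> C * norm x"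
  obtains S where "is_resolvent l T S" "\<And>x. norm (S x) \<le> C / (1 - q) * norm x"
proof (rule inverse_of_approximate_inverse[OF bop_shift[OF assms(1)] assms(2-6) bopD(5)[OF assms(2)] assms(7,8)])
  fix S assume "bop S" "\<And>x. cscale l (S x) - T (S x) = x" "\<And>x. S (cscale l x - T x) = x"
    "\<And>x. norm (S x) \<le> C / (1 - q) * norm x"
  then show thesis by (intro that[of S]) (auto simp: is_resolvent_def)
qed

lemma is_resolvent_unique:
  assumes "is_resolvent l T S" "is_resolvent l T S'" shows "S = S'"
proof
  fix x
  have "S x = S (cscale l (S' x) - T (S' x))" using assms(2) by (simp add: is_resolvent_def)
  also have "\<dots> = S' x" using assms(1) by (simp add: is_resolvent_def)
  finally show "S x = S' x" .
qed

lemma resolv_eq: "is_resolvent l T S \<Longrightarrow> resolv l T = S"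
  unfolding resolv_def by (rule some_equality) (auto intro: is_resolvent_unique)

lemma is_resolvent_resolv: "l \<notin> sp T \<Longrightarrow> is_resolvent l T (resolv l T)"
  unfolding sp_def resolv_def using someI_ex[of "is_resolvent l T"] by auto

lemma not_in_sp: "is_resolvent l T S \<Longrightarrow> l \<notin> sp T"
  by (auto simp: sp_def)

lemma resolvD:
  assumes "l \<notin> sp T"
  shows "bop (resolv l T)" "cscale l (resolv l T x) - T (resolv l T x) = x" "resolv l T (cscale l x - T x) = x"
  using is_resolvent_resolv[OF assms] by (auto simp: is_resolvent_def)

lemma T_resolv: "l \<notin> sp T \<Longrightarrow> T (resolv l T x) = cscale l (resolv l T x) - x"
  using resolvD(2)[of l T x] by (simp add: algebra_simps)

lemma resolv_T: "bop T \<Longrightarrow> l \<notin> sp T \<Longrightarrow> resolv l T (T x) = cscale l (resolv l T x) - x"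
  using resolvD(3)[of l T x] by (simp add: bopD(4)[OF resolvD(1)] bopD(2)[OF resolvD(1)] algebra_simps)

text \<open>The scalar \<open>1 / l\<close> is an approximate inverse with error at most
  \<open>M / cmod l < 1\<close>. The bound is then read off from
  \<open>l R x = x + T (R x)\<close>.\<close>

lemma resolvent_outside_ball:
  fixes T :: "'a::complex_banach \<Rightarrow> 'a"
  assumes T: "bop T" and M: "M \<ge> 0" "\<And>x. norm (T x) \<le> M * norm x" and l: "cmod l > M"
  shows "l \<notin> sp T" "norm (resolv l T x) \<le> 1 / (cmod l - M) * norm x"
proof -
  have l0: "l \<noteq> 0" using l M by auto
  have bd: "norm (T x) / cmod l \<le> M / cmod l * norm x" for x
    using divide_right_mono[OF M(2)[of x], of "cmod l"] by simp
  obtain S where S: "is_resolvent l T S"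
  proof (rule resolvent_of_approximate_inverse[of T "cscale (1 / l)" "M / cmod l" "1 / cmod l" l])
    show "norm (cscale (1 / l) (cscale l x - T x) - x) \<le> M / cmod l * norm x" for x
      using l0 bd[of x] by (simp add: cscale_diff_right cscale_cscale cscale_one norm_cscale norm_divide)
    show "norm (cscale l (cscale (1 / l) x) - T (cscale (1 / l) x) - x) \<le> M / cmod l * norm x" for x
      using l0 bd[of x] by (simp add: bopD(2)[OF T] cscale_cscale cscale_one norm_cscale norm_divide)
  qed (use T l l0 M in \<open>auto simp: bop_cscale norm_cscale norm_divide\<close>)
  then show nsp: "l \<notin> sp T" by (rule not_in_sp)
  have "cscale l (resolv l T x) = x + T (resolv l T x)" using T_resolv[OF nsp, of x] by simp
  then have "cmod l * norm (resolv l T x) \<le> norm x + M * norm (resolv l T x)"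
    using norm_triangle_ineq[of x "T (resolv l T x)"] M(2)[of "resolv l T x"] norm_cscale[of l "resolv l T x"] by simp
  then show "norm (resolv l T x) \<le> 1 / (cmod l - M) * norm x"
    using l by (simp add: field_simps)
qed

text \<open>The resolvent at \<open>l\<close> is an approximate inverse at \<open>w\<close>, and
  both error terms equal \<open>cscale (w - l) (resolv l T x)\<close>. The admissible distance
  depends on \<open>T\<close> only through \<open>C\<close>, so it is the same for all members of a
  family with a common bound.\<close>

lemma resolvent_perturb:
  fixes T :: "'a::complex_banach \<Rightarrow> 'a"
  assumes T: "bop T" and l: "l \<notin> sp T" and C: "C \<ge> 0" "\<And>x. norm (resolv l T x) \<le> C * norm x"
    and w: "cmod (w - l) * C \<le> 1 / 2"
  shows "w \<notin> sp T" "norm (resolv w T x) \<le> 2 * C * norm x"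
proof -
  note R = resolvD[OF l]
  have bd: "cmod (w - l) * norm (resolv l T x) \<le> 1 / 2 * norm x" for x
  proof -
    have "cmod (w - l) * norm (resolv l T x) \<le> cmod (w - l) * (C * norm x)"
      by (intro mult_left_mono C) auto
    also have "\<dots> \<le> 1 / 2 * norm x" using mult_right_mono[OF w, of "norm x"] by (simp add: mult.assoc)
    finally show ?thesis .
  qed
  obtain S where S: "is_resolvent w T S" "\<And>x. norm (S x) \<le> C / (1 - 1 / 2) * norm x"
  proof (rule resolvent_of_approximate_inverse[of T "resolv l T" "1 / 2" C w])
    have "resolv l T (cscale w x - T x) - x = cscale (w - l) (resolv l T x)" for x
      by (simp add: bopD[OF R(1)] resolv_T[OF T l] cscale_diff_left)
    then show "norm (resolv l T (cscale w x - T x) - x) \<le> 1 / 2 * norm x" for x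
      using bd[of x] by (simp only: norm_cscale)
    have "cscale w (resolv l T x) - T (resolv l T x) - x = cscale (w - l) (resolv l T x)" for x
      by (simp add: T_resolv[OF l] cscale_diff_left)
    then show "norm (cscale w (resolv l T x) - T (resolv l T x) - x) \<le> 1 / 2 * norm x" for x
      using bd[of x] by (simp only: norm_cscale)
  qed (use T R C in auto)
  show "w \<notin> sp T" "norm (resolv w T x) \<le> 2 * C * norm x"
    using not_in_sp[OF S(1)] S(2) resolv_eq[OF S(1)] by (auto simp: mult.commute)
qed

lemma resolvent_identity:
  assumes T: "bop T" and w: "w \<notin> sp T" and z: "z \<notin> sp T"
  shows "resolv w T x - resolv z T x = cscale (z - w) (resolv w T (resolv z T x))"
proof -
  define y where "y = resolv z T x"
  have "y = resolv w T (cscale w y - T y)" by (rule resolvD(3)[OF w, symmetric])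
  also have "cscale w y - T y = cscale (w - z) y + x"
    by (simp add: y_def T_resolv[OF z] cscale_diff_left)
  finally have "y = cscale (w - z) (resolv w T y) + resolv w T x"
    by (simp add: bopD[OF resolvD(1)[OF w]])
  then show ?thesis
    by (simp add: y_def cscale_diff_left algebra_simps)
qed

lemma compact_sp:
  fixes T :: "'a::complex_banach \<Rightarrow> 'a"
  assumes T: "bop T" shows "compact (sp T)"
proof -
  obtain M where M: "M \<ge> 0" "\<And>x. norm (T x) \<le> M * norm x" using bop_bound[OF T] by metis
  have "sp T \<subseteq> cball 0 M"
    using resolvent_outside_ball(1)[OF T M] by (force simp: not_less)
  moreover have "open (- sp T)"
    unfolding open_contains_ball
  proof
    fix l assume "l \<in> - sp T"
    then have l: "l \<notin> sp T" by simp
    obtain C where C: "C \<ge> 0" "\<And>x. norm (resolv l T x) \<le> C * norm x" using bop_bound[OF resolvD(1)[OF l]] by metis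
    \<comment> \<open>The radius is \<open>1 / (2 * (C + 1))\<close> instead of
      \<open>1 / (2 * C)\<close> because \<open>C\<close> may be zero.\<close>
    have "w \<notin> sp T" if "w \<in> ball l (1 / (2 * (C + 1)))" for w
    proof (rule resolvent_perturb(1)[OF T l C])
      have "cmod (w - l) \<le> 1 / (2 * (C + 1))" using that by (simp add: dist_norm norm_minus_commute)
      then have "cmod (w - l) * C \<le> 1 / (2 * (C + 1)) * C" using C(1) by (rule mult_right_mono)
      also have "\<dots> \<le> 1 / 2" using C(1) by (simp add: field_simps)
      finally show "cmod (w - l) * C \<le> 1 / 2" .
    qed
    then show "\<exists>e>0. ball l e \<subseteq> - sp T"
      using C(1) by (intro exI[of _ "1 / (2 * (C + 1))"]) auto
  qed
  ultimately show ?thesis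
    by (metis bounded_cball bounded_subset closed_def compact_eq_bounded_closed)
qed

lemma open_resolvent_set: "bop T \<Longrightarrow> open (- sp T)"
  by (simp add: compact_sp compact_imp_closed open_Compl)

lemma isCont_resolvent:
  fixes T :: "'a::complex_banach \<Rightarrow> 'a"
  assumes T: "bop T" and l: "l \<notin> sp T" shows "isCont (\<lambda>w. resolv w T x) l"
proof -
  obtain C where C: "C \<ge> 0" "\<And>x. norm (resolv l T x) \<le> C * norm x" using bop_bound[OF resolvD(1)[OF l]] by metis
  have "\<forall>\<^sub>F w in at l. cmod (w - l) < 1 / (2 * (C + 1))"
    using C(1) eventually_at[of "\<lambda>w. cmod (w - l) < 1 / (2 * (C + 1))" l UNIV] by (auto simp: dist_norm intro!: exI[of _ "1 / (2 * (C + 1))"])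
  then have ev: "\<forall>\<^sub>F w in at l. norm (resolv w T x - resolv l T x) \<le> cmod (l - w) * (2 * C * (C * norm x))"
  proof eventually_elim
    case (elim w)
    have "cmod (w - l) * C \<le> 1 / (2 * (C + 1)) * C" using elim C(1) by (intro mult_right_mono) auto
    also have "\<dots> \<le> 1 / 2" using C(1) by (simp add: field_simps)
    finally have w: "w \<notin> sp T" "\<And>x. norm (resolv w T x) \<le> 2 * C * norm x"
      using resolvent_perturb[OF T l C] by auto
    have "norm (resolv w T (resolv l T x)) \<le> 2 * C * norm (resolv l T x)" by (rule w(2))
    also have "\<dots> \<le> 2 * C * (C * norm x)" using C by (intro mult_left_mono) auto
    finally show ?case
      by (simp add: resolvent_identity[OF T w(1) l] norm_cscale mult_left_mono)
  qed
  have "((\<lambda>w. cmod (l - w) * (2 * C * (C * norm x))) \<longlongrightarrow> cmod (l - l) * (2 * C * (C * norm x))) (at l)"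
    by (intro tendsto_intros)
  then have "((\<lambda>w. cmod (l - w) * (2 * C * (C * norm x))) \<longlongrightarrow> 0) (at l)" by simp
  then have "((\<lambda>w. resolv w T x - resolv l T x) \<longlongrightarrow> 0) (at l)"
    by (rule Lim_null_comparison[OF ev])
  then show ?thesis unfolding isCont_def by (rule LIM_zero_cancel)
qed

section \<open>Functionals of the resolvent and vector-valued primitives\<close>

lemma cfunctionalD:
  assumes "cfunctional \<phi>"
  shows "bounded_linear \<phi>" "\<phi> (cscale c x) = c * \<phi> x" "\<phi> (x + y) = \<phi> x + \<phi> y" "\<phi> (x - y) = \<phi> x - \<phi> y" "\<phi> 0 = 0"
proof -
  show bl: "bounded_linear \<phi>" and "\<phi> (cscale c x) = c * \<phi> x" using assms by (auto simp: cfunctional_def)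
  interpret bounded_linear \<phi> by (rule bl)
  show "\<phi> (x + y) = \<phi> x + \<phi> y" "\<phi> (x - y) = \<phi> x - \<phi> y" "\<phi> 0 = 0" by (rule add, rule diff, rule zero)
qed

lemma cfunctional_eqI:
  assumes "\<And>\<phi>. cfunctional \<phi> \<Longrightarrow> \<phi> x = \<phi> y" shows "x = y"
  using cfunctional_separates[of "x - y"] assms by (simp add: cfunctionalD(4))

text \<open>Applying the scalar formula for \<open>hfc\<close> to the functional
  \<open>\<phi>\<close> composed with \<open>T\<close> moves the operator \<open>T\<close> under the
  integral sign.\<close>

lemma cfunctional_bop: "cfunctional \<phi> \<Longrightarrow> bop T \<Longrightarrow> cfunctional (\<lambda>x. \<phi> (T x))"
  unfolding cfunctional_def bop_def by (auto intro: bounded_linear_compose)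

text \<open>By the resolvent identity the difference quotient at \<open>l\<close> is
  \<open>- \<phi> (resolv w T (resolv l T x))\<close>, and strong continuity of the resolvent gives
  its limit.\<close>

lemma holomorphic_resolvent:
  fixes T :: "'a::complex_banach \<Rightarrow> 'a"
  assumes T: "bop T" and \<phi>: "cfunctional \<phi>"
  shows "(\<lambda>w. \<phi> (resolv w T x)) holomorphic_on (- sp T)"
  unfolding holomorphic_on_open[OF open_resolvent_set[OF T]]
proof (intro ballI exI)
  fix l assume "l \<in> - sp T"
  then have l: "l \<notin> sp T" by simp
  have lim: "((\<lambda>w. - \<phi> (resolv w T (resolv l T x))) \<longlongrightarrow> - \<phi> (resolv l T (resolv l T x))) (at l)"
    using isCont_resolvent[OF T l, of "resolv l T x"] unfolding isCont_def
    by (intro tendsto_minus bounded_linear.tendsto[OF cfunctionalD(1)[OF \<phi>]])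
  have "\<forall>\<^sub>F w in at l. w \<in> - sp T"
    using open_resolvent_set[OF T] l by (intro eventually_at_in_open') auto
  then have "\<forall>\<^sub>F w in at l. - \<phi> (resolv w T (resolv l T x)) = (\<phi> (resolv w T x) - \<phi> (resolv l T x)) / (w - l)"
    using eventually_neq_at_within[of l l UNIV]
  proof eventually_elim
    case (elim w)
    have "\<phi> (resolv w T x) - \<phi> (resolv l T x) = (l - w) * \<phi> (resolv w T (resolv l T x))"
      using resolvent_identity[OF T _ l, of w x] elim by (simp add: cfunctionalD[OF \<phi>] flip: cfunctionalD(4)[OF \<phi>])
    also have "\<dots> = - \<phi> (resolv w T (resolv l T x)) * (w - l)" by (simp add: algebra_simps)
    finally show ?case using elim by simp
  qed
  then show "((\<lambda>w. \<phi> (resolv w T x)) has_field_derivative (- \<phi> (resolv l T (resolv l T x)))) (at l)"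
    unfolding has_field_derivative_iff using lim by (rule tendsto_cong[THEN iffD1])
qed

text \<open>A valid path need not be rectifiable, so continuity of the integrand would not be enough for
  integrability; local primitives are.\<close>

lemma local_primitive:
  fixes F :: "complex \<Rightarrow> 'a::complex_banach"
  assumes F: "continuous_on (ball a r) F" and hol: "\<And>\<phi>. cfunctional \<phi> \<Longrightarrow> (\<lambda>w. \<phi> (F w)) holomorphic_on ball a r"
  obtains P where "\<And>z. z \<in> ball a r \<Longrightarrow> (P has_derivative (\<lambda>h. cscale h (F z))) (at z)"
proof -
  define I where "I u v = integral {0..1} (\<lambda>t. cscale (v - u) (F (linepath u v t)))" for u v
  have cont: "continuous_on {0..1} (\<lambda>t. F (linepath u v t))" if "u \<in> ball a r" "v \<in> ball a r" for u v
  proof (rule continuous_on_compose2[OF F])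
    show "linepath u v ` {0..1} \<subseteq> ball a r"
      using that closed_segment_subset[of u "ball a r" v] by (simp add: path_image_def[symmetric])
  qed (rule continuous_on_linepath)
  have int: "(\<lambda>t. cscale (v - u) (F (linepath u v t))) integrable_on {0..1}" if "u \<in> ball a r" "v \<in> ball a r" for u v
    by (intro integrable_continuous_real bounded_linear.continuous_on[OF bounded_linear_cscale_right] cont that)
  have \<phi>I: "\<phi> (I u v) = contour_integral (linepath u v) (\<lambda>w. \<phi> (F w))"
    if "cfunctional \<phi>" "u \<in> ball a r" "v \<in> ball a r" for \<phi> u v
    using integral_linear[OF int[OF that(2,3)] cfunctionalD(1)[OF that(1)]]
    by (simp add: I_def contour_integral_integral o_def cfunctionalD(2)[OF that(1)] mult.commute)
  \<comment> \<open>Tested with functionals, this is Cauchy's theorem for the triangle with vertices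
    \<open>a\<close>, \<open>u\<close>, \<open>v\<close>, which lies in the ball by
    convexity.\<close>
  have triangle: "I a v - I a u = I u v" if "u \<in> ball a r" "v \<in> ball a r" for u v
  proof (rule cfunctional_eqI)
    fix \<phi> :: "'a \<Rightarrow> complex" assume \<phi>: "cfunctional \<phi>"
    have a: "a \<in> ball a r" using that by (metis ball_eq_empty centre_in_ball empty_iff not_le)
    have "convex hull {a, u, v} \<subseteq> ball a r"
      by (rule hull_minimal) (use a that in auto)
    then have "((\<lambda>w. \<phi> (F w)) has_contour_integral 0) (linepath a u +++ linepath u v +++ linepath v a)"
      by (intro Cauchy_theorem_triangle holomorphic_on_subset[OF hol[OF \<phi>]])
    then have "contour_integral (linepath a u +++ linepath u v +++ linepath v a) (\<lambda>w. \<phi> (F w)) = 0"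
      by (rule contour_integral_unique)
    moreover have *: "(\<lambda>w. \<phi> (F w)) contour_integrable_on linepath x y" if "x \<in> ball a r" "y \<in> ball a r" for x y
      by (rule contour_integrable_continuous_linepath, rule continuous_on_subset[OF holomorphic_on_imp_continuous_on[OF hol[OF \<phi>]]])
         (use that in \<open>simp add: closed_segment_subset\<close>)
    ultimately have "contour_integral (linepath a u) (\<lambda>w. \<phi> (F w)) + (contour_integral (linepath u v) (\<lambda>w. \<phi> (F w)) +
        contour_integral (linepath v a) (\<lambda>w. \<phi> (F w))) = 0"
      using *[OF a that(1)] *[OF that] *[OF that(2) a] by (simp add: contour_integrable_joinI)
    moreover have "contour_integral (linepath v a) (\<lambda>w. \<phi> (F w)) = - contour_integral (linepath a v) (\<lambda>w. \<phi> (F w))"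
      using contour_integral_reversepath[of "linepath a v"] by (simp add: reversepath_linepath)
    ultimately show "\<phi> (I a v - I a u) = \<phi> (I u v)"
      using that a by (simp add: cfunctionalD[OF \<phi>] \<phi>I[OF \<phi>] algebra_simps)
  qed
  show ?thesis
  proof (rule that[of "I a"])
    fix z assume z: "z \<in> ball a r"
    show "(I a has_derivative (\<lambda>h. cscale h (F z))) (at z)"
      unfolding has_derivative_at_alt
    proof (intro conjI allI impI)
      show "bounded_linear (\<lambda>h. cscale h (F z))"
        by (rule bounded_bilinear.bounded_linear_left[OF bounded_bilinear_cscale])
      fix e :: real assume e: "e > 0"
      have "isCont F z" using F z by (simp add: continuous_on_eq_continuous_at)
      then obtain d1 where d1: "d1 > 0" "\<And>w. dist w z < d1 \<Longrightarrow> dist (F w) (F z) < e"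
        using e unfolding continuous_at_eps_delta by metis
      obtain d2 where d2: "d2 > 0" "ball z d2 \<subseteq> ball a r" using z open_ball by (meson openE)
      define d where "d = min d1 d2"
      have "norm (I a y - I a z - cscale (y - z) (F z)) \<le> e * norm (y - z)" if y: "norm (y - z) < d" for y
      proof -
        have yb: "y \<in> ball a r" using y d2(2) by (auto simp: d_def dist_norm norm_minus_commute subset_iff)
        have "I a y - I a z - cscale (y - z) (F z) = I z y - integral {0..1} (\<lambda>t::real. cscale (y - z) (F z))"
          by (simp add: triangle[OF z yb])
        also have "\<dots> = integral {0..1} (\<lambda>t. cscale (y - z) (F (linepath z y t)) - cscale (y - z) (F z))"
          unfolding I_def by (rule integral_diff[symmetric, OF int[OF z yb] integrable_continuous_real[OF continuous_on_const]])
        also have "\<dots> = integral {0..1} (\<lambda>t. cscale (y - z) (F (linepath z y t) - F z))"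
          by (simp add: cscale_diff_right)
        also have "norm \<dots> \<le> (norm (y - z) * e) * (1 - 0)"
        proof (rule integral_bound)
          show "continuous_on {0..1} (\<lambda>t. cscale (y - z) (F (linepath z y t) - F z))"
            by (intro bounded_linear.continuous_on[OF bounded_linear_cscale_right] continuous_on_diff cont z yb continuous_on_const)
          fix t :: real assume t: "t \<in> {0..1}"
          have "linepath z y t \<in> closed_segment z y" using t by (metis image_eqI path_image_def path_image_linepath)
          then have "dist (linepath z y t) z \<le> dist y z"
            by (metis dist_in_closed_segment dist_commute)
          then have "norm (F (linepath z y t) - F z) \<le> e"
            using d1(2)[of "linepath z y t"] y by (simp add: d_def dist_norm)
          then show "norm (cscale (y - z) (F (linepath z y t) - F z)) \<le> norm (y - z) * e"
            by (simp add: norm_cscale mult_left_mono)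
        qed simp
        finally show ?thesis by (simp add: mult.commute)
      qed
      then show "\<exists>d>0. \<forall>y. norm (y - z) < d \<longrightarrow> norm (I a y - I a z - cscale (y - z) (F z)) \<le> e * norm (y - z)"
        using d1(1) d2(1) by (intro exI[of _ d]) (auto simp: d_def)
    qed
  qed
qed

text \<open>Near each parameter \<open>s\<close> the path stays in a ball where \<open>F\<close> has
  a primitive \<open>P\<close>, and the fundamental theorem of calculus with finitely many
  exceptional points applies to \<open>P (g t)\<close>. Integrability on small intervals around
  every point gives integrability on \<open>{0..1}\<close>.\<close>

lemma valid_path_integrable:
  fixes F :: "complex \<Rightarrow> 'a::complex_banach"
  assumes V: "open V" and F: "continuous_on V F" and hol: "\<And>\<phi>. cfunctional \<phi> \<Longrightarrow> (\<lambda>w. \<phi> (F w)) holomorphic_on V"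
    and g: "valid_path g" "path_image g \<subseteq> V"
  shows "(\<lambda>t. cscale (vector_derivative g (at t within {0..1})) (F (g t))) integrable_on {0..1}"
proof -
  let ?f = "\<lambda>t. cscale (vector_derivative g (at t within {0..1})) (F (g t))"
  obtain S where S: "finite S" "g C1_differentiable_on ({0..1} - S)" and cg: "continuous_on {0..1} g"
    using g(1) by (auto simp: valid_path_def piecewise_C1_differentiable_on_def)
  have "?f integrable_on cbox 0 1"
  proof (rule integrable_on_little_subintervals, rule ballI)
    fix s :: real assume s: "s \<in> cbox 0 1"
    then have gs: "g s \<in> V" using g(2) by (auto simp: path_image_def)
    then obtain r where r: "r > 0" "ball (g s) r \<subseteq> V" using V by (meson openE)
    obtain P where P: "\<And>z. z \<in> ball (g s) r \<Longrightarrow> (P has_derivative (\<lambda>h. cscale h (F z))) (at z)"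
      by (rule local_primitive[OF continuous_on_subset[OF F r(2)] holomorphic_on_subset[OF hol r(2)]]) blast+
    obtain d where d: "d > 0" "\<And>t. t \<in> {0..1} \<Longrightarrow> dist t s < d \<Longrightarrow> dist (g t) (g s) < r"
      using cg s r(1) unfolding continuous_on_iff by (metis box_real(2))
    have "?f integrable_on cbox u v" if uv: "s \<in> cbox u v" "cbox u v \<subseteq> ball s d" "cbox u v \<subseteq> cbox 0 1" for u v
    proof -
      have gball: "g t \<in> ball (g s) r" if "t \<in> {u..v}" for t
        using d(2)[of t] that uv by (auto simp: dist_commute subset_iff)
      have "(?f has_integral (P (g v) - P (g u))) {u..v}"
      proof (rule fundamental_theorem_of_calculus_interior_strong[OF S(1)])
        show "u \<le> v" using uv(1) by auto
        have "continuous_on (ball (g s) r) P"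
          using P by (meson has_derivative_continuous continuous_at_imp_continuous_on)
        then show "continuous_on {u..v} (\<lambda>t. P (g t))"
          by (rule continuous_on_compose2[OF _ continuous_on_subset[OF cg]]) (use gball uv(3) in auto)
        fix t assume t: "t \<in> {u<..<v} - S"
        \<comment> \<open>The derivative in the integrand is relative to \<open>{0..1}\<close>; it
          agrees with the two-sided derivative at interior parameters.\<close>
        have t01: "t \<in> {0..1} - S" "0 < t" "t < 1"
        proof -
          have "u \<in> {0..1}" "v \<in> {0..1}" using uv t by (auto simp: subset_iff)
          then show "t \<in> {0..1} - S" "0 < t" "t < 1" using t by auto
        qed
        then have "(g has_vector_derivative vector_derivative g (at t)) (at t)"
          using S(2) by (simp add: C1_differentiable_on_eq vector_derivative_works)
        moreover from this have "vector_derivative g (at t within {0..1}) = vector_derivative g (at t)"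
          using vector_derivative_at_within_ivl t01 by fastforce
        ultimately have "(g has_derivative (\<lambda>h. h *\<^sub>R vector_derivative g (at t within {0..1}))) (at t)"
          by (simp add: has_vector_derivative_def)
        then have "((\<lambda>t. P (g t)) has_derivative (\<lambda>h. cscale (h *\<^sub>R vector_derivative g (at t within {0..1})) (F (g t)))) (at t)"
          by (rule has_derivative_compose) (use P gball t in auto)
        then show "((\<lambda>t. P (g t)) has_vector_derivative ?f t) (at t)"
          by (simp add: has_vector_derivative_def scaleR_cscale)
      qed
      then show ?thesis by (auto simp: integrable_on_def)
    qed
    then show "\<exists>d>0. \<forall>u v. s \<in> cbox u v \<and> cbox u v \<subseteq> ball s d \<and> cbox u v \<subseteq> cbox 0 1 \<longrightarrow> ?f integrable_on cbox u v"
      using d(1) by blast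
  qed
  then show ?thesis by simp
qed

section \<open>The holomorphic functional calculus\<close>

text \<open>The integral in \<open>hfc\<close> with the cycle as a parameter and without the factor
  \<open>1 / (2 * of_real pi * \<i>)\<close>.\<close>

definition vcycle_integral ::
  "(real \<Rightarrow> complex) list \<Rightarrow> (complex \<Rightarrow> complex) \<Rightarrow> ('a::complex_banach \<Rightarrow> 'a) \<Rightarrow> 'a \<Rightarrow> 'a" where
  "vcycle_integral \<Gamma> f T x = (\<Sum>g\<leftarrow>\<Gamma>. integral {0..1}
      (\<lambda>t. cscale (f (g t) * vector_derivative g (at t within {0..1})) (resolv (g t) T x)))"

text \<open>Moving \<open>\<phi>\<close> under \<open>integral\<close> requires integrability of the
  vector-valued integrand. It has to be available for all valid paths, because nothing more is known
  of the cycle chosen in \<open>hfc\<close>.\<close>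

lemma cfunctional_vcycle_integral:
  assumes T: "bop T" and Om: "open Om" and f: "f holomorphic_on Om" and \<Gamma>: "is_cycle (Om - sp T) \<Gamma>"
    and \<phi>: "cfunctional \<phi>"
  shows "\<phi> (vcycle_integral \<Gamma> f T x) = cycle_integral \<Gamma> (\<lambda>w. f w * \<phi> (resolv w T x))"
proof -
  define V where "V = Om - sp T"
  define F where "F w = cscale (f w) (resolv w T x)" for w
  have V: "open V" using Om open_resolvent_set[OF T] by (simp add: V_def Diff_eq open_Int)
  have "continuous_on V (\<lambda>w. resolv w T x)"
    by (intro continuous_at_imp_continuous_on ballI isCont_resolvent T) (simp add: V_def)
  moreover have "continuous_on V f"
    using holomorphic_on_imp_continuous_on[OF f] by (rule continuous_on_subset) (auto simp: V_def)
  ultimately have contF: "continuous_on V F"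
    unfolding F_def by (intro bounded_bilinear.continuous_on[OF bounded_bilinear_cscale])
  have holF: "(\<lambda>w. \<psi> (F w)) holomorphic_on V" if "cfunctional \<psi>" for \<psi>
    unfolding F_def cfunctionalD(2)[OF that]
    by (intro holomorphic_on_mult holomorphic_on_subset[OF f] holomorphic_on_subset[OF holomorphic_resolvent[OF T that]])
       (auto simp: V_def)
  have "\<phi> (integral {0..1} (\<lambda>t. cscale (f (g t) * vector_derivative g (at t within {0..1})) (resolv (g t) T x))) =
      contour_integral g (\<lambda>w. f w * \<phi> (resolv w T x))" if g: "g \<in> set \<Gamma>" for g
  proof -
    have "(\<lambda>t. cscale (vector_derivative g (at t within {0..1})) (F (g t))) integrable_on {0..1}"
      using is_cycleD[OF \<Gamma> g] by (intro valid_path_integrable[OF V contF holF]) (auto simp: V_def)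
    then have "((\<lambda>t. cscale (vector_derivative g (at t within {0..1})) (F (g t))) has_integral
        integral {0..1} (\<lambda>t. cscale (vector_derivative g (at t within {0..1})) (F (g t)))) {0..1}"
      by (rule integrable_integral)
    then have "(\<phi> \<circ> (\<lambda>t. cscale (vector_derivative g (at t within {0..1})) (F (g t))) has_integral
        \<phi> (integral {0..1} (\<lambda>t. cscale (vector_derivative g (at t within {0..1})) (F (g t))))) {0..1}"
      by (rule has_integral_linear) (rule cfunctionalD(1)[OF \<phi>])
    then have "((\<lambda>w. f w * \<phi> (resolv w T x)) has_contour_integral
        \<phi> (integral {0..1} (\<lambda>t. cscale (vector_derivative g (at t within {0..1})) (F (g t))))) g"
      unfolding has_contour_integral_def by (simp add: F_def o_def cfunctionalD(2)[OF \<phi>] mult_ac)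
    then show ?thesis
      by (simp add: contour_integral_unique F_def cscale_cscale mult.commute)
  qed
  then have *: "map (\<lambda>g. \<phi> (integral {0..1} (\<lambda>t. cscale (f (g t) * vector_derivative g (at t within {0..1})) (resolv (g t) T x)))) \<Gamma> =
      map (\<lambda>g. contour_integral g (\<lambda>w. f w * \<phi> (resolv w T x))) \<Gamma>"
    by (rule map_cong[OF refl])
  have sum: "\<phi> (\<Sum>g\<leftarrow>G. H g) = (\<Sum>g\<leftarrow>G. \<phi> (H g))" for H :: "(real \<Rightarrow> complex) \<Rightarrow> 'a" and G
    by (induction G) (simp_all add: cfunctionalD[OF \<phi>])
  show ?thesis
    unfolding vcycle_integral_def cycle_integral_def sum * ..
qed

lemma admissible_cycleD:
  assumes "admissible_cycle Om K \<Gamma>"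
  shows "is_cycle (Om - K) \<Gamma>" "z \<in> K \<Longrightarrow> cycle_index \<Gamma> z = 1" "z \<notin> Om \<Longrightarrow> cycle_index \<Gamma> z = 0" "is_cycle Om \<Gamma>"
  using assms by (auto simp: admissible_cycle_iff intro: is_cycle_mono)

text \<open>The difference of the two cycles has index \<open>1 - 1\<close> on \<open>K\<close> and
  \<open>0 - 0\<close> outside \<open>Om\<close>, so it is null-homologous in
  \<open>Om - K\<close>.\<close>

lemma admissible_cycle_integral_unique:
  assumes Om: "open Om" and K: "closed K" and adm: "admissible_cycle Om K \<Gamma>" "admissible_cycle Om K \<Delta>"
    and F: "F holomorphic_on (Om - K)"
  shows "cycle_integral \<Gamma> F = cycle_integral \<Delta> F"
proof -
  note \<Gamma> = admissible_cycleD[OF adm(1)] and \<Delta> = admissible_cycleD[OF adm(2)]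
  have "cycle_integral (\<Gamma> @ map reversepath \<Delta>) F = 0"
  proof (rule Cauchy_theorem_cycle[of "Om - K"])
    show "is_cycle (Om - K) (\<Gamma> @ map reversepath \<Delta>)"
      using \<Gamma>(1) \<Delta>(1) by (simp add: is_cycle_append is_cycle_reverse)
    fix z assume z: "z \<notin> Om - K"
    then have "z \<notin> cycle_image \<Delta>" using cycle_image_subset[OF \<Delta>(1)] by auto
    then have "cycle_index (\<Gamma> @ map reversepath \<Delta>) z = cycle_index \<Gamma> z - cycle_index \<Delta> z"
      by (simp add: cycle_index_append cycle_index_reverse[OF \<Delta>(1)])
    also have "\<dots> = 0" using z \<Gamma>(2,3)[of z] \<Delta>(2,3)[of z] by (cases "z \<in> K") auto
    finally show "cycle_index (\<Gamma> @ map reversepath \<Delta>) z = 0" .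
  qed (use F Om K in auto)
  then show ?thesis by (simp add: cycle_integral_append cycle_integral_reverse[OF \<Delta>(1)])
qed

lemma cycle_integrable_lmul: "cycle_integrable \<Gamma> F \<Longrightarrow> cycle_integrable \<Gamma> (\<lambda>w. c * F w)"
  by (auto simp: cycle_integrable_def intro: contour_integrable_lmul)

lemma holomorphic_times_resolvent:
  assumes "bop T" "f holomorphic_on Om" "cfunctional \<phi>"
  shows "(\<lambda>w. f w * \<phi> (resolv w T x)) holomorphic_on (Om - sp T)"
  by (intro holomorphic_on_mult holomorphic_on_subset[OF assms(2)] holomorphic_on_subset[OF holomorphic_resolvent[OF assms(1,3)]]) auto

text \<open>Existence of \<open>\<Gamma>\<close> guarantees that the cycle chosen by
  \<open>SOME\<close> is admissible too, and the two integrals agree after every functional. From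
  here on the chosen cycle is never looked at again.\<close>

lemma hfc_eq_vcycle_integral:
  assumes T: "bop T" and Om: "open Om" and f: "f holomorphic_on Om" and adm: "admissible_cycle Om (sp T) \<Gamma>"
  shows "hfc Om f T x = cscale (1 / (2 * of_real pi * \<i>)) (vcycle_integral \<Gamma> f T x)"
proof -
  define \<Delta> where "\<Delta> = (SOME \<Gamma>. admissible_cycle Om (sp T) \<Gamma>)"
  have \<Delta>: "admissible_cycle Om (sp T) \<Delta>" unfolding \<Delta>_def by (rule someI[of "admissible_cycle Om (sp T)", OF adm])
  have "vcycle_integral \<Delta> f T x = vcycle_integral \<Gamma> f T x"
  proof (rule cfunctional_eqI)
    fix \<phi> :: "'a \<Rightarrow> complex" assume \<phi>: "cfunctional \<phi>"
    show "\<phi> (vcycle_integral \<Delta> f T x) = \<phi> (vcycle_integral \<Gamma> f T x)"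
      unfolding cfunctional_vcycle_integral[OF T Om f admissible_cycleD(1)[OF \<Delta>] \<phi>]
        cfunctional_vcycle_integral[OF T Om f admissible_cycleD(1)[OF adm] \<phi>]
      by (rule admissible_cycle_integral_unique[OF Om compact_imp_closed[OF compact_sp[OF T]] \<Delta> adm
            holomorphic_times_resolvent[OF T f \<phi>]])
  qed
  then show ?thesis by (simp add: hfc_def vcycle_integral_def \<Delta>_def Let_def)
qed

lemma cfunctional_hfc:
  assumes T: "bop T" and Om: "open Om" and f: "f holomorphic_on Om" and adm: "admissible_cycle Om (sp T) \<Gamma>"
    and \<phi>: "cfunctional \<phi>"
  shows "\<phi> (hfc Om f T x) = 1 / (2 * of_real pi * \<i>) * cycle_integral \<Gamma> (\<lambda>w. f w * \<phi> (resolv w T x))"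
  by (simp only: hfc_eq_vcycle_integral[OF T Om f adm] cfunctionalD(2)[OF \<phi>]
      cfunctional_vcycle_integral[OF T Om f admissible_cycleD(1)[OF adm] \<phi>])

lemma admissible_cycle_mono:
  assumes "admissible_cycle Om' K' \<Gamma>" "Om' \<subseteq> Om" "K \<subseteq> K'"
  shows "admissible_cycle Om K \<Gamma>"
  using assms by (auto simp: admissible_cycle_iff intro: is_cycle_mono)

text \<open>A cycle admissible in \<open>Om'\<close> is admissible in \<open>Om\<close>, so one
  integral computes both sides. This lets \<open>f\<close> be compared with functions such as
  \<open>1 / (\<mu> - f)\<close> that are defined on a smaller set.\<close>

lemma hfc_subdomain:
  fixes T :: "'a::complex_banach \<Rightarrow> 'a"
  assumes T: "bop T" and Om: "open Om" "open Om'" "sp T \<subseteq> Om'" "Om' \<subseteq> Om" and f: "f holomorphic_on Om"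
  shows "hfc Om' f T x = hfc Om f T x"
proof -
  obtain \<Gamma> where \<Gamma>: "admissible_cycle Om' (sp T) \<Gamma>"
    using polynomial_admissible_cycle[OF compact_sp[OF T] Om(2,3)] by metis
  have "admissible_cycle Om (sp T) \<Gamma>" using admissible_cycle_mono[OF \<Gamma> Om(4)] by simp
  then show ?thesis
    using hfc_eq_vcycle_integral[OF T Om(2) holomorphic_on_subset[OF f Om(4)] \<Gamma>]
      hfc_eq_vcycle_integral[OF T Om(1) f] by simp
qed

text \<open>If the integrand is not integrable the integral is 0 and the bound is trivial, so
  pointwise bounds on the resolvent are all that has to be supplied.\<close>

lemma norm_integral_le:
  fixes F :: "real \<Rightarrow> 'a::banach"
  assumes "B \<ge> 0" "\<And>t. t \<in> {0..1} \<Longrightarrow> norm (F t) \<le> B"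
  shows "norm (integral {0..1} F) \<le> B"
proof (cases "F integrable_on {0..1}")
  case True
  then show ?thesis
    using has_integral_bound_real[OF assms(1) finite.emptyI integrable_integral[OF True]] assms(2) by simp
next
  case False
  then show ?thesis using assms(1) by (simp add: not_integrable_integral)
qed

text \<open>The constant \<open>M\<close> is a sum of bounds for \<open>f (g t)\<close> times the
  derivative of \<open>g\<close>, one for each path \<open>g\<close> of the cycle, and is fixed
  before \<open>T\<close>, \<open>C\<close> and \<open>x\<close>. This order of quantifiers gives
  bounds uniform in \<open>h\<close>.\<close>

lemma vcycle_integral_bound:
  assumes \<Gamma>: "polynomial_paths \<Gamma>" and f: "continuous_on (cycle_image \<Gamma>) f"
  obtains M where "M \<ge> 0" "\<And>(T :: 'a::complex_banach \<Rightarrow> 'a) C x. C \<ge> 0 \<Longrightarrow>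
    (\<And>w. w \<in> cycle_image \<Gamma> \<Longrightarrow> norm (resolv w T x) \<le> C * norm x) \<Longrightarrow> norm (vcycle_integral \<Gamma> f T x) \<le> M * C * norm x"
proof -
  have "\<exists>m. g \<in> set \<Gamma> \<longrightarrow> m \<ge> 0 \<and> (\<forall>t\<in>{0..1}. norm (f (g t) * vector_derivative g (at t within {0..1})) \<le> m)" for g
  proof (cases "g \<in> set \<Gamma>")
    case True
    then have g: "polynomial_function g" using \<Gamma> by (simp add: polynomial_paths_def)
    have "continuous_on {0..1} (\<lambda>t. f (g t))"
      by (rule continuous_on_compose2[OF f continuous_on_polymonial_function[OF g]])
         (use True in \<open>auto simp: cycle_image_def path_image_def\<close>)
    then have "continuous_on {0..1} (\<lambda>t. f (g t) * vector_derivative g (at t))"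
      by (intro continuous_on_mult continuous_vector_derivative_polynomial g)
    then have "bounded ((\<lambda>t. f (g t) * vector_derivative g (at t)) ` {0..1})"
      by (intro compact_imp_bounded compact_continuous_image) auto
    then obtain m where m: "m > 0" "\<And>t. t \<in> {0..1} \<Longrightarrow> norm (f (g t) * vector_derivative g (at t)) \<le> m"
      by (auto simp: bounded_pos)
    have "vector_derivative g (at t within {0..1}) = vector_derivative g (at t)" if "t \<in> {0..1}" for t
    proof -
      obtain g' where "\<And>x. (g has_vector_derivative g' x) (at x)"
        using has_vector_derivative_polynomial_function[OF g] by metis
      then show ?thesis
        using that vector_derivative_at_within_ivl[of g "g' t" t 0 1] vector_derivative_at[of g "g' t" t] by simp
    qed
    then show ?thesis using m by (intro exI[of _ m]) auto
  qed simp
  then obtain m where m: "\<And>g. g \<in> set \<Gamma> \<Longrightarrow> m g \<ge> 0"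
      "\<And>g t. g \<in> set \<Gamma> \<Longrightarrow> t \<in> {0..1} \<Longrightarrow> norm (f (g t) * vector_derivative g (at t within {0..1})) \<le> m g"
    by metis
  have "norm (vcycle_integral G f T x) \<le> (\<Sum>g\<leftarrow>G. m g) * C * norm x"
    if G: "set G \<subseteq> set \<Gamma>" and C: "C \<ge> 0" "\<And>w. w \<in> cycle_image \<Gamma> \<Longrightarrow> norm (resolv w T x) \<le> C * norm x"
    for G C x and T :: "'a \<Rightarrow> 'a"
    using G
  proof (induction G)
    case Nil
    then show ?case by (simp add: vcycle_integral_def)
  next
    case (Cons g G)
    have g: "g \<in> set \<Gamma>" using Cons.prems by auto
    have "norm (integral {0..1} (\<lambda>t. cscale (f (g t) * vector_derivative g (at t within {0..1})) (resolv (g t) T x))) \<le> m g * (C * norm x)"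
    proof (rule norm_integral_le)
      show "0 \<le> m g * (C * norm x)" using m(1)[OF g] C(1) by simp
      fix t :: real assume t: "t \<in> {0..1}"
      have "norm (resolv (g t) T x) \<le> C * norm x"
        using C(2)[of "g t"] g t unfolding cycle_image_def path_image_def by blast
      then show "norm (cscale (f (g t) * vector_derivative g (at t within {0..1})) (resolv (g t) T x)) \<le> m g * (C * norm x)"
        unfolding norm_cscale by (intro mult_mono m g t) auto
    qed
    moreover have "norm (vcycle_integral G f T x) \<le> (\<Sum>g\<leftarrow>G. m g) * C * norm x"
      using Cons by simp
    ultimately show ?case
      using norm_triangle_ineq[of "integral {0..1} (\<lambda>t. cscale (f (g t) * vector_derivative g (at t within {0..1})) (resolv (g t) T x))" "vcycle_integral G f T x"]
      by (simp add: vcycle_integral_def algebra_simps)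
  qed
  moreover have "(\<Sum>g\<leftarrow>\<Gamma>. m g) \<ge> 0" using m(1) by (intro sum_list_nonneg) auto
  ultimately show ?thesis using that[of "\<Sum>g\<leftarrow>\<Gamma>. m g"] by blast
qed

lemma cycle_integrable_resolvent:
  assumes T: "bop T" and Om: "open Om" and f: "f holomorphic_on Om" and \<phi>: "cfunctional \<phi>"
    and \<Gamma>: "admissible_cycle Om (sp T) \<Gamma>"
  shows "cycle_integrable \<Gamma> (\<lambda>w. f w * \<phi> (resolv w T x))"
  by (rule cycle_integrable_holomorphic[OF admissible_cycleD(1)[OF \<Gamma>] _ holomorphic_times_resolvent[OF T f \<phi>]])
     (simp add: Om open_resolvent_set[OF T] Diff_eq open_Int)

lemma admissible_cycle_off_sp:
  "admissible_cycle Om (sp T) \<Gamma> \<Longrightarrow> w \<in> cycle_image \<Gamma> \<Longrightarrow> w \<notin> sp T"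
  using cycle_image_subset[OF admissible_cycleD(1)] by blast

lemma hfc_bop_bound:
  fixes T :: "'a::complex_banach \<Rightarrow> 'a"
  assumes T: "bop T" and Om: "open Om" and f: "f holomorphic_on Om" and adm: "admissible_cycle Om (sp T) \<Gamma>"
    and bound: "\<And>x. norm (vcycle_integral \<Gamma> f T x) \<le> B * norm x"
  shows "bop (hfc Om f T)" "norm (hfc Om f T x) \<le> B * norm x"
proof -
  note \<phi>_hfc = cfunctional_hfc[OF T Om f adm] and int = cycle_integrable_resolvent[OF T Om f _ adm]
  note R = resolvD(1)[OF admissible_cycle_off_sp[OF adm]]
  show nb: "norm (hfc Om f T x) \<le> B * norm x" for x
  proof -
    have "norm (hfc Om f T x) = 1 / (2 * pi) * norm (vcycle_integral \<Gamma> f T x)"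
      by (simp add: hfc_eq_vcycle_integral[OF T Om f adm] norm_cscale norm_divide norm_mult)
    \<comment> \<open>The factor \<open>1 / (2 * pi)\<close> is simply estimated by 1.\<close>
    also have "\<dots> \<le> 1 * norm (vcycle_integral \<Gamma> f T x)"
      using pi_gt3 by (intro mult_right_mono) auto
    finally show ?thesis using bound[of x] by simp
  qed
  show "bop (hfc Om f T)"
  proof (rule bopI[OF _ _ nb])
    show "hfc Om f T (x + y) = hfc Om f T x + hfc Om f T y" for x y
    proof (rule cfunctional_eqI)
      fix \<phi> :: "'a \<Rightarrow> complex" assume \<phi>: "cfunctional \<phi>"
      have "cycle_integral \<Gamma> (\<lambda>w. f w * \<phi> (resolv w T (x + y))) =
          cycle_integral \<Gamma> (\<lambda>w. f w * \<phi> (resolv w T x) + f w * \<phi> (resolv w T y))"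
        by (rule cycle_integral_cong) (simp add: bopD(3)[OF R] cfunctionalD[OF \<phi>] algebra_simps)
      then show "\<phi> (hfc Om f T (x + y)) = \<phi> (hfc Om f T x + hfc Om f T y)"
        by (simp add: \<phi>_hfc[OF \<phi>] cfunctionalD(3)[OF \<phi>] cycle_integral_add int[OF \<phi>] add_divide_distrib)
    qed
    show "hfc Om f T (cscale c x) = cscale c (hfc Om f T x)" for c x
    proof (rule cfunctional_eqI)
      fix \<phi> :: "'a \<Rightarrow> complex" assume \<phi>: "cfunctional \<phi>"
      have "cycle_integral \<Gamma> (\<lambda>w. f w * \<phi> (resolv w T (cscale c x))) = cycle_integral \<Gamma> (\<lambda>w. c * (f w * \<phi> (resolv w T x)))"
        by (rule cycle_integral_cong) (simp add: bopD(2)[OF R] cfunctionalD[OF \<phi>] algebra_simps)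
      then show "\<phi> (hfc Om f T (cscale c x)) = \<phi> (cscale c (hfc Om f T x))"
        by (simp add: \<phi>_hfc[OF \<phi>] cfunctionalD(2)[OF \<phi>] cycle_integral_lmul int[OF \<phi>])
    qed
  qed
qed

text \<open>On the circle of radius \<open>r\<close>, \<open>R(w) x = x / w + R(w) T x / w\<close>, and the last term contributes \<open>O(1 / r)\<close>.\<close>

lemma hfc_one:
  fixes T :: "'a::complex_banach \<Rightarrow> 'a"
  assumes T: "bop T" and Om: "open Om" "sp T \<subseteq> Om"
  shows "hfc Om (\<lambda>_. 1) T x = x"
proof (rule cfunctional_eqI)
  fix \<phi> :: "'a \<Rightarrow> complex" assume \<phi>: "cfunctional \<phi>"
  obtain M where M: "M \<ge> 0" "\<And>x. norm (T x) \<le> M * norm x" using bop_bound[OF T] by metis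
  obtain k where k: "k \<ge> 0" "\<And>x. norm (\<phi> x) \<le> norm x * k"
    using bounded_linear.nonneg_bounded[OF cfunctionalD(1)[OF \<phi>]] by metis
  \<comment> \<open>With \<open>UNIV\<close> as domain, circles of arbitrarily large radius around 0
    become admissible.\<close>
  have UN: "hfc Om (\<lambda>_. 1) T x = hfc UNIV (\<lambda>_. 1) T x"
    by (rule hfc_subdomain[OF T]) (use Om in auto)
  have est: "cmod (\<phi> (hfc UNIV (\<lambda>_. 1) T x) - \<phi> x) \<le> k * norm (T x) / (r - M)" if r: "r > M" for r
  proof -
    have r0: "r > 0" using r M(1) by simp
    have nsp: "w \<notin> sp T" "w \<noteq> 0" if "cmod w = r" for w
      using resolvent_outside_ball(1)[OF T M, of w] that r r0 by auto
    have spr: "cmod z < r" if "z \<in> sp T" for z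
      using resolvent_outside_ball(1)[OF T M, of z] that r by force
    have adm: "admissible_cycle UNIV (sp T) [circlepath 0 r]"
      using nsp spr r0 by (auto simp: admissible_cycle_def intro!: winding_number_circlepath)
    have "\<phi> (hfc UNIV (\<lambda>_. 1) T x) = 1 / (2 * of_real pi * \<i>) * contour_integral (circlepath 0 r) (\<lambda>w. \<phi> (resolv w T x))"
      using cfunctional_hfc[OF T open_UNIV holomorphic_on_const adm \<phi>] by (simp add: cycle_integral_def)
    also have "contour_integral (circlepath 0 r) (\<lambda>w. \<phi> (resolv w T x)) =
        contour_integral (circlepath 0 r) (\<lambda>w. \<phi> x * (1 / (w - 0)) + \<phi> (resolv w T (T x)) / w)"
    proof (rule contour_integral_eq)
      fix w assume "w \<in> path_image (circlepath 0 r)"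
      then have w: "cmod w = r" using r0 by simp
      have "\<phi> (resolv w T (T x)) = w * \<phi> (resolv w T x) - \<phi> x"
        by (simp add: resolv_T[OF T nsp(1)[OF w]] cfunctionalD[OF \<phi>])
      then show "\<phi> (resolv w T x) = \<phi> x * (1 / (w - 0)) + \<phi> (resolv w T (T x)) / w"
        using nsp(2)[OF w] by (simp add: field_simps)
    qed
    also have "\<dots> = \<phi> x * contour_integral (circlepath 0 r) (\<lambda>w. 1 / (w - 0)) +
        contour_integral (circlepath 0 r) (\<lambda>w. \<phi> (resolv w T (T x)) / w)"
    proof -
      have op: "open (- sp T - {0})" using open_resolvent_set[OF T] by auto
      have im: "path_image (circlepath 0 r) \<subseteq> - sp T - {0}" using nsp r0 by auto
      have i1: "(\<lambda>w. 1 / (w - 0)) contour_integrable_on circlepath 0 r"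
        by (rule contour_integrable_holomorphic_simple[OF _ op _ im]) (auto intro!: holomorphic_intros)
      have i2: "(\<lambda>w. \<phi> (resolv w T (T x)) / w) contour_integrable_on circlepath 0 r"
        by (rule contour_integrable_holomorphic_simple[OF _ op _ im])
           (auto intro!: holomorphic_intros holomorphic_on_subset[OF holomorphic_resolvent[OF T \<phi>]])
      show ?thesis
        by (simp only: contour_integral_add[OF contour_integrable_lmul[OF i1] i2] contour_integral_lmul[OF i1])
    qed
    also have "contour_integral (circlepath 0 r) (\<lambda>w. 1 / (w - 0)) = 2 * of_real pi * \<i>"
      by (rule contour_integral_circlepath[OF r0])
    finally have eq: "\<phi> (hfc UNIV (\<lambda>_. 1) T x) - \<phi> x =
        1 / (2 * of_real pi * \<i>) * contour_integral (circlepath 0 r) (\<lambda>w. \<phi> (resolv w T (T x)) / w)"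
      by (simp add: field_simps)
    have "cmod (contour_integral (circlepath 0 r) (\<lambda>w. \<phi> (resolv w T (T x)) / w)) \<le> k * norm (T x) / (r - M) / r * (2 * pi * r)"
    proof (rule has_contour_integral_bound_circlepath[OF has_contour_integral_integral])
      show "(\<lambda>w. \<phi> (resolv w T (T x)) / w) contour_integrable_on circlepath 0 r"
        by (rule contour_integrable_holomorphic_simple[of _ "- sp T - {0}"])
           (use nsp r0 open_resolvent_set[OF T] in \<open>auto intro!: holomorphic_intros holomorphic_on_subset[OF holomorphic_resolvent[OF T \<phi>]]\<close>)
      fix w assume w: "cmod (w - 0) = r"
      have "cmod (\<phi> (resolv w T (T x))) \<le> k * norm (resolv w T (T x))" using k(2) by (simp add: mult.commute)
      also have "\<dots> \<le> k * (1 / (r - M) * norm (T x))"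
        using resolvent_outside_ball(2)[OF T M, of w "T x"] w r k(1) by (intro mult_left_mono) auto
      finally have "cmod (\<phi> (resolv w T (T x))) / r \<le> k * (1 / (r - M) * norm (T x)) / r"
        using r0 by (intro divide_right_mono) auto
      then show "cmod (\<phi> (resolv w T (T x)) / w) \<le> k * norm (T x) / (r - M) / r"
        using w by (simp add: norm_divide)
    qed (use r r0 k in auto)
    also have "k * norm (T x) / (r - M) / r * (2 * pi * r) = 2 * pi * (k * norm (T x) / (r - M))"
      using r0 by simp
    finally show ?thesis
      unfolding eq by (simp add: norm_mult norm_divide pos_divide_le_eq mult.commute)
  qed
  have "filterlim (\<lambda>r. - M + r) at_top at_top"
    by (rule filterlim_tendsto_add_at_top[OF tendsto_const filterlim_ident])
  then have "filterlim (\<lambda>r. r - M) at_top at_top" by simp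
  then have "((\<lambda>r. k * norm (T x) / (r - M)) \<longlongrightarrow> 0) at_top"
    by (intro tendsto_divide_0[OF tendsto_const] filterlim_at_top_imp_at_infinity)
  then have "cmod (\<phi> (hfc UNIV (\<lambda>_. 1) T x) - \<phi> x) \<le> 0"
  proof (rule tendsto_lowerbound)
    show "\<forall>\<^sub>F r in at_top. cmod (\<phi> (hfc UNIV (\<lambda>_. 1) T x) - \<phi> x) \<le> k * norm (T x) / (r - M)"
      by (rule eventually_mono[OF eventually_gt_at_top[of M]]) (rule est)
  qed simp
  then show "\<phi> (hfc Om (\<lambda>_. 1) T x) = \<phi> x" by (simp add: UN)
qed

section \<open>Algebraic rules of the calculus for one operator\<close>

context
  fixes T :: "'a::complex_banach \<Rightarrow> 'a" and Om :: "complex set"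
  assumes T: "bop T" and Om: "open Om" and spT: "sp T \<subseteq> Om"
begin

lemma hfc_admissible:
  obtains \<Gamma> where "polynomial_paths \<Gamma>" "admissible_cycle Om (sp T) \<Gamma>"
  using polynomial_admissible_cycle[OF compact_sp[OF T] Om spT] by metis

lemma hfc_cong:
  assumes f: "f holomorphic_on Om" and eq: "\<And>w. w \<in> Om \<Longrightarrow> f w = g w"
  shows "hfc Om f T x = hfc Om g T x"
proof (rule cfunctional_eqI)
  fix \<phi> :: "'a \<Rightarrow> complex" assume \<phi>: "cfunctional \<phi>"
  obtain \<Gamma> where \<Gamma>: "admissible_cycle Om (sp T) \<Gamma>" using hfc_admissible by metis
  have g: "g holomorphic_on Om" using f eq by (rule holomorphic_transform)
  have "cycle_integral \<Gamma> (\<lambda>w. f w * \<phi> (resolv w T x)) = cycle_integral \<Gamma> (\<lambda>w. g w * \<phi> (resolv w T x))"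
    by (rule cycle_integral_cong) (use cycle_image_subset[OF admissible_cycleD(4)[OF \<Gamma>]] eq in auto)
  then show "\<phi> (hfc Om f T x) = \<phi> (hfc Om g T x)"
    by (simp only: cfunctional_hfc[OF T Om f \<Gamma> \<phi>] cfunctional_hfc[OF T Om g \<Gamma> \<phi>])
qed

lemma hfc_const_minus:
  assumes f: "f holomorphic_on Om"
  shows "hfc Om (\<lambda>w. \<mu> - f w) T x = cscale \<mu> x - hfc Om f T x"
proof (rule cfunctional_eqI)
  fix \<phi> :: "'a \<Rightarrow> complex" assume \<phi>: "cfunctional \<phi>"
  obtain \<Gamma> where \<Gamma>: "admissible_cycle Om (sp T) \<Gamma>" using hfc_admissible by metis
  have i1: "cycle_integrable \<Gamma> (\<lambda>w. 1 * \<phi> (resolv w T x))"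
    by (rule cycle_integrable_resolvent[OF T Om holomorphic_on_const \<phi> \<Gamma>])
  have i\<mu>: "cycle_integrable \<Gamma> (\<lambda>w. \<mu> * \<phi> (resolv w T x))"
    by (rule cycle_integrable_resolvent[OF T Om holomorphic_on_const \<phi> \<Gamma>])
  note i2 = cycle_integrable_resolvent[OF T Om f \<phi> \<Gamma>]
  have "\<phi> (hfc Om (\<lambda>w. \<mu> - f w) T x) =
      1 / (2 * of_real pi * \<i>) * cycle_integral \<Gamma> (\<lambda>w. (\<mu> - f w) * \<phi> (resolv w T x))"
    by (rule cfunctional_hfc[OF T Om _ \<Gamma> \<phi>]) (intro holomorphic_intros f)
  also have "cycle_integral \<Gamma> (\<lambda>w. (\<mu> - f w) * \<phi> (resolv w T x)) =
      \<mu> * cycle_integral \<Gamma> (\<lambda>w. 1 * \<phi> (resolv w T x)) - cycle_integral \<Gamma> (\<lambda>w. f w * \<phi> (resolv w T x))"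
    using cycle_integral_diff[OF i\<mu> i2] cycle_integral_lmul[OF i1, of \<mu>] by (simp add: left_diff_distrib)
  also have "1 / (2 * of_real pi * \<i>) * \<dots> = \<mu> * \<phi> (hfc Om (\<lambda>_. 1) T x) - \<phi> (hfc Om f T x)"
    by (simp only: cfunctional_hfc[OF T Om holomorphic_on_const \<Gamma> \<phi>] cfunctional_hfc[OF T Om f \<Gamma> \<phi>] algebra_simps)
  finally show "\<phi> (hfc Om (\<lambda>w. \<mu> - f w) T x) = \<phi> (cscale \<mu> x - hfc Om f T x)"
    by (simp add: hfc_one[OF T Om spT] cfunctionalD[OF \<phi>])
qed

text \<open>Both \<open>T (resolv w T x)\<close> and \<open>resolv w T (T x)\<close> equal
  \<open>cscale w (resolv w T x) - x\<close>, so the two integrands coincide.\<close>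

lemma hfc_commute:
  assumes f: "f holomorphic_on Om"
  shows "hfc Om f T (T x) = T (hfc Om f T x)"
proof (rule cfunctional_eqI)
  fix \<phi> :: "'a \<Rightarrow> complex" assume \<phi>: "cfunctional \<phi>"
  obtain \<Gamma> where \<Gamma>: "admissible_cycle Om (sp T) \<Gamma>" using hfc_admissible by metis
  have "cycle_integral \<Gamma> (\<lambda>w. f w * \<phi> (resolv w T (T x))) = cycle_integral \<Gamma> (\<lambda>w. f w * \<phi> (T (resolv w T x)))"
    by (rule cycle_integral_cong)
       (simp add: resolv_T[OF T admissible_cycle_off_sp[OF \<Gamma>]] T_resolv[OF admissible_cycle_off_sp[OF \<Gamma>]])
  then show "\<phi> (hfc Om f T (T x)) = \<phi> (T (hfc Om f T x))"
    using cfunctional_hfc[OF T Om f \<Gamma> \<phi>] cfunctional_hfc[OF T Om f \<Gamma> cfunctional_bop[OF \<phi> T]] by simp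
qed

text \<open>From \<open>T (R x) = w R x - x\<close> one gets
  \<open>(l - w) R x = l R x - T (R x) - x\<close>, where \<open>R\<close> is the resolvent at
  \<open>w\<close>. The last term contributes the integral of \<open>k\<close> times a constant,
  which vanishes by Cauchy's theorem.\<close>

lemma hfc_linear_factor:
  assumes k: "k holomorphic_on Om"
  shows "hfc Om (\<lambda>w. (l - w) * k w) T x = cscale l (hfc Om k T x) - T (hfc Om k T x)"
proof (rule cfunctional_eqI)
  fix \<phi> :: "'a \<Rightarrow> complex" assume \<phi>: "cfunctional \<phi>"
  obtain \<Gamma> where \<Gamma>: "admissible_cycle Om (sp T) \<Gamma>" using hfc_admissible by metis
  have lk: "(\<lambda>w. (l - w) * k w) holomorphic_on Om" by (intro holomorphic_intros k)
  note i1 = cycle_integrable_resolvent[OF T Om lk \<phi> \<Gamma>] and i2 = cycle_integrable_resolvent[OF T Om k \<phi> \<Gamma>]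
    and i3 = cycle_integrable_holomorphic[OF admissible_cycleD(4)[OF \<Gamma>] Om k]
    and i4 = cycle_integrable_resolvent[OF T Om k cfunctional_bop[OF \<phi> T] \<Gamma>]
  have i5: "cycle_integrable \<Gamma> (\<lambda>w. \<phi> x * k w)"
    by (rule cycle_integrable_holomorphic[OF admissible_cycleD(4)[OF \<Gamma>] Om]) (intro holomorphic_intros k)
  have i6: "cycle_integrable \<Gamma> (\<lambda>w. l * (k w * \<phi> (resolv w T x)))"
    using i2 by (rule cycle_integrable_lmul)
  have "cycle_integral \<Gamma> k = 0"
    by (rule Cauchy_theorem_cycle[OF Om admissible_cycleD(4)[OF \<Gamma>] admissible_cycleD(3)[OF \<Gamma>] k])
  then have "cycle_integral \<Gamma> (\<lambda>w. \<phi> x * k w) = 0" by (simp add: cycle_integral_lmul[OF i3])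
  then have "cycle_integral \<Gamma> (\<lambda>w. (l - w) * k w * \<phi> (resolv w T x)) =
      cycle_integral \<Gamma> (\<lambda>w. (l - w) * k w * \<phi> (resolv w T x) + \<phi> x * k w)"
    by (simp add: cycle_integral_add[OF i1 i5])
  also have "\<dots> = cycle_integral \<Gamma> (\<lambda>w. l * (k w * \<phi> (resolv w T x)) - k w * \<phi> (T (resolv w T x)))"
    by (rule cycle_integral_cong)
       (simp add: T_resolv[OF admissible_cycle_off_sp[OF \<Gamma>]] cfunctionalD[OF \<phi>] algebra_simps)
  also have "\<dots> = l * cycle_integral \<Gamma> (\<lambda>w. k w * \<phi> (resolv w T x)) - cycle_integral \<Gamma> (\<lambda>w. k w * \<phi> (T (resolv w T x)))"
    by (simp add: cycle_integral_diff[OF i6 i4] cycle_integral_lmul[OF i2])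
  finally show "\<phi> (hfc Om (\<lambda>w. (l - w) * k w) T x) = \<phi> (cscale l (hfc Om k T x) - T (hfc Om k T x))"
    by (simp add: cfunctionalD[OF \<phi>] cfunctional_hfc[OF T Om lk \<Gamma> \<phi>] cfunctional_hfc[OF T Om k \<Gamma> \<phi>]
        cfunctional_hfc[OF T Om k \<Gamma> cfunctional_bop[OF \<phi> T]] diff_divide_distrib)
qed

text \<open>Take the cycle of the second factor inside the cycle of the first one and use the resolvent identity.\<close>

lemma hfc_mult:
  assumes f: "f holomorphic_on Om" and g: "g holomorphic_on Om"
  shows "hfc Om f T (hfc Om g T x) = hfc Om (\<lambda>w. f w * g w) T x"
proof (rule cfunctional_eqI)
  fix \<phi> :: "'a \<Rightarrow> complex" assume \<phi>: "cfunctional \<phi>"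
  define c :: complex where "c = 1 / (2 * of_real pi * \<i>)"
  have c: "c * (2 * of_real pi * \<i>) = 1" by (simp add: c_def)
  obtain \<Gamma> where \<Gamma>: "polynomial_paths \<Gamma>" "admissible_cycle Om (sp T) \<Gamma>" using hfc_admissible by metis
  note \<Gamma>c = admissible_cycleD[OF \<Gamma>(2)]
  \<comment> \<open>The inner cycle \<open>\<Delta>\<close> runs in \<open>U\<close>, so
    \<open>\<Gamma>\<close> has index 1 around each of its points, while \<open>\<Delta>\<close> has
    index 0 around the points of \<open>\<Gamma>\<close>, which lie outside
    \<open>U\<close>.\<close>
  define U where "U = Om \<inter> {z. z \<notin> cycle_image \<Gamma> \<and> cycle_index \<Gamma> z = 1}"
  have U: "open U" unfolding U_def by (intro open_Int Om open_cycle_index_eq[OF \<Gamma>c(1)])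
  have spU: "sp T \<subseteq> U" using spT \<Gamma>c(2) cycle_image_subset[OF \<Gamma>c(1)] by (auto simp: U_def)
  obtain \<Delta> where \<Delta>: "polynomial_paths \<Delta>" "admissible_cycle U (sp T) \<Delta>"
    using polynomial_admissible_cycle[OF compact_sp[OF T] U spU] by metis
  note \<Delta>c = admissible_cycleD[OF \<Delta>(2)]
  have UOm: "U \<subseteq> Om" by (auto simp: U_def)
  have \<Delta>Om: "admissible_cycle Om (sp T) \<Delta>" using admissible_cycle_mono[OF \<Delta>(2) UOm] by simp
  have im\<Delta>: "cycle_image \<Delta> \<subseteq> U - sp T" by (rule cycle_image_subset[OF \<Delta>c(1)])
  have im\<Gamma>: "cycle_image \<Gamma> \<subseteq> Om - sp T" by (rule cycle_image_subset[OF \<Gamma>c(1)])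
  have disj: "w \<noteq> z" if "w \<in> cycle_image \<Gamma>" "z \<in> cycle_image \<Delta>" for w z
    using that im\<Delta> by (auto simp: U_def)
  have gU: "g holomorphic_on U" using g UOm by (rule holomorphic_on_subset)
  have \<phi>g: "\<psi> (hfc Om g T x) = c * cycle_integral \<Delta> (\<lambda>z. g z * \<psi> (resolv z T x))" if "cfunctional \<psi>" for \<psi>
    unfolding c_def by (rule cfunctional_hfc[OF T Om g \<Delta>Om that])
  have inner: "\<phi> (resolv w T (hfc Om g T x)) = c * cycle_integral \<Delta> (\<lambda>z. g z * \<phi> (resolv z T x) / (w - z))"
    if w: "w \<in> cycle_image \<Gamma>" for w
  proof -
    have wsp: "w \<notin> sp T" and wU: "w \<notin> U" using w im\<Gamma> by (auto simp: U_def)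
    have h: "(\<lambda>z. g z / (w - z)) holomorphic_on U" using wU by (auto intro!: holomorphic_intros gU)
    have i1: "cycle_integrable \<Delta> (\<lambda>z. g z / (w - z) * \<phi> (resolv z T x))"
      by (rule cycle_integrable_resolvent[OF T U h \<phi> \<Delta>(2)])
    have i2: "cycle_integrable \<Delta> (\<lambda>z. g z / (w - z))"
      by (rule cycle_integrable_holomorphic[OF \<Delta>c(4) U h])
    have i3: "cycle_integrable \<Delta> (\<lambda>z. \<phi> (resolv w T x) * (g z / (w - z)))"
      using i2 by (rule cycle_integrable_lmul)
    have "cycle_integral \<Delta> (\<lambda>z. g z * \<phi> (resolv w T (resolv z T x))) =
        cycle_integral \<Delta> (\<lambda>z. g z / (w - z) * \<phi> (resolv z T x) - \<phi> (resolv w T x) * (g z / (w - z)))"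
    proof (rule cycle_integral_cong)
      fix z assume z: "z \<in> cycle_image \<Delta>"
      then have zsp: "z \<notin> sp T" using im\<Delta> by auto
      have "\<phi> (resolv w T x) - \<phi> (resolv z T x) = (z - w) * \<phi> (resolv w T (resolv z T x))"
        using resolvent_identity[OF T wsp zsp, of x] by (simp add: cfunctionalD[OF \<phi>] flip: cfunctionalD(4)[OF \<phi>])
      then have eq: "\<phi> (resolv w T (resolv z T x)) = (\<phi> (resolv z T x) - \<phi> (resolv w T x)) / (w - z)"
        using disj[OF w z] by (simp add: field_simps)
      show "g z * \<phi> (resolv w T (resolv z T x)) = g z / (w - z) * \<phi> (resolv z T x) - \<phi> (resolv w T x) * (g z / (w - z))"
        unfolding eq by (simp add: diff_divide_distrib algebra_simps)
    qed
    also have "\<dots> = cycle_integral \<Delta> (\<lambda>z. g z / (w - z) * \<phi> (resolv z T x)) - \<phi> (resolv w T x) * cycle_integral \<Delta> (\<lambda>z. g z / (w - z))"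
      by (simp only: cycle_integral_diff[OF i1 i3] cycle_integral_lmul[OF i2])
    \<comment> \<open>The pole \<open>w\<close> lies on \<open>\<Gamma>\<close>, hence outside
      \<open>U\<close>, so this integrand is holomorphic on \<open>U\<close> and only one term of
      the resolvent identity survives.\<close>
    also have "cycle_integral \<Delta> (\<lambda>z. g z / (w - z)) = 0"
      by (rule Cauchy_theorem_cycle[OF U \<Delta>c(4) \<Delta>c(3) h])
    finally show ?thesis
      using \<phi>g[OF cfunctional_bop[OF \<phi> resolvD(1)[OF wsp]]] by (simp add: mult.commute)
  qed
  have contf: "continuous_on (cycle_image \<Gamma>) f"
    using holomorphic_on_imp_continuous_on[OF f] by (rule continuous_on_subset) (use im\<Gamma> in auto)
  have contg: "continuous_on (cycle_image \<Delta>) (\<lambda>z. g z * \<phi> (resolv z T x))"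
    using holomorphic_on_imp_continuous_on[OF holomorphic_times_resolvent[OF T gU \<phi>]] im\<Delta> by (rule continuous_on_subset)
  have cont: "continuous_on (cycle_image \<Gamma> \<times> cycle_image \<Delta>) (\<lambda>(w, z). f w * (g z * \<phi> (resolv z T x) / (w - z)))"
  proof -
    have c1: "continuous_on (cycle_image \<Gamma> \<times> cycle_image \<Delta>) (\<lambda>p. f (fst p))"
      by (rule continuous_on_compose2[OF contf, of _ fst]) (auto intro: continuous_on_fst continuous_on_id)
    have c2: "continuous_on (cycle_image \<Gamma> \<times> cycle_image \<Delta>) (\<lambda>p. g (snd p) * \<phi> (resolv (snd p) T x))"
      by (rule continuous_on_compose2[OF contg, of _ snd]) (auto intro: continuous_on_snd continuous_on_id)
    show ?thesis
      unfolding case_prod_unfold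
      by (intro continuous_on_mult[OF c1 continuous_on_divide[OF c2]] continuous_on_diff continuous_on_fst continuous_on_snd continuous_on_id)
         (use disj in auto)
  qed
  have mulc: "cycle_integrable \<Gamma> (\<lambda>w. cycle_integral \<Delta> (\<lambda>z. f w * (g z * \<phi> (resolv z T x) / (w - z))))"
    by (rule cycle_integrable_polynomial[OF \<Gamma>(1) continuous_on_cycle_integral_param[OF \<Delta>(1) cont]])
  have "\<phi> (hfc Om f T (hfc Om g T x)) = c * cycle_integral \<Gamma> (\<lambda>w. f w * \<phi> (resolv w T (hfc Om g T x)))"
    unfolding c_def by (rule cfunctional_hfc[OF T Om f \<Gamma>(2) \<phi>])
  also have "cycle_integral \<Gamma> (\<lambda>w. f w * \<phi> (resolv w T (hfc Om g T x))) =
      cycle_integral \<Gamma> (\<lambda>w. c * cycle_integral \<Delta> (\<lambda>z. f w * (g z * \<phi> (resolv z T x) / (w - z))))"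
  proof (rule cycle_integral_cong)
    fix w assume w: "w \<in> cycle_image \<Gamma>"
    have wU: "w \<notin> U" using w by (auto simp: U_def)
    have "cycle_integrable \<Delta> (\<lambda>z. g z / (w - z) * \<phi> (resolv z T x))"
      by (rule cycle_integrable_resolvent[OF T U _ \<phi> \<Delta>(2)]) (use wU in \<open>auto intro!: holomorphic_intros gU\<close>)
    then have "cycle_integrable \<Delta> (\<lambda>z. g z * \<phi> (resolv z T x) / (w - z))" by simp
    from cycle_integral_lmul[OF this, of "f w"]
    show "f w * \<phi> (resolv w T (hfc Om g T x)) = c * cycle_integral \<Delta> (\<lambda>z. f w * (g z * \<phi> (resolv z T x) / (w - z)))"
      by (simp add: inner[OF w] del: times_divide_eq_right)
  qed
  also have "\<dots> = c * cycle_integral \<Gamma> (\<lambda>w. cycle_integral \<Delta> (\<lambda>z. f w * (g z * \<phi> (resolv z T x) / (w - z))))"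
    by (rule cycle_integral_lmul[OF mulc])
  also have "cycle_integral \<Gamma> (\<lambda>w. cycle_integral \<Delta> (\<lambda>z. f w * (g z * \<phi> (resolv z T x) / (w - z)))) =
      cycle_integral \<Delta> (\<lambda>z. cycle_integral \<Gamma> (\<lambda>w. f w * (g z * \<phi> (resolv z T x) / (w - z))))"
    by (rule cycle_integral_swap[OF \<Gamma>(1) \<Delta>(1) cont])
  also have "\<dots> = cycle_integral \<Delta> (\<lambda>z. (2 * of_real pi * \<i>) * (f z * g z * \<phi> (resolv z T x)))"
  proof (rule cycle_integral_cong)
    fix z assume z: "z \<in> cycle_image \<Delta>"
    then have zU: "z \<in> Om" "z \<notin> cycle_image \<Gamma>" "cycle_index \<Gamma> z = 1" using im\<Delta> by (auto simp: U_def)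
    have "is_cycle (Om - {z}) \<Gamma>"
      by (rule is_cycle_cycle_image[OF \<Gamma>c(4)]) (use im\<Gamma> zU in auto)
    then have "cycle_integrable \<Gamma> (\<lambda>w. f w / (w - z))"
      by (rule cycle_integrable_holomorphic) (use Om in \<open>auto intro!: holomorphic_intros holomorphic_on_subset[OF f]\<close>)
    from cycle_integral_lmul[OF this, of "g z * \<phi> (resolv z T x)"]
    have "cycle_integral \<Gamma> (\<lambda>w. f w * (g z * \<phi> (resolv z T x) / (w - z))) =
        g z * \<phi> (resolv z T x) * cycle_integral \<Gamma> (\<lambda>w. f w / (w - z))"
      by (simp add: mult_ac)
    also have "cycle_integral \<Gamma> (\<lambda>w. f w / (w - z)) = 2 * of_real pi * \<i> * f z"
      using cycle_integral_formula[OF Om \<Gamma>c(4) \<Gamma>c(3) f zU(1,2)] zU(3) by simp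
    finally show "cycle_integral \<Gamma> (\<lambda>w. f w * (g z * \<phi> (resolv z T x) / (w - z))) =
        (2 * of_real pi * \<i>) * (f z * g z * \<phi> (resolv z T x))"
      by (simp add: mult_ac)
  qed
  also have "\<dots> = (2 * of_real pi * \<i>) * cycle_integral \<Delta> (\<lambda>z. f z * g z * \<phi> (resolv z T x))"
    by (rule cycle_integral_lmul, rule cycle_integrable_resolvent[OF T Om _ \<phi> \<Delta>Om]) (intro holomorphic_intros f g)
  finally have "\<phi> (hfc Om f T (hfc Om g T x)) = c * cycle_integral \<Delta> (\<lambda>z. f z * g z * \<phi> (resolv z T x))"
    using c by (metis (no_types, lifting) mult.assoc mult_1)
  also have "\<dots> = \<phi> (hfc Om (\<lambda>w. f w * g w) T x)"
    unfolding c_def by (rule cfunctional_hfc[OF T Om _ \<Delta>Om \<phi>, symmetric]) (intro holomorphic_intros f g)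
  finally show "\<phi> (hfc Om f T (hfc Om g T x)) = \<phi> (hfc Om (\<lambda>w. f w * g w) T x)" .
qed

end

section \<open>Spectra of families\<close>

lemma bounded_familyD:
  assumes "bounded_family T"
  obtains M where "M \<ge> 0" "\<And>h x. h \<in> {0<..1} \<Longrightarrow> norm (T h x) \<le> M * norm x"
proof -
  obtain M where M: "\<And>h. h \<in> {0<..1} \<Longrightarrow> onorm (T h) \<le> M" and T: "\<And>h. h \<in> {0<..1} \<Longrightarrow> bop (T h)"
    using assms unfolding bounded_family_def by blast
  have "norm (T h x) \<le> max M 0 * norm x" if h: "h \<in> {0<..1}" for h x
  proof -
    have "norm (T h x) \<le> onorm (T h) * norm x" by (rule onorm[OF bopD(1)[OF T[OF h]]])
    also have "\<dots> \<le> max M 0 * norm x" using M[OF h] by (intro mult_right_mono) auto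
    finally show ?thesis .
  qed
  then show ?thesis using that[of "max M 0"] by simp
qed

text \<open>Exact resolvents for all small \<open>h\<close>, with one threshold \<open>h0\<close>
  and one bound \<open>C\<close> for the whole set \<open>A\<close>: the working form of the
  definition by approximate resolvents.\<close>

definition uniform_resolvent :: "(real \<Rightarrow> 'a::complex_banach \<Rightarrow> 'a) \<Rightarrow> complex set \<Rightarrow> bool" where
  "uniform_resolvent S A \<longleftrightarrow> (\<exists>h0>0. \<exists>C\<ge>0. \<forall>h. 0 < h \<longrightarrow> h < h0 \<longrightarrow>
      (\<forall>l\<in>A. l \<notin> sp (S h) \<and> (\<forall>x. norm (resolv l (S h) x) \<le> C * norm x)))"

lemma uniform_resolventI:
  assumes "h0 > 0" "C \<ge> 0"
    "\<And>h l. 0 < h \<Longrightarrow> h < h0 \<Longrightarrow> l \<in> A \<Longrightarrow> l \<notin> sp (S h) \<and> (\<forall>x. norm (resolv l (S h) x) \<le> C * norm x)"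
  shows "uniform_resolvent S A"
  unfolding uniform_resolvent_def using assms by (intro exI[of _ h0] exI[of _ C] conjI) auto

lemma uniform_resolventE:
  assumes "uniform_resolvent S A"
  obtains h0 C where "h0 > 0" "C \<ge> 0" "\<And>h l. 0 < h \<Longrightarrow> h < h0 \<Longrightarrow> l \<in> A \<Longrightarrow> l \<notin> sp (S h)"
    "\<And>h l x. 0 < h \<Longrightarrow> h < h0 \<Longrightarrow> l \<in> A \<Longrightarrow> norm (resolv l (S h) x) \<le> C * norm x"
proof -
  obtain h0 C where "h0 > 0" "C \<ge> 0" "\<forall>h. 0 < h \<longrightarrow> h < h0 \<longrightarrow>
      (\<forall>l\<in>A. l \<notin> sp (S h) \<and> (\<forall>x. norm (resolv l (S h) x) \<le> C * norm x))"
    using assms unfolding uniform_resolvent_def by auto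
  then show ?thesis by (intro that[of h0 C]) auto
qed

lemma uniform_resolvent_mono: "uniform_resolvent S A \<Longrightarrow> B \<subseteq> A \<Longrightarrow> uniform_resolvent S B"
  unfolding uniform_resolvent_def by blast

lemma uniform_resolvent_Un:
  assumes "uniform_resolvent S A" "uniform_resolvent S B" shows "uniform_resolvent S (A \<union> B)"
proof -
  obtain h1 C1 where 1: "h1 > 0" "C1 \<ge> 0" "\<And>h l. 0 < h \<Longrightarrow> h < h1 \<Longrightarrow> l \<in> A \<Longrightarrow> l \<notin> sp (S h)"
      "\<And>h l x. 0 < h \<Longrightarrow> h < h1 \<Longrightarrow> l \<in> A \<Longrightarrow> norm (resolv l (S h) x) \<le> C1 * norm x"
    using uniform_resolventE[OF assms(1)] by blast
  obtain h2 C2 where 2: "h2 > 0" "C2 \<ge> 0" "\<And>h l. 0 < h \<Longrightarrow> h < h2 \<Longrightarrow> l \<in> B \<Longrightarrow> l \<notin> sp (S h)"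
      "\<And>h l x. 0 < h \<Longrightarrow> h < h2 \<Longrightarrow> l \<in> B \<Longrightarrow> norm (resolv l (S h) x) \<le> C2 * norm x"
    using uniform_resolventE[OF assms(2)] by blast
  have le: "C1 * norm x \<le> max C1 C2 * norm x" "C2 * norm x \<le> max C1 C2 * norm x" for x :: 'a
    by (auto intro: mult_right_mono)
  show ?thesis
  proof (rule uniform_resolventI[of "min h1 h2" "max C1 C2"])
    fix h l assume h: "0 < h" "h < min h1 h2" and l: "l \<in> A \<union> B"
    show "l \<notin> sp (S h) \<and> (\<forall>x. norm (resolv l (S h) x) \<le> max C1 C2 * norm x)"
    proof (cases "l \<in> A")
      case True
      then show ?thesis using 1(3)[of h l] 1(4)[of h l] le(1) h by (auto intro: order_trans)
    next
      case False
      then show ?thesis using 2(3)[of h l] 2(4)[of h l] le(2) h l by (auto intro: order_trans)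
    qed
  qed (use 1 2 in auto)
qed

text \<open>Once both errors have norm below \<open>1 / 2\<close>, the approximate resolvents can be
  corrected to exact ones at the cost of doubling the bound. Boundedness of \<open>S h\<close> is
  asked for small \<open>h\<close> only, since that is what is known of
  \<open>hfc Om f (T h)\<close>.\<close>

lemma fam_resolvent_set_iff:
  fixes S :: "real \<Rightarrow> 'a::complex_banach \<Rightarrow> 'a"
  assumes h1: "h1 > 0" and S: "\<And>h. 0 < h \<Longrightarrow> h < h1 \<Longrightarrow> bop (S h)"
  shows "l \<in> fam_resolvent_set S \<longleftrightarrow> uniform_resolvent S {l}"
proof
  assume "l \<in> fam_resolvent_set S"
  then obtain R where R: "bounded_family R"
      "((\<lambda>h. onorm (\<lambda>x. cscale l (R h x) - S h (R h x) - x)) \<longlongrightarrow> 0) (at_right 0)"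
      "((\<lambda>h. onorm (\<lambda>x. R h (cscale l x - S h x) - x)) \<longlongrightarrow> 0) (at_right 0)"
    by (auto simp: fam_resolvent_set_def)
  obtain M where M: "M \<ge> 0" "\<And>h x. h \<in> {0<..1} \<Longrightarrow> norm (R h x) \<le> M * norm x"
    using bounded_familyD[OF R(1)] by metis
  have "\<forall>\<^sub>F h in at_right 0. onorm (\<lambda>x. cscale l (R h x) - S h (R h x) - x) < 1 / 2"
    using R(2) by (rule order_tendstoD) simp
  then obtain b1 where b1: "b1 > 0" "\<And>h. 0 < h \<Longrightarrow> h < b1 \<Longrightarrow> onorm (\<lambda>x. cscale l (R h x) - S h (R h x) - x) < 1 / 2"
    by (auto simp: eventually_at_right_field)
  have "\<forall>\<^sub>F h in at_right 0. onorm (\<lambda>x. R h (cscale l x - S h x) - x) < 1 / 2"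
    using R(3) by (rule order_tendstoD) simp
  then obtain b2 where b2: "b2 > 0" "\<And>h. 0 < h \<Longrightarrow> h < b2 \<Longrightarrow> onorm (\<lambda>x. R h (cscale l x - S h x) - x) < 1 / 2"
    by (auto simp: eventually_at_right_field)
  show "uniform_resolvent S {l}"
  proof (rule uniform_resolventI[of "min (min b1 b2) (min 1 h1)" "M / (1 - 1 / 2)"])
    fix h l' assume h: "0 < h" "h < min (min b1 b2) (min 1 h1)" and l': "l' \<in> {l}"
    have bS: "bop (S h)" and bR: "bop (R h)" using S[of h] R(1) h by (auto simp: bounded_family_def)
    have half: "norm (E x) \<le> 1 / 2 * norm x" if "bop E" "onorm E < 1 / 2" for E :: "'a \<Rightarrow> 'a" and x
    proof -
      have "norm (E x) \<le> onorm E * norm x" by (rule onorm[OF bopD(1)[OF that(1)]])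
      also have "\<dots> \<le> 1 / 2 * norm x" using that(2) by (intro mult_right_mono) auto
      finally show ?thesis .
    qed
    obtain Q where Q: "is_resolvent l (S h) Q" "\<And>x. norm (Q x) \<le> M / (1 - 1 / 2) * norm x"
    proof (rule resolvent_of_approximate_inverse[OF bS bR, of "1 / 2" M l])
      show "norm (R h (cscale l x - S h x) - x) \<le> 1 / 2 * norm x" for x
        by (rule half[of "\<lambda>x. R h (cscale l x - S h x) - x"])
           (use b2(2) h bS bR in \<open>auto intro!: bop_diff bop_id bop_compose[OF bR] bop_shift\<close>)
      show "norm (cscale l (R h x) - S h (R h x) - x) \<le> 1 / 2 * norm x" for x
        by (rule half[of "\<lambda>x. cscale l (R h x) - S h (R h x) - x"])
           (use b1(2) h bS bR in \<open>auto intro!: bop_diff bop_id bop_compose[OF bS] bop_compose[OF bop_cscale]\<close>)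
      show "norm (R h x) \<le> M * norm x" for x using M(2)[of h x] h by simp
    qed (use M in auto)
    then show "l' \<notin> sp (S h) \<and> (\<forall>x. norm (resolv l' (S h) x) \<le> M / (1 - 1 / 2) * norm x)"
      using l' not_in_sp[OF Q(1)] resolv_eq[OF Q(1)] by simp
  qed (use b1 b2 h1 M in auto)
next
  assume "uniform_resolvent S {l}"
  then obtain h0 C where h0: "h0 > 0" and C: "C \<ge> 0" and nsp: "\<And>h. 0 < h \<Longrightarrow> h < h0 \<Longrightarrow> l \<notin> sp (S h)"
      and bd: "\<And>h x. 0 < h \<Longrightarrow> h < h0 \<Longrightarrow> norm (resolv l (S h) x) \<le> C * norm x"
    using uniform_resolventE[of S "{l}"] by (metis singletonI)
  \<comment> \<open>The zero operator fills in the values of \<open>h\<close> where a resolvent need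
    not exist; this keeps the family bounded and does not affect limits at 0.\<close>
  define R where "R h = (if 0 < h \<and> h < h0 then resolv l (S h) else (\<lambda>x. 0))" for h
  have "bounded_family R"
    unfolding bounded_family_def
  proof (intro conjI ballI exI[of _ C])
    fix h :: real
    have R: "norm (R h x) \<le> C * norm x" for x using bd[of h x] C by (simp add: R_def)
    show "bop (R h)"
      using resolvD(1)[OF nsp, of h] by (auto simp: R_def bop_def bounded_linear_zero)
    show "onorm (R h) \<le> C" by (rule onorm_bound[OF C R])
  qed
  moreover have ev: "\<forall>\<^sub>F h in at_right 0. 0 < h \<and> h < h0"
    using h0 by (auto simp: eventually_at_right_field)
  have "((\<lambda>h. onorm (\<lambda>x. cscale l (R h x) - S h (R h x) - x)) \<longlongrightarrow> 0) (at_right 0)"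
    by (rule tendsto_eventually, rule eventually_mono[OF ev])
       (simp add: R_def resolvD(2)[OF nsp] onorm_zero)
  moreover have "((\<lambda>h. onorm (\<lambda>x. R h (cscale l x - S h x) - x)) \<longlongrightarrow> 0) (at_right 0)"
    by (rule tendsto_eventually, rule eventually_mono[OF ev])
       (simp add: R_def resolvD(3)[OF nsp] onorm_zero)
  ultimately show "l \<in> fam_resolvent_set S" by (auto simp: fam_resolvent_set_def)
qed

section \<open>Uniformity and compactness for a bounded family\<close>

context
  fixes T :: "real \<Rightarrow> 'a::complex_banach \<Rightarrow> 'a"
  assumes T: "bounded_family T"
begin

lemma family_bop: "0 < h \<Longrightarrow> h < 1 \<Longrightarrow> bop (T h)"
  using T by (auto simp: bounded_family_def)

lemma family_resolvent_iff: "l \<in> fam_resolvent_set T \<longleftrightarrow> uniform_resolvent T {l}"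
  by (rule fam_resolvent_set_iff[of 1]) (auto intro: family_bop)

text \<open>The perturbation radius depends only on the common bound \<open>C\<close>, so the same
  ball works for all small \<open>h\<close>.\<close>

lemma uniform_resolvent_ball:
  assumes "l \<in> fam_resolvent_set T"
  obtains r where "r > 0" "uniform_resolvent T (ball l r)"
proof -
  obtain h0 C where h0: "h0 > 0" and C: "C \<ge> 0" and nsp: "\<And>h. 0 < h \<Longrightarrow> h < h0 \<Longrightarrow> l \<notin> sp (T h)"
      and bd: "\<And>h x. 0 < h \<Longrightarrow> h < h0 \<Longrightarrow> norm (resolv l (T h) x) \<le> C * norm x"
    using uniform_resolventE[of T "{l}"] assms unfolding family_resolvent_iff by (metis singletonI)
  have "uniform_resolvent T (ball l (1 / (2 * (C + 1))))"
  proof (rule uniform_resolventI[of "min h0 1" "2 * C"])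
    fix h w assume h: "0 < h" "h < min h0 1" and w: "w \<in> ball l (1 / (2 * (C + 1)))"
    have "cmod (w - l) \<le> 1 / (2 * (C + 1))" using w by (simp add: dist_norm norm_minus_commute)
    then have "cmod (w - l) * C \<le> 1 / (2 * (C + 1)) * C" using C by (rule mult_right_mono)
    also have "\<dots> \<le> 1 / 2" using C by (simp add: field_simps)
    finally have "cmod (w - l) * C \<le> 1 / 2" .
    then show "w \<notin> sp (T h) \<and> (\<forall>x. norm (resolv w (T h) x) \<le> 2 * C * norm x)"
      using resolvent_perturb[OF family_bop nsp C bd, of h w] h by auto
  qed (use h0 C in auto)
  then show ?thesis using that[of "1 / (2 * (C + 1))"] C by simp
qed

text \<open>Passing to a finite subcover keeps the threshold for \<open>h\<close> positive and the
  bound finite.\<close>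

lemma uniform_resolvent_compact:
  assumes L: "compact L" "L \<subseteq> fam_resolvent_set T"
  shows "uniform_resolvent T L"
proof -
  have "\<exists>r. l \<in> L \<longrightarrow> r > 0 \<and> uniform_resolvent T (ball l r)" for l
    using uniform_resolvent_ball[of l] L(2) by blast
  then obtain r where r: "\<And>l. l \<in> L \<Longrightarrow> r l > 0" "\<And>l. l \<in> L \<Longrightarrow> uniform_resolvent T (ball l (r l))"
    by metis
  have cover: "L \<subseteq> (\<Union>l\<in>L. ball l (r l))" using r(1) by force
  obtain D where D: "D \<subseteq> L" "finite D" "L \<subseteq> (\<Union>l\<in>D. ball l (r l))"
    by (rule compactE_image[OF L(1) _ cover]) auto
  have "uniform_resolvent T (\<Union>l\<in>D. ball l (r l))"
    using D(2,1)
  proof (induction D rule: finite_induct)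
    case empty
    show ?case by (rule uniform_resolventI[of 1 0]) auto
  next
    case (insert l D)
    then show ?case using uniform_resolvent_Un[OF r(2)] by simp
  qed
  then show ?thesis using D(3) by (rule uniform_resolvent_mono)
qed

lemma compact_fam_sp: "compact (fam_sp T)"
proof -
  obtain M where M: "M \<ge> 0" "\<And>h x. h \<in> {0<..1} \<Longrightarrow> norm (T h x) \<le> M * norm x"
    using bounded_familyD[OF T] by metis
  have "l \<in> fam_resolvent_set T" if l: "cmod l > M" for l
    unfolding family_resolvent_iff
    by (rule uniform_resolventI[of 1 "1 / (cmod l - M)"])
       (use l resolvent_outside_ball[OF family_bop M(1) M(2)] in auto)
  then have "fam_sp T \<subseteq> cball 0 M" by (force simp: fam_sp_def not_less)
  moreover have "open (fam_resolvent_set T)"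
    unfolding open_contains_ball
  proof
    fix l assume "l \<in> fam_resolvent_set T"
    then obtain r where "r > 0" "uniform_resolvent T (ball l r)" by (rule uniform_resolvent_ball)
    then show "\<exists>r>0. ball l r \<subseteq> fam_resolvent_set T"
      using uniform_resolvent_mono unfolding subset_iff family_resolvent_iff by (intro exI[of _ r]) blast
  qed
  ultimately show ?thesis
    by (metis bounded_cball bounded_subset closed_Compl compact_eq_bounded_closed fam_sp_def)
qed

text \<open>For small \<open>h\<close> one cycle around the spectrum of the family serves all \<open>T h\<close> at once.\<close>

lemma family_calculus:
  assumes Om: "open Om" "fam_sp T \<subseteq> Om" and f: "f holomorphic_on Om"
  obtains h0 B where "h0 > 0" "h0 \<le> 1" "B \<ge> 0" "\<And>h. 0 < h \<Longrightarrow> h < h0 \<Longrightarrow> sp (T h) \<subseteq> Om"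
    "\<And>h. 0 < h \<Longrightarrow> h < h0 \<Longrightarrow> bop (hfc Om f (T h))"
    "\<And>h x. 0 < h \<Longrightarrow> h < h0 \<Longrightarrow> norm (hfc Om f (T h) x) \<le> B * norm x"
proof -
  obtain M where M: "M \<ge> 0" "\<And>h x. h \<in> {0<..1} \<Longrightarrow> norm (T h x) \<le> M * norm x"
    using bounded_familyD[OF T] by metis
  obtain \<Gamma> where \<Gamma>: "polynomial_paths \<Gamma>" "admissible_cycle Om (fam_sp T) \<Gamma>"
    using polynomial_admissible_cycle[OF compact_fam_sp Om] by metis
  note \<Gamma>c = admissible_cycleD[OF \<Gamma>(2)]
  have im: "cycle_image \<Gamma> \<subseteq> Om - fam_sp T" by (rule cycle_image_subset[OF \<Gamma>c(1)])
  define U where "U = Om \<inter> {z. z \<notin> cycle_image \<Gamma> \<and> cycle_index \<Gamma> z = 1}"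
  have U: "open U" unfolding U_def by (intro open_Int Om open_cycle_index_eq[OF \<Gamma>c(1)])
  have spU: "fam_sp T \<subseteq> U" using Om(2) \<Gamma>c(2) im by (auto simp: U_def)
  \<comment> \<open>The first part of \<open>L\<close> forces the spectra \<open>sp (T h)\<close>,
    which lie in \<open>cball 0 M\<close>, into \<open>U\<close>; the second gives resolvent bounds
    along the cycle. Both avoid the spectrum of the family.\<close>
  define L where "L = (cball 0 M - U) \<union> cycle_image \<Gamma>"
  have "compact L"
    unfolding L_def by (intro compact_Un compact_diff compact_cball U compact_cycle_image[OF \<Gamma>c(1)])
  moreover have "L \<subseteq> fam_resolvent_set T"
    using spU im by (auto simp: L_def fam_sp_def)
  ultimately have "uniform_resolvent T L" by (rule uniform_resolvent_compact)
  then obtain h0 C where h0: "h0 > 0" and C: "C \<ge> 0" and nsp: "\<And>h l. 0 < h \<Longrightarrow> h < h0 \<Longrightarrow> l \<in> L \<Longrightarrow> l \<notin> sp (T h)"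
      and bd: "\<And>h l x. 0 < h \<Longrightarrow> h < h0 \<Longrightarrow> l \<in> L \<Longrightarrow> norm (resolv l (T h) x) \<le> C * norm x"
    by (rule uniform_resolventE) blast
  have contf: "continuous_on (cycle_image \<Gamma>) f"
    using holomorphic_on_imp_continuous_on[OF f] by (rule continuous_on_subset) (use im in auto)
  obtain m where m: "m \<ge> 0" "\<And>(T :: 'a \<Rightarrow> 'a) C x. C \<ge> 0 \<Longrightarrow>
      (\<And>w. w \<in> cycle_image \<Gamma> \<Longrightarrow> norm (resolv w T x) \<le> C * norm x) \<Longrightarrow> norm (vcycle_integral \<Gamma> f T x) \<le> m * C * norm x"
    using vcycle_integral_bound[OF \<Gamma>(1) contf] by blast
  have spTU: "sp (T h) \<subseteq> U" if h: "0 < h" "h < min h0 1" for h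
  proof
    fix z assume z: "z \<in> sp (T h)"
    have "cmod z \<le> M"
      using resolvent_outside_ball(1)[OF family_bop M(1) M(2), of h z] z h by force
    then show "z \<in> U" using nsp[of h z] h z by (auto simp: L_def)
  qed
  have adm: "admissible_cycle Om (sp (T h)) \<Gamma>" if h: "0 < h" "h < min h0 1" for h
  proof -
    have "cycle_image \<Gamma> \<subseteq> Om - sp (T h)" using im nsp[of h] h by (auto simp: L_def)
    then have "is_cycle (Om - sp (T h)) \<Gamma>" by (rule is_cycle_cycle_image[OF \<Gamma>c(1)])
    then show ?thesis using spTU[OF h] \<Gamma>c(3) by (auto simp: admissible_cycle_iff U_def)
  qed
  have bound: "norm (vcycle_integral \<Gamma> f (T h) x) \<le> m * C * norm x" if h: "0 < h" "h < min h0 1" for h x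
    by (rule m(2)[OF C]) (use bd h in \<open>auto simp: L_def\<close>)
  show ?thesis
  proof (rule that[of "min h0 1" "m * C"])
    fix h assume h: "0 < h" "h < min h0 1"
    have Th: "bop (T h)" using family_bop h by simp
    show "sp (T h) \<subseteq> Om" using spTU[OF h] by (auto simp: U_def)
    show "bop (hfc Om f (T h))" "norm (hfc Om f (T h) x) \<le> m * C * norm x" for x
      using hfc_bop_bound[OF Th Om(1) f adm[OF h] bound[OF h]] by blast+
  qed (use h0 m C in auto)
qed

end

section \<open>The two inclusions of spectral mapping for families\<close>

theorem theorem27:
  fixes T :: "real \<Rightarrow> 'a::complex_banach \<Rightarrow> 'a"
    and Om :: "complex set" and f :: "complex \<Rightarrow> complex"
  assumes "bounded_family T"
    and "open Om"
    and "(\<Union>h\<in>{0<..1}. sp (T h)) \<subseteq> Om"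
    and "fam_sp T \<subseteq> Om"
    and "f analytic_on Om"
  shows "fam_sp (\<lambda>h. hfc Om f (T h)) = f ` fam_sp T"
proof -
  note T = assms(1) and Om = assms(2) and spOm = assms(4)
  have f: "f holomorphic_on Om" using assms(5) by (rule analytic_imp_holomorphic)
  obtain h1 where h1: "h1 > 0" "h1 \<le> 1" "\<And>h. 0 < h \<Longrightarrow> h < h1 \<Longrightarrow> sp (T h) \<subseteq> Om"
      "\<And>h. 0 < h \<Longrightarrow> h < h1 \<Longrightarrow> bop (hfc Om f (T h))"
    by (rule family_calculus[OF T Om spOm f]) blast
  have res_iff: "l \<in> fam_resolvent_set (\<lambda>h. hfc Om f (T h)) \<longleftrightarrow> uniform_resolvent (\<lambda>h. hfc Om f (T h)) {l}" for l
    by (rule fam_resolvent_set_iff[OF h1(1)]) (rule h1(4))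
  have bT: "bop (T h)" if "0 < h" "h < h1" for h using family_bop[OF T] that h1(2) by simp
  have "\<mu> \<in> fam_resolvent_set (\<lambda>h. hfc Om f (T h))" if \<mu>: "\<mu> \<notin> f ` fam_sp T" for \<mu>
  proof -
    \<comment> \<open>On this open set \<open>\<mu> - f\<close> has no zeros. It contains the
      spectrum of the family because \<open>\<mu>\<close> is not a value of \<open>f\<close> there,
      and hence \<open>sp (T h)\<close> for small \<open>h\<close>.\<close>
    define Om' where "Om' = Om \<inter> f -` (- {\<mu>})"
    define g where "g w = 1 / (\<mu> - f w)" for w
    have Om': "open Om'" unfolding Om'_def
      by (rule continuous_open_preimage[OF holomorphic_on_imp_continuous_on[OF f] Om]) auto
    have sub: "Om' \<subseteq> Om" by (auto simp: Om'_def)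
    have f': "f holomorphic_on Om'" using f sub by (rule holomorphic_on_subset)
    have \<mu>f: "(\<lambda>w. \<mu> - f w) holomorphic_on Om" by (intro holomorphic_intros f)
    have \<mu>f': "(\<lambda>w. \<mu> - f w) holomorphic_on Om'" by (intro holomorphic_intros f')
    have g: "g holomorphic_on Om'"
      unfolding g_def by (intro holomorphic_intros f') (auto simp: Om'_def)
    have sp': "fam_sp T \<subseteq> Om'" using \<mu> spOm by (auto simp: Om'_def)
    obtain h2 B where h2: "h2 > 0" "B \<ge> 0" "\<And>h. 0 < h \<Longrightarrow> h < h2 \<Longrightarrow> sp (T h) \<subseteq> Om'"
        "\<And>h. 0 < h \<Longrightarrow> h < h2 \<Longrightarrow> bop (hfc Om' g (T h))"
        "\<And>h x. 0 < h \<Longrightarrow> h < h2 \<Longrightarrow> norm (hfc Om' g (T h) x) \<le> B * norm x"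
      by (rule family_calculus[OF T Om' sp' g]) blast
    show ?thesis
      unfolding res_iff
    proof (rule uniform_resolventI[of "min h1 h2" B])
      fix h l assume h: "0 < h" "h < min h1 h2" and l: "l \<in> {\<mu>}"
      have Th: "bop (T h)" using bT h by simp
      have spO: "sp (T h) \<subseteq> Om" and spO': "sp (T h) \<subseteq> Om'" using h1(3) h2(3) h by simp_all
      \<comment> \<open>The product rule needs both factors on one domain, so
        \<open>\<mu> - f\<close> is restricted from \<open>Om\<close> to \<open>Om'\<close>.\<close>
      have minus: "cscale \<mu> x - hfc Om f (T h) x = hfc Om' (\<lambda>w. \<mu> - f w) (T h) x" for x
        by (simp add: hfc_const_minus[OF Th Om spO f] hfc_subdomain[OF Th Om Om' spO' sub \<mu>f])
      have one: "hfc Om' k (T h) x = x" if "\<And>w. w \<in> Om' \<Longrightarrow> k w = 1" for k x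
        using hfc_cong[OF Th Om' spO' holomorphic_on_const[of 1], of k x] that hfc_one[OF Th Om' spO', of x] by simp
      have "is_resolvent \<mu> (hfc Om f (T h)) (hfc Om' g (T h))"
        unfolding is_resolvent_def minus hfc_mult[OF Th Om' spO' \<mu>f' g] hfc_mult[OF Th Om' spO' g \<mu>f']
        using h2(4) h by (intro conjI allI one) (simp_all add: g_def, auto simp: Om'_def)
      then show "l \<notin> sp (hfc Om f (T h)) \<and> (\<forall>x. norm (resolv l (hfc Om f (T h)) x) \<le> B * norm x)"
        using l h h2(5) by (simp add: not_in_sp resolv_eq)
    qed (use h1 h2 in auto)
  qed
  \<comment> \<open>Applied in contrapositive form to \<open>l\<close> in \<open>fam_sp T\<close>,
    which lies in \<open>Om\<close> by hypothesis: then \<open>f l\<close> is in the spectrum of the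
    image family.\<close>
  moreover have "l \<in> fam_resolvent_set T" if l: "l \<in> Om" and res: "f l \<in> fam_resolvent_set (\<lambda>h. hfc Om f (T h))" for l
  proof -
    define k where "k w = (if w = l then deriv f l else (f w - f l) / (w - l))" for w
    have k: "k holomorphic_on Om"
      unfolding k_def by (rule pole_lemma[OF f]) (use l Om in \<open>simp add: interior_open\<close>)
    have fk: "(\<lambda>w. (l - w) * k w) = (\<lambda>w. f l - f w)"
      by (auto simp: k_def field_simps)
    obtain h2 B where h2: "h2 > 0" "B \<ge> 0" "\<And>h. 0 < h \<Longrightarrow> h < h2 \<Longrightarrow> bop (hfc Om k (T h))"
        "\<And>h x. 0 < h \<Longrightarrow> h < h2 \<Longrightarrow> norm (hfc Om k (T h) x) \<le> B * norm x"
      by (rule family_calculus[OF T Om spOm k]) blast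
    obtain h3 C where h3: "h3 > 0" "C \<ge> 0" "\<And>h. 0 < h \<Longrightarrow> h < h3 \<Longrightarrow> f l \<notin> sp (hfc Om f (T h))"
        "\<And>h x. 0 < h \<Longrightarrow> h < h3 \<Longrightarrow> norm (resolv (f l) (hfc Om f (T h)) x) \<le> C * norm x"
      by (rule uniform_resolventE[OF res[unfolded res_iff]]) blast
    show ?thesis
      unfolding family_resolvent_iff[OF T]
    proof (rule uniform_resolventI[of "min h1 (min h2 h3)" "B * C"])
      fix h l' assume h: "0 < h" "h < min h1 (min h2 h3)" and l': "l' \<in> {l}"
      have Th: "bop (T h)" using bT h by simp
      have spO: "sp (T h) \<subseteq> Om" using h1(3) h by simp
      have nsp: "f l \<notin> sp (hfc Om f (T h))" and kb: "bop (hfc Om k (T h))" using h3(3) h2(3) h by simp_all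
      define K Q where "K = hfc Om k (T h)" and "Q = resolv (f l) (hfc Om f (T h))"
      note Q = resolvD[OF nsp, folded Q_def]
      have lT: "cscale l (K x) - T h (K x) = cscale (f l) x - hfc Om f (T h) x" for x
        using hfc_linear_factor[OF Th Om spO k, of l x] hfc_const_minus[OF Th Om spO f, of "f l" x]
        by (simp add: fk K_def)
      have Tl: "K (cscale l x - T h x) = cscale (f l) x - hfc Om f (T h) x" for x
        using lT[of x] hfc_commute[OF Th Om spO k, of x] kb by (simp add: K_def bopD)
      have right: "cscale l (K (Q x)) - T h (K (Q x)) = x" for x by (simp add: lT Q(2))
      have left: "Q (K (cscale l x - T h x)) = x" for x by (simp add: Tl Q(3))
      \<comment> \<open>Commutation is obtained without the calculus: \<open>Q K\<close> is a left
        inverse and \<open>K Q\<close> a right inverse of \<open>l - T h\<close>, so they are equal,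
        and \<open>K Q\<close> is a two-sided inverse.\<close>
      have KQ: "K (Q y) = Q (K y)" for y
        using left[of "K (Q y)"] by (simp only: right)
      have "K (Q (cscale l x - T h x)) = x" for x
        by (simp only: KQ left)
      then have "is_resolvent l (T h) (\<lambda>x. K (Q x))"
        using right bop_compose[OF kb Q(1)] by (simp add: is_resolvent_def K_def)
      moreover have "norm (K (Q x)) \<le> B * C * norm x" for x
      proof -
        have "norm (K (Q x)) \<le> B * norm (Q x)" using h2(4) h by (simp add: K_def)
        also have "\<dots> \<le> B * (C * norm x)" using h3(4)[of h x] h h2(2) by (intro mult_left_mono) (auto simp: Q_def)
        finally show ?thesis by (simp add: mult.assoc)
      qed
      ultimately show "l' \<notin> sp (T h) \<and> (\<forall>x. norm (resolv l' (T h) x) \<le> B * C * norm x)"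
        using l' by (simp add: not_in_sp resolv_eq)
    qed (use h1 h2 h3 in auto)
  qed
  ultimately show ?thesis
    using spOm by (auto simp: fam_sp_def)
qed

end
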